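(* In the setting below, for every nonempty $A\subseteq[n]$: \[ \Pr_{\omega\sim\mathrm{Walk}(G,l)}\big(|\mathrm{estimate}(\tau_2(\omega,q(\omega)),q(\omega))-|A||>\varepsilon|A|\big)\le\delta. \]
   Context: $[N]:=\{0,\dots,N-1\}$. Fix integers $n\ge1$, reals $0<\varepsilon<1$ and $(\ln n)^{-1}\le\delta<1$. Let $l:=\lceil4\ln(2\delta^{-1})\rceil$, $b:=2^{\lceil\log_2(9\cdot2^{23}\varepsilon^{-2})\rceil}$, $k:=\lceil\tfrac{15}2\ln b+16\rceil$, $\lambda:=\min(\tfrac1{16},\exp(-l(\ln l)^3))$. Hash families: for $d\ge1$, identify $[2^d]$ with $\mathrm{GF}(2^d)$ via binary representation. For $k'\ge1$, $N\le2^d$, $c\le d$, $\mathcal H_{k'}([N],[2^c])$ is the uniform distribution over tuples $(a_0,\dots,a_{k'-1})\in\mathrm{GF}(2^d)^{k'}$, each giving $x\mapsto(\sum_ia_ix^i)\bmod2^c$ on $[N]$; $\mathcal G_{k'}([N])$ is uniform over the same tuples giving $x\mapsto\mathrm{tz}(\sum_ia_ix^i)$, $\mathrm{tz}(y)$ = number of trailing zeros of the $d$-bit representation of $y$ ($\mathrm{tz}(0)=d$); $d$ a fixed integer with $2^d\ge N$, $d\ge c$. $\Psi:=\mathcal G_2([n])\times\mathcal H_2([n],[2^5b^2])\times\mathcal H_k([2^5b^2],[b])$, $\psi=(f,g,h)$. Graphs: finite undirected multigraphs (loops allowed) with adjacency matrix $A=(a_{uv})$ counting edges; $d$-regular if symmetric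 with row sums $d$; a $\lambda$-expander if $d$-regular and the second largest absolute eigenvalue of $A$ is $\le d\lambda$. $\mathrm{Walk}(G,l)$: $w_0$ uniform on the vertex set, $w_{i+1}=u$ with probability $a_{w_iu}/d$. Let $G$ be a $\lambda$-expander with vertex set $\Psi$; a walk $\omega$ has vertices $\omega_0,\dots,\omega_{l-1}\in\Psi$. For fixed nonempty $A\subseteq[n]$: $\tau_0(\psi)[j]:=\max(\{f(a):a\in A,h(g(a))=j\}\cup\{-1\})$; $\tau_1(\psi,q)[j]:=\max(\tau_0(\psi)[j]-q,-1)$; $\tau_2(\omega,q)[i,j]:=\tau_1(\omega_i,q)[j]$; $q(\omega):=\min\{q\in\mathbb Z_{\ge0}:\sum_{i\in[l],j\in[b]}\lfloor\log_2(\tau_2(\omega,q)[i,j]+2)\rfloor\le33\,b\,l\}$. For a table $B:[l]\times[b]\to\mathbb Z$ and $q\ge0$, $\mathrm{estimate}(B,q)$: for each $i\in[l]$ let $s_i:=\max(0,\max_j(B[i,j]+q)-\log_2b+9)$, $p_i:=|\{j\in[b]:B[i,j]+q\ge s_i\}|$, $Y_i:=2^{s_i}\ln(1-p_i/b)/\ln(1-1/b)$ (with $Y_i:=+\infty$ if $p_i=b$); return the element at position $\lfloor l/2\rfloor$ (0-indexed) of the sorted list $Y_0,\dots,Y_{l-1}$. *)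

theory Defs
  imports "HOL-Probability.Probability" "HOL-Library.Z2"
    "HOL-Computational_Algebra.Polynomial" "HOL-Computational_Algebra.Polynomial_Factorial"
    "Jordan_Normal_Form.Char_Poly"
begin

text \<open>GF(2^d) is realised as GF(2)[X]/(p) for an irreducible polynomial p of degree d over
  GF(2) (type bit).  The number x in [2^d] corresponds to the residue polynomial whose
  coefficient of X^i is the i-th binary digit of x.\<close>

definition gf_of_nat :: "nat \<Rightarrow> nat \<Rightarrow> bit poly" where
  "gf_of_nat d x = (\<Sum>i<d. monom (of_bool (bit x i)) i)"

definition nat_of_gf :: "nat \<Rightarrow> bit poly \<Rightarrow> nat" where
  "nat_of_gf d q = (\<Sum>i<d. if coeff q i = 1 then 2 ^ i else 0)"

definition gf_eval :: "nat \<Rightarrow> bit poly \<Rightarrow> nat list \<Rightarrow> nat \<Rightarrow> nat" where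
  "gf_eval d p as x =
     nat_of_gf d ((\<Sum>i<length as. gf_of_nat d (as ! i) * gf_of_nat d x ^ i) mod p)"

definition tz :: "nat \<Rightarrow> nat \<Rightarrow> nat" where
  "tz d y = (if y = 0 then d else (LEAST i. bit y i))"

text \<open>Hash function of the family H (values reduced mod 2^c, here passed as M = 2^c)
  and of the family G (trailing zeros).\<close>
definition hashH :: "nat \<Rightarrow> bit poly \<Rightarrow> nat \<Rightarrow> nat list \<Rightarrow> nat \<Rightarrow> nat" where
  "hashH d p M as x = gf_eval d p as x mod M"

definition hashG :: "nat \<Rightarrow> bit poly \<Rightarrow> nat list \<Rightarrow> nat \<Rightarrow> nat" where
  "hashG d p as x = tz d (gf_eval d p as x)"

definition seeds :: "nat \<Rightarrow> nat \<Rightarrow> nat list set" where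
  "seeds d k' = {as. length as = k' \<and> set as \<subseteq> {..<2 ^ d}}"

definition enum_of :: "'v set \<Rightarrow> nat \<Rightarrow> 'v" where
  "enum_of V = (SOME e. bij_betw e {..<card V} V)"

definition adj_mat :: "'v set \<Rightarrow> ('v \<Rightarrow> 'v \<Rightarrow> nat) \<Rightarrow> complex mat" where
  "adj_mat V a = Matrix.mat (card V) (card V)
     (\<lambda>(i, j). of_nat (a (enum_of V i) (enum_of V j)))"

definition eigenvalues_mset :: "'v set \<Rightarrow> ('v \<Rightarrow> 'v \<Rightarrow> nat) \<Rightarrow> complex multiset" where
  "eigenvalues_mset V a = proots (char_poly (adj_mat V a))"

definition second_abs_eig :: "'v set \<Rightarrow> ('v \<Rightarrow> 'v \<Rightarrow> nat) \<Rightarrow> real" where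
  "second_abs_eig V a =
     (let xs = rev (sorted_list_of_multiset (image_mset cmod (eigenvalues_mset V a)))
      in if length xs < 2 then 0 else xs ! 1)"

definition regular :: "'v set \<Rightarrow> ('v \<Rightarrow> 'v \<Rightarrow> nat) \<Rightarrow> nat \<Rightarrow> bool" where
  "regular V a D \<longleftrightarrow> finite V \<and> (\<forall>u\<in>V. \<forall>v\<in>V. a u v = a v u) \<and> (\<forall>u\<in>V. (\<Sum>v\<in>V. a u v) = D)"

definition expander :: "'v set \<Rightarrow> ('v \<Rightarrow> 'v \<Rightarrow> nat) \<Rightarrow> nat \<Rightarrow> real \<Rightarrow> bool" where
  "expander V a D lam \<longleftrightarrow> regular V a D \<and> second_abs_eig V a \<le> real D * lam"

definition walk_step :: "'v set \<Rightarrow> ('v \<Rightarrow> 'v \<Rightarrow> nat) \<Rightarrow> 'v \<Rightarrow> 'v pmf" where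
  "walk_step V a v = pmf_of_multiset (\<Sum>u\<in>V. replicate_mset (a v u) u)"

fun walk_from :: "'v set \<Rightarrow> ('v \<Rightarrow> 'v \<Rightarrow> nat) \<Rightarrow> nat \<Rightarrow> 'v \<Rightarrow> 'v list pmf" where
  "walk_from V a 0 v = return_pmf [v]"
| "walk_from V a (Suc m) v = bind_pmf (walk_step V a v) (\<lambda>u. map_pmf (Cons v) (walk_from V a m u))"

text \<open>Walk(G,l): list of the l vertices w_0,...,w_{l-1}, w_0 uniform on V.\<close>
definition walk :: "'v set \<Rightarrow> ('v \<Rightarrow> 'v \<Rightarrow> nat) \<Rightarrow> nat \<Rightarrow> 'v list pmf" where
  "walk V a l = bind_pmf (pmf_of_set V) (walk_from V a (l - 1))"

type_synonym seed = "nat list \<times> nat list \<times> nat list"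

text \<open>FE, GE, HE evaluate the hash functions given by the seeds f, g, h.\<close>
definition tau0 :: "(nat list \<Rightarrow> nat \<Rightarrow> nat) \<Rightarrow> (nat list \<Rightarrow> nat \<Rightarrow> nat) \<Rightarrow> (nat list \<Rightarrow> nat \<Rightarrow> nat)
    \<Rightarrow> nat set \<Rightarrow> seed \<Rightarrow> nat \<Rightarrow> int" where
  "tau0 FE GE HE A \<psi> j = (case \<psi> of (f, g, h) \<Rightarrow>
     Max ({int (FE f a) | a. a \<in> A \<and> HE h (GE g a) = j} \<union> {-1}))"

definition tau1 :: "(nat list \<Rightarrow> nat \<Rightarrow> nat) \<Rightarrow> (nat list \<Rightarrow> nat \<Rightarrow> nat) \<Rightarrow> (nat list \<Rightarrow> nat \<Rightarrow> nat)
    \<Rightarrow> nat set \<Rightarrow> seed \<Rightarrow> nat \<Rightarrow> nat \<Rightarrow> int" where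
  "tau1 FE GE HE A \<psi> q j = max (tau0 FE GE HE A \<psi> j - int q) (-1)"

definition tau2 :: "(nat list \<Rightarrow> nat \<Rightarrow> nat) \<Rightarrow> (nat list \<Rightarrow> nat \<Rightarrow> nat) \<Rightarrow> (nat list \<Rightarrow> nat \<Rightarrow> nat)
    \<Rightarrow> nat set \<Rightarrow> seed list \<Rightarrow> nat \<Rightarrow> nat \<Rightarrow> nat \<Rightarrow> int" where
  "tau2 FE GE HE A \<omega> q i j = tau1 FE GE HE A (\<omega> ! i) q j"

definition qfun :: "(nat list \<Rightarrow> nat \<Rightarrow> nat) \<Rightarrow> (nat list \<Rightarrow> nat \<Rightarrow> nat) \<Rightarrow> (nat list \<Rightarrow> nat \<Rightarrow> nat)
    \<Rightarrow> nat set \<Rightarrow> nat \<Rightarrow> nat \<Rightarrow> seed list \<Rightarrow> nat" where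
  "qfun FE GE HE A l b \<omega> = (LEAST q::nat.
     (\<Sum>i<l. \<Sum>j<b. \<lfloor>log 2 (real_of_int (tau2 FE GE HE A \<omega> q i j) + 2)\<rfloor>) \<le> int (33 * b * l))"

definition estimate :: "nat \<Rightarrow> nat \<Rightarrow> (nat \<Rightarrow> nat \<Rightarrow> int) \<Rightarrow> nat \<Rightarrow> ereal" where
  "estimate l b B q =
     (let s = (\<lambda>i. max 0 (real_of_int (Max {B i j + int q | j. j < b}) - log 2 (real b) + 9));
          p = (\<lambda>i. card {j. j < b \<and> real_of_int (B i j + int q) \<ge> s i});
          Y = (\<lambda>i. if p i = b then (\<infinity> :: ereal)
                   else ereal (2 powr (s i) * ln (1 - real (p i) / real b) / ln (1 - 1 / real b)))
      in sort (map Y [0..<l]) ! (l div 2))"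

end

theory Submission
  imports Defs "Jordan_Normal_Form.Schur_Decomposition"
begin

text \<open>
  For a single seed \<open>(f, g, h)\<close> the row estimate is accurate except with probability 1/16: by
  Chebyshev the maximal level of \<open>f\<close> on \<open>A\<close> is \<open>log\<^sub>2 |A| + O(1)\<close> and the number of elements
  above the cutoff level is close to its mean, \<open>g\<close> is injective on these elements, and the number
  of bins they occupy under \<open>h\<close> concentrates, because truncated inclusion-exclusion shows that
  \<open>k\<close>-wise independence reproduces the first two moments of the independent case.

  Write \<open>Z\<close> for a function on the vertices with values in \<open>[0, M]\<close>. Then the expectation of the
  product of the \<open>Z(\<omega>\<^sub>i)\<close> along a walk of length \<open>l\<close> is at most \<open>(E Z + \<lambda> M)\<^sup>l\<close>.
  For \<open>Z\<close> equal to 8 on the inaccurate seeds and 1 elsewhere this bounds the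
  probability that half of the rows are inaccurate. For \<open>Z\<close> a truncation of the average
  counter it bounds, via Jensen's inequality, the probability that the subsampling level \<open>q\<close>
  exceeds the value up to which it does not affect the accurate rows.
\<close>

text \<open>The level \<open>qfun\<close> is computed from the whole walk, so no row can be analysed
  at a level fixed in advance. A seed therefore counts as accurate only if its row estimate is
  within the error at every level up to \<open>qmax\<close>, a threshold that depends on
  \<open>A\<close> and \<open>b\<close> alone. This is affordable because a row reads only the
  counters at or above its cutoff \<open>max_level f + 9 - r\<close>, and no level up to
  \<open>qmax\<close> passes that cutoff unless the maximal level is too small. A wrong result then
  forces one of two events that no longer mention the random level: half of the rows are inaccurate,
  or the bit budget is exceeded at \<open>qmax\<close>.

  The walk bound charges \<open>lam * M\<close> per step, so the average counter is cut at
  \<open>M = 2 ^ 31 / lam\<close>. The charge becomes the constant \<open>2 ^ 31\<close>, which the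
  budget of 33 bits absorbs, and passing the cut is unlikely because \<open>lam\<close> is at most
  \<open>exp (- l)\<close>. The seeds are uniform on finite sets, so statements about one vertex
  take the form of inequalities between cardinalities.\<close>

section \<open>Polynomial hash families over a finite field\<close>

text \<open>A polynomial over the integral domain R/(p) with more roots than its degree vanishes;
  divisibility in R stands in for the quotient ring. Splitting off a root by synthetic division
  leaves \<open>(y - x) * poly Q y\<close>, and primality of \<open>p\<close> cancels
  \<open>y - x\<close>, since distinct elements of \<open>S\<close> are incongruent.\<close>

lemma coeffs_dvd_if_many_roots:
  fixes p :: "'a :: idom" and F :: "'a poly"
  assumes p: "prime_elem p"
  assumes "finite S" "degree F < card S"
    and "\<And>x y. x \<in> S \<Longrightarrow> y \<in> S \<Longrightarrow> p dvd x - y \<Longrightarrow> x = y"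
    and "\<And>x. x \<in> S \<Longrightarrow> p dvd poly F x"
  shows "p dvd coeff F i"
  using assms(2-)
proof (induction "degree F" arbitrary: F S i)
  case 0
  then obtain c where F: "F = [:c:]" by (metis degree_0_id)
  from 0 obtain x where "x \<in> S" by fastforce
  with 0 F have "p dvd c" by force
  then show ?case using F by (cases i) auto
next
  case (Suc m)
  from Suc.prems(2) obtain x where x: "x \<in> S" by fastforce
  define Q where "Q = synthetic_div F x"
  have F: "F = [:-x,1:] * Q + [:poly F x:]"
    using synthetic_div_correct'[of x F] by (simp add: Q_def)
  have dQ: "m = degree Q" using Suc.hyps(2) by (simp add: Q_def degree_synthetic_div)
  have "p dvd poly Q y" if y: "y \<in> S - {x}" for y
  proof -
    have "poly F y = (y - x) * poly Q y + poly F x" by (subst F) (simp add: algebra_simps)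
    hence "(y - x) * poly Q y = poly F y - poly F x" by simp
    hence "p dvd (y - x) * poly Q y" using Suc.prems(4) x y by (simp add: dvd_diff)
    thus ?thesis using p y x Suc.prems(3)[of y x] prime_elem_dvd_multD by blast
  qed
  hence IH: "p dvd coeff Q j" for j
    using Suc.prems x by (intro Suc.hyps(1)[OF dQ, of "S - {x}"]) (use Suc.hyps(2) dQ in auto)
  have "coeff F i = coeff ([:-x,1:] * Q) i + coeff [:poly F x:] i" by (subst F) simp
  moreover have "p dvd coeff ([:-x,1:] * Q) i"
    using IH by (auto simp: coeff_pCons split: nat.split)
  moreover have "p dvd coeff [:poly F x:] i" using Suc.prems(4)[OF x] by (auto simp: coeff_pCons split: nat.split)
  ultimately show ?case by auto
qed

lemma coeff_gf_of_nat: "coeff (gf_of_nat d x) i = (if i < d then of_bool (bit x i) else 0)"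
proof -
  have "coeff (gf_of_nat d x) i = (\<Sum>j<d. if j = i then of_bool (bit x j) else 0)"
    unfolding gf_of_nat_def coeff_sum by (intro sum.cong) auto
  thus ?thesis by simp
qed

lemma degree_gf_of_nat: "d > 0 \<Longrightarrow> degree (gf_of_nat d x) < d"
  by (intro degree_lessI) (auto simp: coeff_gf_of_nat)

lemma gf_of_nat_inj:
  assumes "gf_of_nat d x = gf_of_nat d y" "x < 2 ^ d" "y < 2 ^ d"
  shows "x = y"
proof -
  have "bit x i = bit y i" if "i < d" for i
    using arg_cong[OF assms(1), of "\<lambda>q. coeff q i"] that
    by (cases "bit x i"; cases "bit y i") (simp_all add: coeff_gf_of_nat)
  moreover have "take_bit d x = x" "take_bit d y = y" using assms by (auto simp: take_bit_nat_eq_self)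
  ultimately show ?thesis by (metis bit_take_bit_iff bit_eq_iff)
qed

lemma nat_of_gf_less: "nat_of_gf d q < 2 ^ d"
proof -
  have "nat_of_gf d q \<le> (\<Sum>i<d. 2 ^ i)" unfolding nat_of_gf_def by (intro sum_mono) auto
  also have "\<dots> < 2 ^ d" by (induction d) auto
  finally show ?thesis .
qed

lemma bit_nat_of_gf: "bit (nat_of_gf d q) i \<longleftrightarrow> i < d \<and> coeff q i = 1"
proof -
  have eq: "nat_of_gf d q = horner_sum of_bool 2 (map (\<lambda>i. coeff q i = 1) [0..<d])"
    unfolding nat_of_gf_def horner_sum_eq_sum by (intro sum.cong) auto
  show ?thesis unfolding eq by (auto simp: bit_horner_sum_bit_iff)
qed

lemma nat_of_gf_inj:
  assumes "nat_of_gf d q = nat_of_gf d q'" "degree q < d" "degree q' < d"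
  shows "q = q'"
proof (rule poly_eqI)
  fix i
  have "(i < d \<and> coeff q i = 1) = (i < d \<and> coeff q' i = 1)"
    using assms(1) by (metis bit_nat_of_gf)
  thus "coeff q i = coeff q' i"
    using assms(2,3) by (cases "i < d"; cases "coeff q i"; cases "coeff q' i") (simp_all add: coeff_eq_0)
qed

lemma gf_eval_less: "gf_eval d p as x < 2 ^ d"
  unfolding gf_eval_def by (rule nat_of_gf_less)

lemma card_seeds: "card (seeds d k) = (2 ^ d) ^ k" and finite_seeds: "finite (seeds d k)"
  using card_lists_length_eq[of "{..<2 ^ d::nat}" k] finite_lists_length_eq[of "{..<2 ^ d::nat}" k]
  unfolding seeds_def by (simp_all add: conj_commute)

text \<open>Two seeds with equal values on \<open>X\<close> differ by a polynomial \<open>F\<close>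
  of degree below \<open>card X\<close> with \<open>card X\<close> roots modulo \<open>p\<close>. So
  \<open>p\<close> divides all coefficients of \<open>F\<close>, and these have degree below
  \<open>degree p\<close>, hence vanish.\<close>

lemma gf_eval_inj:
  assumes p: "irreducible p" "degree p = d" and X: "X \<subseteq> {..<2 ^ d}"
  shows "inj_on (\<lambda>as. restrict (gf_eval d p as) X) (seeds d (card X))"
proof (rule inj_onI)
  fix as bs
  assume as: "as \<in> seeds d (card X)" and bs: "bs \<in> seeds d (card X)"
    and eq: "restrict (gf_eval d p as) X = restrict (gf_eval d p bs) X"
  have len: "length as = card X" "length bs = card X" using as bs by (auto simp: seeds_def)
  have prime: "prime_elem p" using p(1) by (rule field_poly_irreducible_imp_prime)
  have d0: "d > 0" using p by (metis gr0I irreducible_def is_unit_iff_degree)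
  have finX: "finite X" using X finite_subset by blast
  define F where "F = (\<Sum>i<card X. monom (gf_of_nat d (as ! i) - gf_of_nat d (bs ! i)) i)"
  have coeffF: "coeff F i = (if i < card X then gf_of_nat d (as ! i) - gf_of_nat d (bs ! i) else 0)" for i
  proof -
    have "coeff F i = (\<Sum>j<card X. if j = i then gf_of_nat d (as ! j) - gf_of_nat d (bs ! j) else 0)"
      unfolding F_def coeff_sum by (intro sum.cong) auto
    thus ?thesis by simp
  qed
  show "as = bs"
  proof (cases "X = {}")
    case True
    thus ?thesis using len by simp
  next
    case False
    hence c0: "card X > 0" using finX by auto
    let ?S = "gf_of_nat d ` X"
    have injS: "inj_on (gf_of_nat d) X"
      using X gf_of_nat_inj by (intro inj_onI) blast
    have dvdp: "q = 0" if "p dvd q" "degree q < d" for q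
      using that p by (metis dvd_imp_degree_le not_less)
    have "p dvd coeff F i" for i
    proof (rule coeffs_dvd_if_many_roots[OF prime, of ?S])
      show "finite ?S" using finX by simp
      have "degree F < card X" using c0 by (intro degree_lessI) (auto simp: coeffF)
      thus "degree F < card ?S" by (simp add: card_image[OF injS])
      fix x y assume xy: "x \<in> ?S" "y \<in> ?S" "p dvd x - y"
      have "degree (x - y) < d" using xy degree_gf_of_nat[OF d0] by (auto intro: degree_diff_less)
      thus "x = y" using dvdp[OF xy(3)] by simp
    next
      fix y assume "y \<in> ?S"
      then obtain x where x: "x \<in> X" "y = gf_of_nat d x" by auto
      define e where "e = (\<lambda>as. \<Sum>i<card X. gf_of_nat d (as ! i) * y ^ i)"
      have "gf_eval d p as x = gf_eval d p bs x" using eq x by (metis restrict_apply')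
      hence "nat_of_gf d (e as mod p) = nat_of_gf d (e bs mod p)"
        unfolding gf_eval_def len e_def x by simp
      moreover have "degree (q mod p) < d" for q
        using p d0 by (metis degree_0 degree_mod_less' gr0I mod_by_0 not_gr_zero degree_mod_less)
      ultimately have "e as mod p = e bs mod p" using nat_of_gf_inj by blast
      hence "p dvd e as - e bs" by (simp add: mod_eq_dvd_iff)
      also have "e as - e bs = poly F y"
        unfolding e_def F_def by (simp add: poly_sum poly_monom sum_subtractf left_diff_distrib)
      finally show "p dvd poly F y" .
    qed
    moreover have "degree (coeff F i) < d" if "i < card X" for i
      using that degree_gf_of_nat[OF d0] by (auto simp: coeffF intro: degree_diff_less)
    ultimately have "coeff F i = 0" if "i < card X" for i
      using that dvdp by blast
    hence "gf_of_nat d (as ! i) = gf_of_nat d (bs ! i)" if "i < card X" for i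
      using that by (metis coeffF right_minus_eq)
    moreover have "as ! i < 2 ^ d" "bs ! i < 2 ^ d" if "i < card X" for i
      using as bs that by (auto simp: seeds_def subset_iff)
    ultimately have "as ! i = bs ! i" if "i < card X" for i
      using that gf_of_nat_inj by blast
    thus ?thesis using len by (intro nth_equalityI) auto
  qed
qed

text \<open>Interpolation without an explicit formula: the evaluation map is injective between
  finite sets of equal size.\<close>

lemma gf_eval_bij:
  assumes p: "irreducible p" "degree p = d" and X: "X \<subseteq> {..<2 ^ d}"
  shows "bij_betw (\<lambda>as. restrict (gf_eval d p as) X) (seeds d (card X)) (X \<rightarrow>\<^sub>E {..<2 ^ d})"
proof -
  have finX: "finite X" using X finite_subset by blast
  let ?F = "\<lambda>as. restrict (gf_eval d p as) X"
  have "?F ` seeds d (card X) = X \<rightarrow>\<^sub>E {..<2 ^ d}"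
  proof (rule card_subset_eq)
    show "finite (X \<rightarrow>\<^sub>E {..<2 ^ d :: nat})" using finX by (intro finite_PiE) auto
    show "?F ` seeds d (card X) \<subseteq> X \<rightarrow>\<^sub>E {..<2 ^ d}" by (auto simp: gf_eval_less)
    show "card (?F ` seeds d (card X)) = card (X \<rightarrow>\<^sub>E {..<2 ^ d :: nat})"
      using card_image[OF gf_eval_inj[OF p X]] finX by (simp add: card_seeds card_PiE)
  qed
  thus ?thesis using gf_eval_inj[OF p X] by (simp add: bij_betw_def)
qed

text \<open>Adding \<open>k - card X\<close> unconstrained points makes the number of points equal
  to the number of coefficients, and the seeds then correspond to the product set
  \<open>PiE X' Y'\<close>. The bound \<open>k \<le> 2 ^ d\<close> guarantees that enough points
  exist.\<close>

lemma gf_eval_indep: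
  assumes p: "irreducible p" "degree p = d" and X: "X \<subseteq> {..<2 ^ d}"
    and k: "card X \<le> k" "k \<le> 2 ^ d" and Y: "\<And>x. x \<in> X \<Longrightarrow> Y x \<subseteq> {..<2 ^ d}"
  shows "card {as \<in> seeds d k. \<forall>x\<in>X. gf_eval d p as x \<in> Y x} * (2 ^ d) ^ card X
       = (2 ^ d) ^ k * (\<Prod>x\<in>X. card (Y x))"
proof -
  have finX: "finite X" using X finite_subset by blast
  have "k - card X \<le> card ({..<2 ^ d} - X)" using X k finX by (subst card_Diff_subset) auto
  then obtain Z where Z: "Z \<subseteq> {..<2 ^ d} - X" "card Z = k - card X" "finite Z"
    by (metis obtain_subset_with_card_n finite_Diff finite_lessThan finite_subset)
  define X' where "X' = X \<union> Z"
  define Y' where "Y' = (\<lambda>x. if x \<in> X then Y x else {..<2 ^ d})"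
  have X': "X' \<subseteq> {..<2 ^ d}" using X Z by (auto simp: X'_def)
  have cX': "card X' = k" unfolding X'_def using Z finX k by (subst card_Un_disjoint) auto
  let ?F = "\<lambda>as. restrict (gf_eval d p as) X'"
  let ?L = "{as \<in> seeds d k. \<forall>x\<in>X. gf_eval d p as x \<in> Y x}"
  have bij: "bij_betw ?F (seeds d k) (X' \<rightarrow>\<^sub>E {..<2 ^ d})"
    using gf_eval_bij[OF p X'] cX' by simp
  have "?F ` ?L = PiE X' Y'"
  proof
    show "?F ` ?L \<subseteq> PiE X' Y'" by (auto simp: Y'_def gf_eval_less)
    show "PiE X' Y' \<subseteq> ?F ` ?L"
    proof
      fix y assume y: "y \<in> PiE X' Y'"
      have "PiE X' Y' \<subseteq> X' \<rightarrow>\<^sub>E {..<2 ^ d}"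
        using Y by (intro PiE_mono) (auto simp: Y'_def)
      with y bij obtain as where as: "as \<in> seeds d k" "y = ?F as"
        unfolding bij_betw_def by blast
      have "gf_eval d p as x \<in> Y x" if "x \<in> X" for x
      proof -
        have "y x \<in> Y' x" using y that by (auto simp: X'_def)
        thus ?thesis using that as by (simp add: X'_def Y'_def)
      qed
      thus "y \<in> ?F ` ?L" using as by auto
    qed
  qed
  moreover have "inj_on ?F ?L" using bij unfolding bij_betw_def by (auto intro: inj_on_subset)
  ultimately have "card ?L = card (PiE X' Y')" using card_image[of ?F ?L] by simp
  also have "\<dots> = (\<Prod>x\<in>X'. card (Y' x))" using finX Z by (intro card_PiE) (auto simp: X'_def)
  also have "\<dots> = (\<Prod>x\<in>X. card (Y' x)) * (\<Prod>x\<in>Z. card (Y' x))"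
    unfolding X'_def using finX Z by (intro prod.union_disjoint) auto
  also have "(\<Prod>x\<in>X. card (Y' x)) = (\<Prod>x\<in>X. card (Y x))" by (intro prod.cong) (auto simp: Y'_def)
  also have "(\<Prod>x\<in>Z. card (Y' x)) = (\<Prod>x\<in>Z. 2 ^ d)"
    using Z by (intro prod.cong) (auto simp: Y'_def)
  also have "\<dots> = (2 ^ d) ^ (k - card X)" using Z by simp
  finally show ?thesis using k by (simp add: power_add[symmetric])
qed

section \<open>Trailing zeros and residue classes\<close>

lemma tz_le: "y < 2 ^ d \<Longrightarrow> tz d y \<le> d"
proof -
  assume y: "y < 2 ^ d"
  show ?thesis
  proof (cases "y = 0")
    case False
    then obtain i where "bit y i" by (metis bit_eq_iff bit_0_eq bot_apply bot_bool_def)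
    moreover have "i < d" using \<open>bit y i\<close> y by (metis bit_take_bit_iff take_bit_nat_eq_self)
    ultimately have "(LEAST i. bit y i) \<le> d" using Least_le[of "bit y" i] by simp
    thus ?thesis using False by (simp add: tz_def)
  qed (simp add: tz_def)
qed

text \<open>The bound on \<open>u\<close> concerns \<open>y = 0\<close>, which is divisible by every
  power of two while its \<open>tz\<close> is only \<open>d\<close>.\<close>

lemma tz_ge_iff:
  assumes "u \<le> d"
  shows "u \<le> tz d y \<longleftrightarrow> 2 ^ u dvd y"
proof (cases "y = 0")
  case False
  then obtain i where i: "bit y i" by (metis bit_eq_iff bit_0_eq bot_apply bot_bool_def)
  have "u \<le> (LEAST i. bit y i) \<longleftrightarrow> (\<forall>j<u. \<not> bit y j)"
  proof
    assume "u \<le> (LEAST i. bit y i)"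
    thus "\<forall>j<u. \<not> bit y j" by (meson not_less_Least order.strict_trans2)
  next
    assume "\<forall>j<u. \<not> bit y j"
    moreover have "bit y (LEAST i. bit y i)" using i by (rule LeastI)
    ultimately show "u \<le> (LEAST i. bit y i)" by (metis not_le)
  qed
  also have "\<dots> \<longleftrightarrow> take_bit u y = 0" by (auto simp: bit_eq_iff bit_take_bit_iff)
  also have "\<dots> \<longleftrightarrow> 2 ^ u dvd y" by (simp add: take_bit_eq_mod dvd_eq_mod_eq_0)
  finally show ?thesis using False by (simp add: tz_def)
qed (use assms in \<open>simp add: tz_def\<close>)

lemma card_residue_set:
  assumes "c \<le> d" "J \<subseteq> {..<2 ^ c}"
  shows "card {y \<in> {..<2 ^ d :: nat}. y mod 2 ^ c \<in> J} = card J * 2 ^ (d - c)"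
proof -
  let ?f = "\<lambda>(j, z). z * 2 ^ c + j :: nat"
  have eq: "(2::nat) ^ d = 2 ^ c * 2 ^ (d - c)" using assms(1) by (simp flip: power_add)
  have "?f ` (J \<times> {..<2 ^ (d - c)}) = {y \<in> {..<2 ^ d :: nat}. y mod 2 ^ c \<in> J}"
  proof (intro equalityI subsetI)
    fix y assume "y \<in> ?f ` (J \<times> {..<2 ^ (d - c)})"
    then obtain j z where jz: "j \<in> J" "z < 2 ^ (d - c)" "y = z * 2 ^ c + j" by auto
    have j: "j < 2 ^ c" using jz(1) assms(2) by auto
    have "z * 2 ^ c + j < Suc z * 2 ^ c" using j by simp
    also have "\<dots> \<le> 2 ^ (d - c) * 2 ^ c" using jz(2) by (intro mult_right_mono) auto
    finally show "y \<in> {y \<in> {..<2 ^ d :: nat}. y mod 2 ^ c \<in> J}"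
      using jz j eq by (simp add: mult.commute)
  next
    fix y assume y: "y \<in> {y \<in> {..<2 ^ d :: nat}. y mod 2 ^ c \<in> J}"
    hence "y div 2 ^ c < 2 ^ (d - c)" using eq by (simp add: less_mult_imp_div_less mult.commute)
    moreover have "y = ?f (y mod 2 ^ c, y div 2 ^ c)" using div_mult_mod_eq[of y "2 ^ c"] by simp
    ultimately show "y \<in> ?f ` (J \<times> {..<2 ^ (d - c)})" using y by blast
  qed
  moreover have "inj_on ?f (J \<times> {..<2 ^ (d - c)})"
  proof (rule inj_onI, clarify)
    fix j z j' z' assume j: "j \<in> J" "j' \<in> J" and e: "z * 2 ^ c + j = z' * 2 ^ c + j'"
    have jl: "j < 2 ^ c" "j' < 2 ^ c" using j assms(2) by auto
    have "(z * 2 ^ c + j) mod 2 ^ c = (z' * 2 ^ c + j') mod 2 ^ c" using e by simp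
    hence "j = j'" using jl by simp
    thus "j = j' \<and> z = z'" using e by simp
  qed
  ultimately show ?thesis using card_image[of ?f "J \<times> {..<2 ^ (d - c)}"] by (simp add: card_cartesian_product)
qed

lemma gf_eval_indep_real:
  assumes p: "irreducible p" "degree p = d" and X: "X \<subseteq> {..<2 ^ d}"
    and k: "card X \<le> k" "k \<le> 2 ^ d" and Y: "Y \<subseteq> {..<2 ^ d}"
  shows "real (card {as \<in> seeds d k. \<forall>x\<in>X. gf_eval d p as x \<in> Y})
       = real (card (seeds d k)) * (real (card Y) / 2 ^ d) ^ card X"
proof -
  have "real (card {as \<in> seeds d k. \<forall>x\<in>X. gf_eval d p as x \<in> Y} * (2 ^ d) ^ card X)
      = real ((2 ^ d) ^ k * (\<Prod>x\<in>X. card Y))"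
    using gf_eval_indep[OF p X k, of "\<lambda>_. Y"] Y by simp
  thus ?thesis by (simp add: card_seeds power_divide field_simps)
qed

lemma pow2_diff_ratio: "c \<le> d \<Longrightarrow> (2::real) ^ (d - c) / 2 ^ d = 1 / 2 ^ c"
  by (simp add: power_diff)

lemma hashH_indep:
  assumes p: "irreducible p" "degree p = d" and X: "X \<subseteq> {..<2 ^ d}"
    and k: "card X \<le> k" "k \<le> 2 ^ d" and M: "M = 2 ^ c" "M \<le> 2 ^ d" and J: "J \<subseteq> {..<M}"
  shows "real (card {as \<in> seeds d k. \<forall>x\<in>X. hashH d p M as x \<in> J})
       = real (card (seeds d k)) * (real (card J) / real M) ^ card X"
proof -
  have c: "c \<le> d" using M by simp
  let ?Y = "{y \<in> {..<2 ^ d :: nat}. y mod 2 ^ c \<in> J}"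
  have "{as \<in> seeds d k. \<forall>x\<in>X. hashH d p M as x \<in> J} = {as \<in> seeds d k. \<forall>x\<in>X. gf_eval d p as x \<in> ?Y}"
    using gf_eval_less by (auto simp: hashH_def M)
  moreover have "real (card ?Y) / 2 ^ d = real (card J) * (2 ^ (d - c) / 2 ^ d)"
    unfolding card_residue_set[OF c J[unfolded M]] by simp
  moreover have "?Y \<subseteq> {..<2 ^ d}" by auto
  ultimately show ?thesis using gf_eval_indep_real[OF p X k, of ?Y] by (simp add: pow2_diff_ratio[OF c] M)
qed

text \<open>A collision is a disjoint union over the common value \<open>j\<close>; pairwise
  independence gives each of the \<open>M\<close> values the probability
  \<open>1 / M^2\<close>.\<close>

lemma hashH_collision:
  assumes p: "irreducible p" "degree p = d" and xy: "x < 2 ^ d" "y < 2 ^ d" "x \<noteq> y"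
    and M: "M = 2 ^ c" "M \<le> 2 ^ d"
  shows "real (card {as \<in> seeds d 2. hashH d p M as x = hashH d p M as y}) = real (card (seeds d 2)) / real M"
proof -
  have d2: "2 \<le> (2::nat) ^ d" using xy by linarith
  have M0: "M > 0" using M by simp
  have "{as \<in> seeds d 2. hashH d p M as x = hashH d p M as y}
     = (\<Union>j<M. {as \<in> seeds d 2. \<forall>z\<in>{x, y}. hashH d p M as z \<in> {j}})"
    using M0 by (auto simp: hashH_def)
  also have "card \<dots> = (\<Sum>j<M. card {as \<in> seeds d 2. \<forall>z\<in>{x, y}. hashH d p M as z \<in> {j}})"
    using finite_seeds by (intro card_UN_disjoint) auto
  also have "real \<dots> = (\<Sum>j<M. real (card (seeds d 2)) * (1 / real M) ^ 2)"
    unfolding of_nat_sum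
  proof (intro sum.cong refl)
    fix j assume "j \<in> {..<M}"
    thus "real (card {as \<in> seeds d 2. \<forall>z\<in>{x, y}. hashH d p M as z \<in> {j}}) = real (card (seeds d 2)) * (1 / real M) ^ 2"
      using hashH_indep[OF p, of "{x, y}" 2 M c "{j}"] xy d2 M by (simp add: power2_eq_square)
  qed
  finally show ?thesis using M0 by (simp add: power2_eq_square)
qed

lemma hashG_le: "hashG d p as x \<le> d"
  unfolding hashG_def by (intro tz_le gf_eval_less)

lemma hashG_indep:
  assumes p: "irreducible p" "degree p = d" and X: "X \<subseteq> {..<2 ^ d}"
    and k: "card X \<le> k" "k \<le> 2 ^ d" and u: "u \<le> d"
  shows "real (card {as \<in> seeds d k. \<forall>x\<in>X. u \<le> hashG d p as x})
       = real (card (seeds d k)) * (1 / 2 ^ u) ^ card X"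
proof -
  \<comment> \<open>Having at least \<open>u\<close> trailing zeros means lying in the residue class
    0 modulo \<open>2 ^ u\<close>, a class of density \<open>1 / 2 ^ u\<close>.\<close>
  let ?Y = "{y \<in> {..<2 ^ d :: nat}. y mod 2 ^ u \<in> {0}}"
  have "{as \<in> seeds d k. \<forall>x\<in>X. u \<le> hashG d p as x} = {as \<in> seeds d k. \<forall>x\<in>X. gf_eval d p as x \<in> ?Y}"
    using gf_eval_less by (auto simp: hashG_def tz_ge_iff[OF u] dvd_eq_mod_eq_0)
  moreover have "real (card ?Y) / 2 ^ d = 1 / 2 ^ u"
    by (subst card_residue_set[OF u]) (use u in \<open>auto simp: pow2_diff_ratio\<close>)
  moreover have "?Y \<subseteq> {..<2 ^ d}" by auto
  ultimately show ?thesis using gf_eval_indep_real[OF p X k, of ?Y] by simp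
qed

section \<open>Markov and Chebyshev inequalities as cardinality bounds\<close>

lemma markov_count:
  fixes h :: "'s \<Rightarrow> real"
  assumes "finite S" "\<And>s. s \<in> S \<Longrightarrow> h s \<ge> 0" "\<And>s. s \<in> S \<Longrightarrow> P s \<Longrightarrow> v \<le> h s"
  shows "v * real (card {s \<in> S. P s}) \<le> (\<Sum>s\<in>S. h s)"
proof -
  have "v * real (card {s \<in> S. P s}) = (\<Sum>s\<in>{s \<in> S. P s}. v)" by simp
  also have "\<dots> \<le> (\<Sum>s\<in>{s \<in> S. P s}. h s)" using assms(3) by (intro sum_mono) auto
  also have "\<dots> \<le> (\<Sum>s\<in>S. h s)" using assms by (intro sum_mono2) auto
  finally show ?thesis .
qed

text \<open>Pairwise independence removes the covariances, so the count has variance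
  \<open>card A * q * (1 - q)\<close>; the sum over \<open>S\<close> is this variance times
  \<open>card S\<close>.\<close>

lemma pairwise_second_moment:
  fixes P :: "'s \<Rightarrow> 'x \<Rightarrow> bool" and q :: real
  assumes fin: "finite S" "finite A"
    and one: "\<And>a. a \<in> A \<Longrightarrow> real (card {s \<in> S. P s a}) = real (card S) * q"
    and two: "\<And>a a'. a \<in> A \<Longrightarrow> a' \<in> A \<Longrightarrow> a \<noteq> a' \<Longrightarrow> real (card {s \<in> S. P s a \<and> P s a'}) = real (card S) * q\<^sup>2"
  shows "(\<Sum>s\<in>S. (real (card {a \<in> A. P s a}) - real (card A) * q)\<^sup>2) \<le> real (card S) * (real (card A) * q)"
proof -
  define N where "N = (\<lambda>s. real (card {a \<in> A. P s a}))"
  define \<mu> where "\<mu> = real (card A) * q"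
  define c where "c = real (card S)"
  have N: "N s = (\<Sum>a\<in>A. of_bool (P s a))" for s
    using fin by (simp add: N_def sum.If_cases of_bool_def Int_def)
  have s1: "(\<Sum>s\<in>S. N s) = c * \<mu>"
  proof -
    have "(\<Sum>s\<in>S. N s) = (\<Sum>a\<in>A. \<Sum>s\<in>S. of_bool (P s a))" unfolding N by (rule sum.swap)
    also have "\<dots> = (\<Sum>a\<in>A. c * q)"
      using fin one by (intro sum.cong) (auto simp: sum.If_cases of_bool_def Int_def c_def)
    finally show ?thesis by (simp add: \<mu>_def)
  qed
  have "(\<Sum>s\<in>S. (N s)\<^sup>2) = (\<Sum>s\<in>S. \<Sum>a\<in>A. \<Sum>a'\<in>A. of_bool (P s a \<and> P s a'))"
    unfolding N power2_eq_square sum_product by (intro sum.cong) auto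
  also have "\<dots> = (\<Sum>a\<in>A. \<Sum>s\<in>S. \<Sum>a'\<in>A. of_bool (P s a \<and> P s a'))" by (rule sum.swap)
  also have "\<dots> = (\<Sum>a\<in>A. \<Sum>a'\<in>A. \<Sum>s\<in>S. of_bool (P s a \<and> P s a'))" by (intro sum.cong refl sum.swap)
  also have "\<dots> = (\<Sum>a\<in>A. \<Sum>a'\<in>A. real (card {s \<in> S. P s a \<and> P s a'}))"
    using fin by (simp add: sum.If_cases of_bool_def Int_def)
  \<comment> \<open>An indicator is its own square, so the diagonal contributes \<open>c * q\<close>
    in place of \<open>c * q^2\<close>.\<close>
  also have "\<dots> = (\<Sum>a\<in>A. \<Sum>a'\<in>A. c * q\<^sup>2 + (if a' = a then c * q - c * q\<^sup>2 else 0))"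
    using one two by (intro sum.cong refl) (auto simp: c_def)
  also have "\<dots> = real (card A) * (real (card A) * (c * q\<^sup>2) + (c * q - c * q\<^sup>2))"
    using fin by (simp add: sum.distrib)
  finally have s2: "(\<Sum>s\<in>S. (N s)\<^sup>2) = real (card A) * (real (card A) * (c * q\<^sup>2) + (c * q - c * q\<^sup>2))" .
  have "(\<Sum>s\<in>S. (N s - \<mu>)\<^sup>2) = (\<Sum>s\<in>S. (N s)\<^sup>2) - 2 * \<mu> * (\<Sum>s\<in>S. N s) + c * \<mu>\<^sup>2"
    unfolding power2_diff sum.distrib sum_subtractf sum_distrib_left by (simp add: c_def mult_ac)
  also have "\<dots> = c * \<mu> - real (card A) * (c * q\<^sup>2)"
    unfolding s1 s2 by (simp add: \<mu>_def algebra_simps power2_eq_square)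
  also have "\<dots> \<le> c * \<mu>" by (simp add: c_def)
  finally show ?thesis by (simp add: N_def \<mu>_def c_def)
qed

lemma pow2_between:
  fixes x :: real
  assumes "x \<ge> 1"
  obtains u :: nat where "2 ^ u \<le> x" "x < 2 ^ Suc u"
proof -
  have fin: "finite {u::nat. 2 ^ u \<le> x}"
  proof (rule finite_subset)
    show "{u::nat. 2 ^ u \<le> x} \<subseteq> {..nat \<lceil>x\<rceil>}"
    proof
      fix u :: nat assume "u \<in> {u. 2 ^ u \<le> x}"
      hence "2 ^ u \<le> x" by simp
      moreover have "real u < 2 ^ u" by (rule of_nat_less_two_power)
      ultimately have "u \<le> nat \<lceil>x\<rceil>" by linarith
      thus "u \<in> {..nat \<lceil>x\<rceil>}" by simp
    qed
  qed simp
  define u where "u = Max {u::nat. 2 ^ u \<le> x}"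
  have "u \<in> {u::nat. 2 ^ u \<le> x}" unfolding u_def using fin assms by (intro Max_in) (auto intro: exI[of _ 0])
  moreover have "\<not> 2 ^ Suc u \<le> x"
  proof
    assume "2 ^ Suc u \<le> x"
    hence "Suc u \<le> u" unfolding u_def[symmetric] using fin by (subst (2) u_def) (intro Max_ge, auto)
    thus False by simp
  qed
  ultimately show ?thesis using that by auto
qed

text \<open>This isolates what is used of the trailing-zero family: a level \<open>u \<le> d\<close>
  is reached with probability exactly \<open>1 / 2 ^ u\<close>, independently for any two elements.
  The bound on \<open>card A\<close> keeps the levels near \<open>log 2 (card A)\<close> inside this
  range.\<close>

locale level_hash =
  fixes S :: "'s set" and F :: "'s \<Rightarrow> 'x \<Rightarrow> nat" and A :: "'x set" and d :: nat
  assumes finS: "finite S" and finA: "finite A" and neA: "A \<noteq> {}" and cardA: "card A \<le> 2 ^ d"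
    and F_le: "\<And>s a. F s a \<le> d"
    and F_one: "\<And>a u. a \<in> A \<Longrightarrow> u \<le> d \<Longrightarrow> real (card {s \<in> S. u \<le> F s a}) = real (card S) * (1 / 2 ^ u)"
    and F_two: "\<And>a a' u. a \<in> A \<Longrightarrow> a' \<in> A \<Longrightarrow> a \<noteq> a' \<Longrightarrow> u \<le> d \<Longrightarrow>
      real (card {s \<in> S. u \<le> F s a \<and> u \<le> F s a'}) = real (card S) * (1 / 2 ^ u)\<^sup>2"
begin

definition max_level :: "'s \<Rightarrow> nat" where "max_level s = Max (F s ` A)"

definition above :: "'s \<Rightarrow> nat \<Rightarrow> 'x set" where "above s u = {a \<in> A. u \<le> F s a}"

lemma max_level_ge_iff: "u \<le> max_level s \<longleftrightarrow> above s u \<noteq> {}"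
  unfolding max_level_def above_def using finA neA by (auto simp: Max_ge_iff)

lemma F_le_one: "a \<in> A \<Longrightarrow> real (card {s \<in> S. u \<le> F s a}) \<le> real (card S) * (1 / 2 ^ u)"
proof (cases "u \<le> d")
  case False
  hence "\<not> u \<le> F s a" for s using F_le[of s a] by simp
  thus ?thesis by simp
qed (simp add: F_one)

lemma card_A_pos: "real (card A) \<ge> 1"
  using finA neA by (simp add: Suc_leI card_gt_0_iff)

lemma card_A_le: "real (card A) \<le> 2 ^ d"
  using of_nat_mono[OF cardA, where 'a = real] by simp

lemma level_deviation:
  assumes "u \<le> d" "v > 0"
  shows "real (card {s \<in> S. v \<le> \<bar>real (card (above s u)) - real (card A) / 2 ^ u\<bar>})
    \<le> real (card S) * (real (card A) / 2 ^ u / v\<^sup>2)"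
proof -
  have "v\<^sup>2 * real (card {s \<in> S. v \<le> \<bar>real (card (above s u)) - real (card A) / 2 ^ u\<bar>})
      \<le> (\<Sum>s\<in>S. (real (card (above s u)) - real (card A) / 2 ^ u)\<^sup>2)"
    using finS assms by (intro markov_count) (auto simp: abs_le_square_iff[symmetric])
  also have "\<dots> \<le> real (card S) * (real (card A) / 2 ^ u)"
    using pairwise_second_moment[OF finS finA, of "\<lambda>s a. u \<le> F s a" "1 / 2 ^ u"] F_one F_two assms(1)
    by (simp add: above_def)
  finally show ?thesis using assms(2) by (simp add: field_simps)
qed

lemma max_level_too_large:
  "real (card {s \<in> S. 2 ^ 7 * real (card A) < 2 ^ max_level s}) \<le> real (card S) / 2 ^ 7"
proof -
  \<comment> \<open>\<open>Suc u\<close> is the first level whose power of two exceeds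
    \<open>2 ^ 7 * card A\<close>. Fewer than \<open>1 / 2 ^ 7\<close> elements are expected to
    reach it, so a union bound over \<open>A\<close> suffices.\<close>
  obtain u where u: "2 ^ u \<le> 2 ^ 7 * real (card A)" "2 ^ 7 * real (card A) < 2 ^ Suc u"
    using pow2_between[of "2 ^ 7 * real (card A)"] card_A_pos by auto
  have "{s \<in> S. 2 ^ 7 * real (card A) < 2 ^ max_level s} \<subseteq> (\<Union>a\<in>A. {s \<in> S. Suc u \<le> F s a})"
  proof clarify
    fix s assume s: "s \<in> S" "2 ^ 7 * real (card A) < 2 ^ max_level s"
    hence "(2::real) ^ u < 2 ^ max_level s" using u by linarith
    hence "Suc u \<le> max_level s" by (simp add: Suc_le_eq)
    thus "s \<in> (\<Union>a\<in>A. {s \<in> S. Suc u \<le> F s a})" using s by (auto simp: max_level_ge_iff above_def)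
  qed
  hence "card {s \<in> S. 2 ^ 7 * real (card A) < 2 ^ max_level s} \<le> card (\<Union>a\<in>A. {s \<in> S. Suc u \<le> F s a})"
    using finA finS by (intro card_mono) auto
  also have "\<dots> \<le> (\<Sum>a\<in>A. card {s \<in> S. Suc u \<le> F s a})" using finA by (rule card_UN_le)
  finally have "real (card {s \<in> S. 2 ^ 7 * real (card A) < 2 ^ max_level s}) \<le> (\<Sum>a\<in>A. real (card {s \<in> S. Suc u \<le> F s a}))"
    by (simp flip: of_nat_sum)
  also have "\<dots> \<le> (\<Sum>a\<in>A. real (card S) * (1 / 2 ^ Suc u))" by (intro sum_mono F_le_one)
  also have "\<dots> = real (card S) * (real (card A) / 2 ^ Suc u)" by simp
  also have "\<dots> \<le> real (card S) * (1 / 2 ^ 7)"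
    using u(2) by (intro mult_left_mono) (auto simp: field_simps)
  finally show ?thesis by simp
qed

lemma max_level_too_small:
  "real (card {s \<in> S. 2 ^ 8 * 2 ^ max_level s < real (card A)}) \<le> real (card S) / 2 ^ 7"
proof (cases "2 ^ 8 < real (card A)")
  case False
  have "\<not> 2 ^ 8 * 2 ^ max_level s < real (card A)" for s
  proof -
    have "(2::real) ^ 8 * 1 \<le> 2 ^ 8 * 2 ^ max_level s" by (intro mult_left_mono) auto
    thus ?thesis using False by linarith
  qed
  thus ?thesis by simp
next
  case True
  then obtain v where v: "2 ^ v \<le> real (card A) / 2 ^ 8" "real (card A) / 2 ^ 8 < 2 ^ Suc v"
    using pow2_between[of "real (card A) / 2 ^ 8"] by auto
  \<comment> \<open>At this level the expected count \<open>\<mu>\<close> is at least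
    \<open>2 ^ 7\<close>. A maximum as small as in the claim leaves the level empty, which is a
    deviation by all of \<open>\<mu>\<close> and has probability at most \<open>1 / \<mu>\<close> by
    Chebyshev.\<close>
  define u where "u = Suc v"
  define \<mu> where "\<mu> = real (card A) / 2 ^ u"
  have mu: "\<mu> \<ge> 2 ^ 7" using v(1) by (simp add: \<mu>_def u_def field_simps)
  have "1 \<le> \<mu>" using mu by simp
  hence "(2::real) ^ u \<le> real (card A)" unfolding \<mu>_def by (subst (asm) le_divide_eq_1_pos) auto
  also note card_A_le
  finally have ud: "u \<le> d" by simp
  have "{s \<in> S. 2 ^ 8 * 2 ^ max_level s < real (card A)} \<subseteq> {s \<in> S. \<mu> \<le> \<bar>real (card (above s u)) - \<mu>\<bar>}"
  proof clarify
    fix s assume s: "s \<in> S" "2 ^ 8 * 2 ^ max_level s < real (card A)"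
    hence "(2::real) ^ max_level s < 2 ^ u" using v(2) by (simp add: u_def)
    hence "\<not> u \<le> max_level s" by simp
    hence "above s u = {}" using max_level_ge_iff by auto
    thus "\<mu> \<le> \<bar>real (card (above s u)) - \<mu>\<bar>" by simp
  qed
  hence "real (card {s \<in> S. 2 ^ 8 * 2 ^ max_level s < real (card A)}) \<le> real (card {s \<in> S. \<mu> \<le> \<bar>real (card (above s u)) - \<mu>\<bar>})"
    using finS by (intro of_nat_mono card_mono) auto
  also have "\<dots> \<le> real (card S) * (\<mu> / \<mu>\<^sup>2)" unfolding \<mu>_def using ud mu card_A_pos by (intro level_deviation) auto
  also have "\<dots> \<le> real (card S) * (1 / 2 ^ 7)"
    using mu by (intro mult_left_mono) (auto simp: power2_eq_square field_simps)
  finally show ?thesis by simp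
qed

text \<open>The cutoff level depends on the sampled function, so the deviation is bounded for all
  admissible levels simultaneously; the failure probabilities form a geometric series.\<close>
lemma cutoff_level_deviation:
  fixes \<epsilon> :: real and r :: nat
  assumes \<epsilon>: "\<epsilon> > 0" and r: "2 ^ r * \<epsilon>\<^sup>2 \<ge> 9 * 2 ^ 23" "r \<ge> 16"
  shows "real (card {s \<in> S. 2 ^ max_level s \<le> 2 ^ 7 * real (card A) \<and>
       \<epsilon> / 3 * (real (card A) / 2 ^ (max_level s + 9 - r)) < \<bar>real (card (above s (max_level s + 9 - r))) - real (card A) / 2 ^ (max_level s + 9 - r)\<bar>})
     \<le> real (card S) / 2 ^ 6"
proof -
  define X where "X = real (card A)"
  have X: "X \<ge> 1" using card_A_pos by (simp add: X_def)
  define Bd where "Bd = (\<lambda>u. {s \<in> S. \<epsilon> / 3 * (X / 2 ^ u) \<le> \<bar>real (card (above s u)) - X / 2 ^ u\<bar>})"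
  let ?L = "{s \<in> S. 2 ^ max_level s \<le> 2 ^ 7 * X \<and>
       \<epsilon> / 3 * (X / 2 ^ (max_level s + 9 - r)) < \<bar>real (card (above s (max_level s + 9 - r))) - X / 2 ^ (max_level s + 9 - r)\<bar>}"
  have main: "s \<in> Bd (max_level s + 9 - r) \<and> 2 ^ (max_level s + 9 - r) * 2 ^ r \<le> 2 ^ 16 * X" if s: "s \<in> ?L" for s
  proof -
    \<comment> \<open>The set above level 0 is \<open>A\<close> itself and shows no deviation. So
      the cutoff is positive, the natural subtraction is not truncated, and its power of two can be
      computed.\<close>
    have "max_level s + 9 - r \<noteq> 0"
    proof
      assume z: "max_level s + 9 - r = 0"
      have "above s 0 = A" by (auto simp: above_def)
      hence "\<epsilon> / 3 * X < 0" using s z by (simp add: X_def)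
      thus False using \<epsilon> X by (simp add: mult_less_0_iff)
    qed
    hence "(2::real) ^ (max_level s + 9 - r) * 2 ^ r = 2 ^ max_level s * 2 ^ 9" by (simp only: power_add[symmetric]) simp
    also have "\<dots> \<le> 2 ^ 7 * X * 2 ^ 9" using s by (intro mult_right_mono) auto
    finally show ?thesis using s by (simp add: Bd_def)
  qed
  have "real (card ?L) \<le> real (card S) / 2 ^ 6"
  proof (cases "2 ^ 16 * X / 2 ^ r \<ge> 1")
    case False
    have "?L = {}"
    proof (rule ccontr)
      assume "?L \<noteq> {}"
      then obtain s where "s \<in> ?L" by blast
      hence "2 ^ (max_level s + 9 - r) * 2 ^ r \<le> 2 ^ 16 * X" using main by blast
      moreover have "(1::real) * 2 ^ r \<le> 2 ^ (max_level s + 9 - r) * 2 ^ r" by (intro mult_right_mono) auto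
      ultimately have "2 ^ r \<le> 2 ^ 16 * X" by linarith
      thus False using False by simp
    qed
    thus ?thesis by (simp only: card.empty) simp
  next
    case True
    then obtain U where U: "2 ^ U \<le> 2 ^ 16 * X / 2 ^ r" "2 ^ 16 * X / 2 ^ r < 2 ^ Suc U"
      using pow2_between by blast
    have ud: "u \<le> d" if "u \<le> U" for u
    proof -
      have "(2::real) ^ u \<le> 2 ^ U" using that by simp
      also have "\<dots> \<le> 2 ^ 16 * X / 2 ^ r" by (rule U)
      \<comment> \<open>Here \<open>r \<ge> 16\<close> keeps every admissible cutoff at or below
        \<open>log 2 (card A)\<close>, hence among the levels for which the moment formulas
        hold.\<close>
      also have "\<dots> \<le> 2 ^ r * X / 2 ^ r"
        using r(2) X by (intro divide_right_mono mult_right_mono power_increasing) auto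
      also have "\<dots> = X" by simp
      also have "\<dots> \<le> 2 ^ d" unfolding X_def by (rule card_A_le)
      finally show ?thesis by simp
    qed
    have "?L \<subseteq> (\<Union>u\<le>U. Bd u)"
    proof
      fix s assume s: "s \<in> ?L"
      have "2 ^ (max_level s + 9 - r) \<le> 2 ^ 16 * X / 2 ^ r" using main[OF s] by (simp add: field_simps)
      hence "(2::real) ^ (max_level s + 9 - r) < 2 ^ Suc U" using U(2) by linarith
      hence "max_level s + 9 - r < Suc U" using power_less_imp_less_exp[of "2::real" _ "Suc U"] by (simp del: power_Suc)
      thus "s \<in> (\<Union>u\<le>U. Bd u)" using main[OF s] by auto
    qed
    hence "card ?L \<le> card (\<Union>u\<le>U. Bd u)" using finS by (intro card_mono) (auto simp: Bd_def)
    also have "\<dots> \<le> (\<Sum>u\<le>U. card (Bd u))" by (intro card_UN_le) auto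
    finally have "real (card ?L) \<le> (\<Sum>u\<le>U. real (card (Bd u)))" by (simp flip: of_nat_sum)
    also have "\<dots> \<le> (\<Sum>u\<le>U. real (card S) * (9 / (\<epsilon>\<^sup>2 * X)) * 2 ^ u)"
    proof (rule sum_mono)
      fix u assume "u \<in> {..U}"
      hence "real (card (Bd u)) \<le> real (card S) * (X / 2 ^ u / (\<epsilon> / 3 * (X / 2 ^ u))\<^sup>2)"
        unfolding Bd_def X_def using ud \<epsilon> card_A_pos by (intro level_deviation) auto
      also have "X / 2 ^ u / (\<epsilon> / 3 * (X / 2 ^ u))\<^sup>2 = 9 / (\<epsilon>\<^sup>2 * X) * 2 ^ u"
        using \<epsilon> X by (simp add: power2_eq_square field_simps)
      finally show "real (card (Bd u)) \<le> real (card S) * (9 / (\<epsilon>\<^sup>2 * X)) * 2 ^ u" by simp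
    qed
    also have "\<dots> = real (card S) * (9 / (\<epsilon>\<^sup>2 * X)) * (\<Sum>u\<le>U. 2 ^ u)" by (simp add: sum_distrib_left)
    also have "(\<Sum>u\<le>U. 2 ^ u :: real) = 2 ^ Suc U - 1" by (induction U) auto
    also have "real (card S) * (9 / (\<epsilon>\<^sup>2 * X)) * (2 ^ Suc U - 1) \<le> real (card S) * (9 / (\<epsilon>\<^sup>2 * X)) * (2 * (2 ^ 16 * X / 2 ^ r))"
      using U(1) \<epsilon> X by (intro mult_left_mono) auto
    also have "\<dots> = real (card S) * (9 * 2 ^ 17 / (2 ^ r * \<epsilon>\<^sup>2))" using \<epsilon> X by (simp add: field_simps)
    \<comment> \<open>This explains \<open>9 * 2 ^ 23\<close> in the choice of \<open>b\<close>: 9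
      comes from the tolerance \<open>\<epsilon> / 3\<close>, the factor
      \<open>2 ^ 17 = 2 * 2 ^ 7 * 2 ^ 9\<close> from the geometric series, the bound on the maximum
      and the offset 9, and \<open>2 ^ 6\<close> is the failure probability aimed at.\<close>
    also have "\<dots> \<le> real (card S) * (9 * 2 ^ 17 / (9 * 2 ^ 23))" using r(1) by (intro mult_left_mono divide_left_mono) auto
    finally show ?thesis by simp
  qed
  thus ?thesis unfolding X_def .
qed

end

lemma not_inj_count:
  fixes G :: "'s \<Rightarrow> 'x \<Rightarrow> 'y" and M :: real
  assumes "finite S" "finite R" "M > 0"
    and "\<And>x y. x \<in> R \<Longrightarrow> y \<in> R \<Longrightarrow> x \<noteq> y \<Longrightarrow> real (card {s \<in> S. G s x = G s y}) \<le> real (card S) / M"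
  shows "real (card {s \<in> S. \<not> inj_on (G s) R}) \<le> real (card S) * ((real (card R))\<^sup>2 / M)"
proof -
  have "{s \<in> S. \<not> inj_on (G s) R} \<subseteq> (\<Union>x\<in>R. \<Union>y\<in>R - {x}. {s \<in> S. G s x = G s y})"
    by (auto simp: inj_on_def)
  hence "card {s \<in> S. \<not> inj_on (G s) R} \<le> card (\<Union>x\<in>R. \<Union>y\<in>R - {x}. {s \<in> S. G s x = G s y})"
    using assms by (intro card_mono) auto
  also have "\<dots> \<le> (\<Sum>x\<in>R. card (\<Union>y\<in>R - {x}. {s \<in> S. G s x = G s y}))" using assms by (intro card_UN_le)
  also have "\<dots> \<le> (\<Sum>x\<in>R. \<Sum>y\<in>R - {x}. card {s \<in> S. G s x = G s y})" using assms by (intro sum_mono card_UN_le) auto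
  finally have "real (card {s \<in> S. \<not> inj_on (G s) R}) \<le> (\<Sum>x\<in>R. \<Sum>y\<in>R - {x}. real (card {s \<in> S. G s x = G s y}))"
    by (simp flip: of_nat_sum)
  also have "\<dots> \<le> (\<Sum>x\<in>R. \<Sum>y\<in>R - {x}. real (card S) / M)" using assms by (intro sum_mono) auto
  also have "\<dots> \<le> (\<Sum>x\<in>R. \<Sum>y\<in>R. real (card S) / M)" using assms by (intro sum_mono sum_mono2) auto
  also have "\<dots> = real (card S) * ((real (card R))\<^sup>2 / M)" by (simp add: power2_eq_square)
  finally show ?thesis .
qed

section \<open>Balls and bins with limited independence\<close>

lemma alternating_binomial_sum:
  "(\<Sum>i\<le>j. (-1) ^ i * real (Suc N choose i)) = (-1) ^ j * real (N choose j)"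
  by (induction j) (auto simp: algebra_simps)

text \<open>For positive \<open>N\<close> and \<open>k\<close> the truncated sum collapses by
  Pascal's rule to plus or minus \<open>(N - 1) choose (k - 1)\<close>, which is at most
  \<open>N choose k\<close>.\<close>

lemma bonferroni:
  "\<bar>of_bool (N = 0) - (\<Sum>i<k. (-1) ^ i * real (N choose i))\<bar> \<le> real (N choose k)"
proof (cases k)
  case 0
  thus ?thesis by simp
next
  case (Suc j)
  show ?thesis
  proof (cases N)
    case 0
    have "(\<Sum>i<k. (-1) ^ i * real (N choose i)) = (\<Sum>i<k. if i = 0 then 1 else 0)"
      using 0 by (intro sum.cong) auto
    thus ?thesis using Suc 0 by simp
  next
    case (Suc N')
    have "(\<Sum>i<k. (-1) ^ i * real (N choose i)) = (-1) ^ j * real (N' choose j)"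
      using alternating_binomial_sum[of N' j] \<open>k = Suc j\<close> Suc by (simp add: lessThan_Suc_atMost)
    moreover have "N' choose j \<le> N choose k" using \<open>k = Suc j\<close> Suc by simp
    ultimately show ?thesis using Suc by (simp add: abs_mult)
  qed
qed

text \<open>This is \<open>bonferroni\<close> averaged over a binomial \<open>N\<close> with
  parameters \<open>m\<close> and \<open>q\<close>. Induction on \<open>m\<close> with the recursion
  \<open>rec\<close>, a form of Pascal's rule, replaces the construction of that
  distribution.\<close>

lemma bonferroni_binomial:
  fixes q :: real
  assumes "0 \<le> q" "q \<le> 1"
  shows "\<bar>(1 - q) ^ m - (\<Sum>i<k. (-1) ^ i * real (m choose i) * q ^ i)\<bar> \<le> real (m choose k) * q ^ k"
proof -
  define S where "S = (\<lambda>m k. \<Sum>i<k. (-1) ^ i * real (m choose i) * q ^ i)"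
  have rec: "S (Suc m) (Suc k) = S m (Suc k) - q * S m k" for m k
    unfolding S_def
    by (induction k) (auto simp: algebra_simps)
  have "\<bar>(1 - q) ^ m - S m k\<bar> \<le> real (m choose k) * q ^ k"
  proof (induction m arbitrary: k)
    case 0
    show ?case
    proof (cases k)
      case (Suc j)
      have "S 0 k = (\<Sum>i<k. if i = 0 then 1 else 0)"
        unfolding S_def by (intro sum.cong) auto
      thus ?thesis using Suc by simp
    qed (simp add: S_def)
  next
    case (Suc m)
    show ?case
    proof (cases k)
      case 0
      thus ?thesis using assms by (simp add: S_def power_le_one mult_le_one)
    next
      case (Suc j)
      have "(1 - q) ^ Suc m - S (Suc m) k = ((1 - q) ^ m - S m (Suc j)) - q * ((1 - q) ^ m - S m j)"
        using rec[of m j] Suc by (simp add: algebra_simps)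
      also have "\<bar>\<dots>\<bar> \<le> \<bar>(1 - q) ^ m - S m (Suc j)\<bar> + q * \<bar>(1 - q) ^ m - S m j\<bar>"
        by (rule order_trans[OF abs_triangle_ineq4]) (use assms(1) in \<open>simp add: abs_mult\<close>)
      also have "\<dots> \<le> real (m choose Suc j) * q ^ Suc j + q * (real (m choose j) * q ^ j)"
        using Suc.IH[of j] Suc.IH[of "Suc j"] assms(1) by (intro add_mono mult_left_mono)
      also have "\<dots> = real (Suc m choose k) * q ^ k" using Suc by (simp add: algebra_simps)
      finally show ?thesis .
    qed
  qed
  thus ?thesis by (simp add: S_def)
qed

text \<open>\<open>N choose i\<close> counts the \<open>i\<close>-element sets of hit elements, and
  limited independence gives each such set its exact probability as long as
  \<open>i \<le> k\<close>.\<close>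

lemma sum_choose_hits:
  fixes P :: "'s \<Rightarrow> 'x \<Rightarrow> bool" and q :: real
  assumes "finite S" "finite R"
    and indep: "\<And>X. X \<subseteq> R \<Longrightarrow> card X \<le> k \<Longrightarrow> real (card {s \<in> S. \<forall>x\<in>X. P s x}) = real (card S) * q ^ card X"
    and "i \<le> k"
  shows "(\<Sum>s\<in>S. real (card {x\<in>R. P s x} choose i)) = real (card S) * (real (card R choose i) * q ^ i)"
proof -
  have "(\<Sum>s\<in>S. real (card {x\<in>R. P s x} choose i)) = (\<Sum>s\<in>S. \<Sum>X\<in>{X. X \<subseteq> R \<and> card X = i}. of_bool (\<forall>x\<in>X. P s x))"
  proof (rule sum.cong)
    fix s assume "s \<in> S"
    have "card {x\<in>R. P s x} choose i = card {X. X \<subseteq> {x\<in>R. P s x} \<and> card X = i}"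
      using assms(2) by (simp add: n_subsets)
    also have "{X. X \<subseteq> {x\<in>R. P s x} \<and> card X = i} = {X \<in> {X. X \<subseteq> R \<and> card X = i}. \<forall>x\<in>X. P s x}" by auto
    finally show "real (card {x\<in>R. P s x} choose i) = (\<Sum>X\<in>{X. X \<subseteq> R \<and> card X = i}. of_bool (\<forall>x\<in>X. P s x))"
      using assms(2) by (simp add: sum.If_cases of_bool_def Int_def)
  qed simp
  also have "\<dots> = (\<Sum>X\<in>{X. X \<subseteq> R \<and> card X = i}. \<Sum>s\<in>S. of_bool (\<forall>x\<in>X. P s x))" by (rule sum.swap)
  also have "\<dots> = (\<Sum>X\<in>{X. X \<subseteq> R \<and> card X = i}. real (card S) * q ^ i)"
  proof (rule sum.cong)
    fix X assume X: "X \<in> {X. X \<subseteq> R \<and> card X = i}"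
    have "(\<Sum>s\<in>S. of_bool (\<forall>x\<in>X. P s x)) = real (card {s \<in> S. \<forall>x\<in>X. P s x})"
      using assms(1) by (simp add: sum.If_cases of_bool_def Int_def)
    thus "(\<Sum>s\<in>S. of_bool (\<forall>x\<in>X. P s x)) = real (card S) * q ^ i"
      using indep[of X] X assms(4) by simp
  qed simp
  also have "\<dots> = real (card S) * (real (card R choose i) * q ^ i)"
    using assms(2) by (simp add: n_subsets)
  finally show ?thesis .
qed

text \<open>Both the \<open>k\<close>-wise independent and the fully independent probability of missing a set of
  bins lie within one Bonferroni term of the same truncated inclusion-exclusion sum.\<close>
lemma prob_no_hit_approx:
  fixes P :: "'s \<Rightarrow> 'x \<Rightarrow> bool" and q :: real
  assumes "finite S" "finite R" "0 \<le> q" "q \<le> 1"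
    and indep: "\<And>X. X \<subseteq> R \<Longrightarrow> card X \<le> k \<Longrightarrow> real (card {s \<in> S. \<forall>x\<in>X. P s x}) = real (card S) * q ^ card X"
  shows "\<bar>real (card {s \<in> S. \<forall>x\<in>R. \<not> P s x}) - real (card S) * (1 - q) ^ card R\<bar>
     \<le> real (card S) * (2 * (real (card R choose k) * q ^ k))"
proof -
  define N where "N = (\<lambda>s. card {x\<in>R. P s x})"
  define T where "T = (\<Sum>i<k. (-1) ^ i * real (card R choose i) * q ^ i)"
  have mom: "(\<Sum>s\<in>S. real (N s choose i)) = real (card S) * (real (card R choose i) * q ^ i)" if "i \<le> k" for i
    unfolding N_def using sum_choose_hits[OF assms(1,2) indep that] by simp
  have "{s \<in> S. \<forall>x\<in>R. \<not> P s x} = {s \<in> S. N s = 0}" using assms(2) by (auto simp: N_def)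
  hence c: "real (card {s \<in> S. \<forall>x\<in>R. \<not> P s x}) = (\<Sum>s\<in>S. of_bool (N s = 0))"
    using assms(1) by (simp add: sum.If_cases of_bool_def Int_def)
  have "(\<Sum>s\<in>S. \<Sum>i<k. (-1) ^ i * real (N s choose i)) = (\<Sum>i<k. (-1) ^ i * (\<Sum>s\<in>S. real (N s choose i)))"
    by (subst sum.swap) (simp add: sum_distrib_left)
  also have "\<dots> = (\<Sum>i<k. (-1) ^ i * (real (card S) * (real (card R choose i) * q ^ i)))"
    by (intro sum.cong) (auto simp: mom)
  also have "\<dots> = real (card S) * T" unfolding T_def sum_distrib_left by (intro sum.cong) auto
  finally have "(\<Sum>s\<in>S. of_bool (N s = 0)) - real (card S) * T
    = (\<Sum>s\<in>S. of_bool (N s = 0) - (\<Sum>i<k. (-1) ^ i * real (N s choose i)))"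
    by (simp add: sum_subtractf)
  also have "\<bar>\<dots>\<bar> \<le> (\<Sum>s\<in>S. real (N s choose k))"
    by (rule order_trans[OF sum_abs]) (intro sum_mono bonferroni)
  also have "\<dots> = real (card S) * (real (card R choose k) * q ^ k)" by (rule mom) simp
  finally have 1: "\<bar>(\<Sum>s\<in>S. of_bool (N s = 0)) - real (card S) * T\<bar> \<le> real (card S) * (real (card R choose k) * q ^ k)" .
  have "\<bar>(1 - q) ^ card R - T\<bar> \<le> real (card R choose k) * q ^ k"
    unfolding T_def by (rule bonferroni_binomial) (use assms in auto)
  hence "real (card S) * \<bar>(1 - q) ^ card R - T\<bar> \<le> real (card S) * (real (card R choose k) * q ^ k)"
    by (intro mult_left_mono) auto
  hence 2: "\<bar>real (card S) * (1 - q) ^ card R - real (card S) * T\<bar> \<le> real (card S) * (real (card R choose k) * q ^ k)"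
    by (simp add: abs_mult flip: right_diff_distrib)
  show ?thesis unfolding c using 1 2 by (simp add: algebra_simps)
qed

text \<open>A mean value bound for \<open>t ^ Suc m\<close> on \<open>[z, x]\<close>, with the
  derivative taken at the larger endpoint here and at the smaller one in the next lemma.\<close>

lemma power_diff_le_real:
  fixes x z :: real
  assumes "0 \<le> z" "z \<le> x"
  shows "x ^ Suc m - z ^ Suc m \<le> real (Suc m) * (x - z) * x ^ m"
proof (induction m)
  case (Suc m)
  have "x ^ Suc (Suc m) - z ^ Suc (Suc m) = x * (x ^ Suc m - z ^ Suc m) + (x - z) * z ^ Suc m"
    by (simp add: algebra_simps)
  also have "\<dots> \<le> x * (real (Suc m) * (x - z) * x ^ m) + (x - z) * x ^ Suc m"
    using Suc assms by (intro add_mono mult_left_mono power_mono) auto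
  also have "\<dots> = real (Suc (Suc m)) * (x - z) * x ^ Suc m" by (simp add: algebra_simps)
  finally show ?case .
qed simp

lemma power_diff_ge_real:
  fixes x z :: real
  assumes "0 \<le> z" "z \<le> x"
  shows "x ^ Suc m - z ^ Suc m \<ge> real (Suc m) * (x - z) * z ^ m"
proof (induction m)
  case (Suc m)
  have "real (Suc (Suc m)) * (x - z) * z ^ Suc m = z * (real (Suc m) * (x - z) * z ^ m) + (x - z) * z ^ Suc m"
    by (simp add: algebra_simps)
  also have "\<dots> \<le> x * (x ^ Suc m - z ^ Suc m) + (x - z) * z ^ Suc m"
    using Suc assms by (intro add_mono mult_mono) auto
  also have "\<dots> = x ^ Suc (Suc m) - z ^ Suc (Suc m)" by (simp add: algebra_simps)
  finally show ?case by simp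
qed simp

text \<open>The left-hand side is the variance of the number of empty bins after throwing \<open>m\<close>
  independent balls.\<close>
lemma empty_bins_variance:
  fixes b :: real
  assumes "b \<ge> 2"
  shows "b * (1 - 1 / b) ^ m + b * (b - 1) * (1 - 2 / b) ^ m - b\<^sup>2 * ((1 - 1 / b) ^ m)\<^sup>2 \<le> real m ^ 2 / b"
proof (cases m)
  case 0
  thus ?thesis using assms by (simp add: algebra_simps power2_eq_square)
next
  case (Suc j)
  \<comment> \<open>\<open>a ^ m\<close> is the probability that a given bin stays empty,
    \<open>c ^ m\<close> that two given bins do. The variance is
    \<open>b * (a^m - c^m) - b^2 * (a^(2*m) - c^m)\<close>. As \<open>a - c = 1/b\<close> and
    \<open>a^2 - c = 1/b^2\<close>, the first part is at most \<open>m * a^j\<close> and the second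
    at least \<open>m * c^j\<close>, so the terms linear in \<open>m\<close> nearly cancel.\<close>
  define a c where "a = 1 - 1 / b" and "c = 1 - 2 / b"
  have c0: "0 \<le> c" "c \<le> a" "a \<le> 1" "0 \<le> a" using assms by (auto simp: a_def c_def field_simps)
  have a2: "a ^ 2 - c = 1 / b ^ 2" using assms by (simp add: a_def c_def power2_eq_square field_simps)
  have cla2: "c \<le> a ^ 2" using a2 assms by (smt (verit) divide_pos_pos zero_less_power zero_less_one)
  have "(a ^ 2) ^ m - c ^ m \<ge> real m * (a ^ 2 - c) * c ^ j"
    unfolding Suc by (rule power_diff_ge_real) (use c0 cla2 in auto)
  hence "b ^ 2 * ((a ^ 2) ^ m - c ^ m) \<ge> b ^ 2 * (real m * (1 / b ^ 2) * c ^ j)"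
    unfolding a2 by (rule mult_left_mono) simp
  also have "b ^ 2 * (real m * (1 / b ^ 2) * c ^ j) = real m * c ^ j" using assms by simp
  finally have 1: "b ^ 2 * ((a ^ m)\<^sup>2 - c ^ m) \<ge> real m * c ^ j" by (simp add: power_mult[symmetric] mult.commute)
  have "a ^ m - c ^ m \<le> real m * (a - c) * a ^ j"
    unfolding Suc by (rule power_diff_le_real) (use c0 in auto)
  hence "b * (a ^ m - c ^ m) \<le> b * (real m * (a - c) * a ^ j)"
    using assms by (intro mult_left_mono) auto
  also have "\<dots> = real m * a ^ j" using assms by (simp add: a_def c_def field_simps)
  finally have 2: "b * (a ^ m - c ^ m) \<le> real m * a ^ j" .
  have 3: "a ^ j - c ^ j \<le> real m / b"
  proof (cases j)
    case 0
    thus ?thesis using assms by simp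
  next
    case (Suc i)
    have "a ^ j - c ^ j \<le> real j * (a - c) * a ^ i"
      unfolding Suc by (rule power_diff_le_real) (use c0 in auto)
    also have "\<dots> \<le> real j * (a - c) * 1"
      using c0 by (intro mult_left_mono power_le_one) auto
    also have "\<dots> = real j / b" by (simp add: a_def c_def field_simps)
    also have "\<dots> \<le> real m / b" using assms \<open>m = Suc j\<close> by (intro divide_right_mono) auto
    finally show ?thesis .
  qed
  have "b * a ^ m + b * (b - 1) * c ^ m - b\<^sup>2 * (a ^ m)\<^sup>2
    = b * (a ^ m - c ^ m) - b ^ 2 * ((a ^ m)\<^sup>2 - c ^ m)" by (simp add: algebra_simps power2_eq_square)
  also have "\<dots> \<le> real m * (a ^ j - c ^ j)" using 1 2 by (simp add: algebra_simps)
  also have "\<dots> \<le> real m * (real m / b)" using 3 by (intro mult_left_mono) auto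
  finally show ?thesis by (simp add: a_def c_def power2_eq_square)
qed

text \<open>The squared number of empty bins is a sum over pairs of bins, so only the chances of
  missing one or two bins enter. \<open>prob_no_hit_approx\<close> replaces them by the independent
  values with relative errors \<open>e1\<close> and \<open>e2\<close>; the independent terms form
  the variance of \<open>empty_bins_variance\<close>.\<close>

lemma empty_bins_second_moment:
  fixes H :: "'s \<Rightarrow> 'x \<Rightarrow> nat" and b :: nat
  assumes "finite S" "finite R" "b \<ge> 2"
    and indep: "\<And>X J. X \<subseteq> R \<Longrightarrow> card X \<le> k \<Longrightarrow> J \<subseteq> {..<b} \<Longrightarrow>
       real (card {s \<in> S. \<forall>x\<in>X. H s x \<in> J}) = real (card S) * (real (card J) / real b) ^ card X"
  defines "U \<equiv> \<lambda>s. real (card {j. j < b \<and> (\<forall>x\<in>R. H s x \<noteq> j)})"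
  shows "(\<Sum>s\<in>S. (U s - real b * (1 - 1 / real b) ^ card R)\<^sup>2)
     \<le> real (card S) * (real (card R) ^ 2 / real b + 8 * real b ^ 2 * (real (card R choose k) * (2 / real b) ^ k))"
proof -
  define m where "m = card R"
  define a y where "a = (1 - 1 / real b) ^ m" and "y = (1 - 2 / real b) ^ m"
  define e1 e2 where "e1 = 2 * (real (m choose k) * (1 / real b) ^ k)" and "e2 = 2 * (real (m choose k) * (2 / real b) ^ k)"
  define c where "c = real (card S)"
  define B where "B = real b"
  have B: "B \<ge> 2" using assms(3) by (simp add: B_def)
  define E where "E = (\<lambda>J. real (card {s \<in> S. \<forall>x\<in>R. H s x \<notin> J}))"
  have E1: "\<bar>E {j} - c * a\<bar> \<le> c * e1" if "j < b" for j
    using prob_no_hit_approx[OF assms(1,2), of "1 / real b" k "\<lambda>s x. H s x \<in> {j}"] indep[of _ "{j}"] assms(3) that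
    by (simp add: E_def c_def a_def e1_def m_def)
  have E2: "\<bar>E {i, j} - c * y\<bar> \<le> c * e2" if "j < b" "i < b" "i \<noteq> j" for i j
    using prob_no_hit_approx[OF assms(1,2), of "2 / real b" k "\<lambda>s x. H s x \<in> {i, j}"] indep[of _ "{i, j}"] assms(3) that
    by (simp add: E_def c_def y_def e2_def m_def)
  have U: "U s = (\<Sum>j<b. of_bool (\<forall>x\<in>R. H s x \<noteq> j))" for s
  proof -
    have "{j. j < b \<and> (\<forall>x\<in>R. H s x \<noteq> j)} = {j\<in>{..<b}. \<forall>x\<in>R. H s x \<noteq> j}" by auto
    thus ?thesis by (simp add: U_def sum.If_cases of_bool_def Int_def)
  qed
  have SU: "(\<Sum>s\<in>S. U s) = (\<Sum>j<b. E {j})"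
    unfolding U E_def using assms(1) by (subst sum.swap) (simp add: sum.If_cases of_bool_def Int_def)
  have SU2: "(\<Sum>s\<in>S. (U s)\<^sup>2) = (\<Sum>i<b. \<Sum>j<b. E {i, j})"
  proof -
    have "(\<Sum>s\<in>S. (U s)\<^sup>2) = (\<Sum>s\<in>S. \<Sum>i<b. \<Sum>j<b. of_bool (\<forall>x\<in>R. H s x \<notin> {i, j}))"
      unfolding U power2_eq_square sum_product by (intro sum.cong refl) auto
    also have "\<dots> = (\<Sum>i<b. \<Sum>s\<in>S. \<Sum>j<b. of_bool (\<forall>x\<in>R. H s x \<notin> {i, j}))" by (rule sum.swap)
    also have "\<dots> = (\<Sum>i<b. \<Sum>j<b. \<Sum>s\<in>S. of_bool (\<forall>x\<in>R. H s x \<notin> {i, j}))" by (intro sum.cong refl sum.swap)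
    also have "\<dots> = (\<Sum>i<b. \<Sum>j<b. E {i, j})"
      unfolding E_def using assms(1) by (simp add: sum.If_cases of_bool_def Int_def)
    finally show ?thesis .
  qed
  have "(\<Sum>j<b. E {j}) \<ge> (\<Sum>j<b. c * a - c * e1)"
    by (intro sum_mono) (use E1 in fastforce)
  hence lo: "(\<Sum>s\<in>S. U s) \<ge> B * (c * a - c * e1)" by (simp add: SU B_def)
  have "(\<Sum>i<b. \<Sum>j<b. E {i, j}) \<le> (\<Sum>i<b. \<Sum>j<b. if i = j then c * a + c * e1 else c * y + c * e2)"
  proof (intro sum_mono)
    fix i j assume "i \<in> {..<b}" "j \<in> {..<b}"
    thus "E {i, j} \<le> (if i = j then c * a + c * e1 else c * y + c * e2)"
      using E1[of i] E2[of j i] by (cases "i = j") auto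
  qed
  also have "\<dots> = (\<Sum>i<b. (c * a + c * e1) + (B - 1) * (c * y + c * e2))"
  proof (intro sum.cong refl)
    fix i assume "i \<in> {..<b}"
    hence "(\<Sum>j<b. if i = j then c * a + c * e1 else c * y + c * e2)
       = (c * a + c * e1) + (\<Sum>j\<in>{..<b} - {i}. c * y + c * e2)"
      by (subst sum.remove[of _ i]) (auto intro!: sum.cong)
    thus "(\<Sum>j<b. if i = j then c * a + c * e1 else c * y + c * e2) = (c * a + c * e1) + (B - 1) * (c * y + c * e2)"
      using \<open>i \<in> {..<b}\<close> by (simp add: B_def of_nat_diff)
  qed
  also have "\<dots> = B * ((c * a + c * e1) + (B - 1) * (c * y + c * e2))" by (simp add: B_def)
  finally have hi: "(\<Sum>s\<in>S. (U s)\<^sup>2) \<le> B * ((c * a + c * e1) + (B - 1) * (c * y + c * e2))" by (simp add: SU2)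
  have a0: "0 \<le> a" "a \<le> 1" using assms(3) by (auto simp: a_def intro!: power_le_one)
  have e0: "0 \<le> e1" "0 \<le> e2" by (auto simp: e1_def e2_def)
  have e12: "e1 \<le> e2" unfolding e1_def e2_def by (intro mult_left_mono power_mono divide_right_mono) auto
  have c0: "0 \<le> c" by (simp add: c_def)
  have "(\<Sum>s\<in>S. (U s - B * a)\<^sup>2) = (\<Sum>s\<in>S. (U s)\<^sup>2) - 2 * B * a * (\<Sum>s\<in>S. U s) + c * (B * a)\<^sup>2"
    unfolding power2_diff sum.distrib sum_subtractf sum_distrib_left
    by (simp add: c_def mult_ac)
  also have "\<dots> \<le> B * ((c * a + c * e1) + (B - 1) * (c * y + c * e2)) - 2 * B * a * (B * (c * a - c * e1)) + c * (B * a)\<^sup>2"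
    using hi mult_left_mono[OF lo, of "2 * B * a"] a0 B by (intro add_mono diff_mono) auto
  also have "\<dots> = c * ((B * a + B * (B - 1) * y - B\<^sup>2 * a\<^sup>2) + (B * e1 + (B\<^sup>2 - B) * e2 + 2 * B\<^sup>2 * e1 * a))"
    by (simp add: algebra_simps power2_eq_square)
  also have "\<dots> \<le> c * (real m ^ 2 / B + 4 * B\<^sup>2 * e2)"
  proof (intro mult_left_mono add_mono c0)
    show "B * a + B * (B - 1) * y - B\<^sup>2 * a\<^sup>2 \<le> real m ^ 2 / B"
      using empty_bins_variance[OF B, of m] by (simp add: a_def y_def B_def)
    \<comment> \<open>All errors are charged to the larger \<open>e2\<close>: one share for the
      diagonal, one for pairs of distinct bins, two for the cross term of the square.\<close>
    have "B * e1 \<le> B\<^sup>2 * e2" using B e0 e12 by (intro mult_mono) (auto simp: power2_eq_square)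
    moreover have "(B\<^sup>2 - B) * e2 \<le> B\<^sup>2 * e2" using B e0 by (intro mult_right_mono) auto
    moreover have "2 * B\<^sup>2 * e1 * a \<le> 2 * B\<^sup>2 * e2 * 1" using a0 e0 e12 by (intro mult_mono) auto
    ultimately show "B * e1 + (B\<^sup>2 - B) * e2 + 2 * B\<^sup>2 * e1 * a \<le> 4 * B\<^sup>2 * e2" by linarith
  qed
  finally show ?thesis by (simp add: a_def m_def c_def B_def e2_def mult.assoc)
qed

section \<open>Accuracy of a single row\<close>

lemma two_pow_le_fact: "(2::real) ^ k \<le> 2 * fact k"
proof (induction k)
  case (Suc k)
  show ?case
  proof (cases k)
    case (Suc j)
    have "(2::real) ^ Suc k = 2 * 2 ^ k" by simp
    also have "\<dots> \<le> real (Suc k) * (2 * fact k)" using Suc.IH Suc by (intro mult_mono) auto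
    finally show ?thesis by (simp add: algebra_simps)
  qed simp
qed simp

text \<open>This determines \<open>k\<close>. The left side is governed by
  \<open>(2 * m / b) ^ k / fact k\<close>; two of the factors are kept to produce
  \<open>m ^ 2\<close>, the others are at most \<open>4 / 3\<close>. Since
  \<open>k \<ge> 15 / 2 * ln b\<close> gives \<open>b \<le> (3 / 2) ^ k\<close>, the product
  \<open>b * (4 / 3) ^ k\<close> is at most \<open>2 ^ k\<close>, and the factorial absorbs
  it.\<close>

lemma choose_tail_bound:
  fixes b m k :: nat
  assumes b: "b \<ge> 2" and m: "3 * m \<le> 2 * b" and k: "15 / 2 * ln (real b) \<le> real k" "k \<ge> 2"
  shows "8 * real b ^ 2 * (real (m choose k) * (2 / real b) ^ k) \<le> 64 * (real m ^ 2 / real b)"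
proof -
  define B M where "B = real b" and "M = real m"
  have B: "B \<ge> 2" using b by (simp add: B_def)
  have M: "M \<ge> 0" "M \<le> 2 / 3 * B" using m by (auto simp: M_def B_def)
  have "real (m choose k) * fact k \<le> M ^ k"
    using of_nat_mono[OF binomial_fact_pow[of m k], where 'a = real] by (simp add: M_def)
  hence "real (m choose k) \<le> M ^ k / fact k" by (simp add: field_simps)
  hence "real (m choose k) * (2 / B) ^ k \<le> M ^ k / fact k * (2 / B) ^ k"
    using B by (intro mult_right_mono) auto
  also have "\<dots> = (2 * M / B) ^ k / fact k" by (simp add: power_divide power_mult_distrib mult_ac)
  also have "(2 * M / B) ^ k = (2 * M / B) ^ 2 * (2 * M / B) ^ (k - 2)"
    using k(2) power_add[of "2 * M / B" 2 "k - 2"] by (metis le_add_diff_inverse)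
  also have "\<dots> \<le> (2 * M / B) ^ 2 * (4 / 3) ^ k"
  proof (intro mult_left_mono)
    have "(2 * M / B) ^ (k - 2) \<le> (4 / 3) ^ (k - 2)" using M B by (intro power_mono) (auto simp: field_simps)
    also have "\<dots> \<le> (4 / 3 :: real) ^ k" by (intro power_increasing) auto
    finally show "(2 * M / B) ^ (k - 2) \<le> (4 / 3) ^ k" .
  qed simp
  finally have 1: "real (m choose k) * (2 / B) ^ k \<le> (2 * M / B) ^ 2 * (4 / 3) ^ k / fact k"
    by (simp add: divide_right_mono)
  have "B = exp (ln B)" using B by simp
  also have "\<dots> \<le> exp (real k * (2 / 15))" using k(1) by (simp add: B_def)
  also have "\<dots> = exp (2 / 15) ^ k" by (rule exp_of_nat_mult)
  also have "\<dots> \<le> (3 / 2) ^ k"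
  proof (intro power_mono)
    have "exp (2 / 15 :: real) \<le> exp (1 / 3)" by simp
    also have "\<dots> \<le> 3 / 2"
    proof (rule power_le_imp_le_base)
      have "exp (1 / 3 :: real) ^ Suc 2 = exp 1" by (simp flip: exp_of_nat_mult)
      thus "exp (1 / 3 :: real) ^ Suc 2 \<le> (3 / 2) ^ Suc 2" using exp_le by (simp add: power_numeral_reduce)
    qed simp
    finally show "exp (2 / 15 :: real) \<le> 3 / 2" .
  qed simp
  finally have "B * (4 / 3) ^ k \<le> (3 / 2) ^ k * (4 / 3) ^ k" by (intro mult_right_mono) auto
  also have "\<dots> = 2 ^ k" by (simp flip: power_mult_distrib)
  also have "\<dots> \<le> 2 * fact k" by (rule two_pow_le_fact)
  finally have 2: "(4 / 3) ^ k / fact k \<le> 2 / B" using B by (simp add: field_simps)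
  have "8 * B ^ 2 * (real (m choose k) * (2 / B) ^ k) \<le> 8 * B ^ 2 * ((2 * M / B) ^ 2 * ((4 / 3) ^ k / fact k))"
    using 1 by (intro mult_left_mono) auto
  also have "\<dots> \<le> 8 * B ^ 2 * ((2 * M / B) ^ 2 * (2 / B))" using 2 by (intro mult_left_mono) auto
  also have "\<dots> = 64 * (M ^ 2 / B)" using B by (simp add: field_simps power2_eq_square)
  finally show ?thesis by (simp add: B_def M_def)
qed

text \<open>Chebyshev for the number of empty bins. Its second moment is at most
  \<open>65 * m^2 / b\<close>, with 1 from independent balls and 64 from limited independence;
  divided by \<open>(\<epsilon> / 12 * m)^2\<close> this is
  \<open>65 * 144 / (b * \<epsilon>^2)\<close>, well below \<open>1 / 2 ^ 6\<close>.\<close>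

lemma occupied_bins_deviation:
  fixes H :: "'s \<Rightarrow> 'x \<Rightarrow> nat" and b k :: nat and \<epsilon> :: real
  assumes fin: "finite S" "finite R" and b: "b \<ge> 2" and \<epsilon>: "\<epsilon> > 0" "real b * \<epsilon>\<^sup>2 \<ge> 9 * 2 ^ 23"
    and Hb: "\<And>s x. H s x < b"
    and indep: "\<And>X J. X \<subseteq> R \<Longrightarrow> card X \<le> k \<Longrightarrow> J \<subseteq> {..<b} \<Longrightarrow>
       real (card {s \<in> S. \<forall>x\<in>X. H s x \<in> J}) = real (card S) * (real (card J) / real b) ^ card X"
    and m: "3 * card R \<le> 2 * b" and k: "15 / 2 * ln (real b) \<le> real k" "k \<ge> 2"
  shows "real (card {s \<in> S. \<epsilon> / 12 * real (card R) < \<bar>real (card (H s ` R)) - real b * (1 - (1 - 1 / real b) ^ card R)\<bar>})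
     \<le> real (card S) / 2 ^ 6"
proof (cases "R = {}")
  case False
  define m' where "m' = real (card R)"
  have m0: "m' > 0" using False fin by (simp add: m'_def card_gt_0_iff)
  define U where "U = (\<lambda>s. real (card {j. j < b \<and> (\<forall>x\<in>R. H s x \<noteq> j)}))"
  define x where "x = (1 - 1 / real b) ^ card R"
  have U: "real (card (H s ` R)) = real b - U s" for s
  proof -
    have "{j. j < b \<and> (\<forall>x\<in>R. H s x \<noteq> j)} = {..<b} - H s ` R" by auto
    moreover have "card ({..<b} - H s ` R) = b - card (H s ` R)"
      using Hb fin by (subst card_Diff_subset) auto
    moreover have "card (H s ` R) \<le> card {..<b}" using Hb by (intro card_mono) auto
    ultimately show ?thesis by (simp add: U_def)
  qed
  let ?L = "{s \<in> S. \<epsilon> / 12 * m' < \<bar>real (card (H s ` R)) - real b * (1 - x)\<bar>}"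
  have "(\<epsilon> / 12 * m')\<^sup>2 * real (card ?L) \<le> (\<Sum>s\<in>S. (U s - real b * x)\<^sup>2)"
  proof (rule markov_count[OF fin(1)])
    fix s assume "\<epsilon> / 12 * m' < \<bar>real (card (H s ` R)) - real b * (1 - x)\<bar>"
    moreover have "real (card (H s ` R)) - real b * (1 - x) = - (U s - real b * x)" by (simp add: U algebra_simps)
    ultimately have "\<bar>\<epsilon> / 12 * m'\<bar> \<le> \<bar>U s - real b * x\<bar>" using \<epsilon> m0 by (simp only: abs_minus_cancel) simp
    thus "(\<epsilon> / 12 * m')\<^sup>2 \<le> (U s - real b * x)\<^sup>2" by (rule abs_le_square_iff[THEN iffD1])
  qed simp
  also have "\<dots> \<le> real (card S) * (m' ^ 2 / real b + 8 * real b ^ 2 * (real (card R choose k) * (2 / real b) ^ k))"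
    using empty_bins_second_moment[OF fin b indep] by (simp add: U_def x_def m'_def)
  also have "\<dots> \<le> real (card S) * (65 * (m' ^ 2 / real b))"
    using choose_tail_bound[OF b m k] by (intro mult_left_mono) (auto simp: m'_def)
  finally have "m' ^ 2 * (\<epsilon> ^ 2 * real b * real (card ?L)) \<le> m' ^ 2 * (real (card S) * (65 * 144))"
    using b by (simp add: power_mult_distrib power_divide field_simps)
  hence 1: "\<epsilon> ^ 2 * real b * real (card ?L) \<le> real (card S) * (65 * 144)" using m0 by simp
  have "9 * 2 ^ 23 * real (card ?L) \<le> \<epsilon> ^ 2 * real b * real (card ?L)"
    using \<epsilon> by (intro mult_right_mono) (auto simp: mult.commute)
  hence "9 * 2 ^ 23 * real (card ?L) \<le> real (card S) * (65 * 144)" using 1 by linarith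
  thus ?thesis by (simp add: m'_def x_def)
qed simp

text \<open>The quotient of logarithms inverts the expected occupancy. A load of at most
  \<open>2 / 3\<close> keeps the expected share \<open>x\<close> of empty bins above
  \<open>1 / 3\<close> and the observed share \<open>v\<close> above \<open>5 / 18\<close>, where
  \<open>ln\<close> has Lipschitz constant \<open>18 / 5\<close>. Division by
  \<open>ln (1 - 1 / b)\<close> costs at most a factor \<open>b\<close>, and
  \<open>18 / 5 * 1 / 12 = 3 / 10\<close>.\<close>

lemma occupancy_inverse:
  fixes b \<epsilon> p :: real and m :: nat
  assumes b: "b \<ge> 2" and m: "3 * real m \<le> 2 * b" and \<epsilon>: "0 < \<epsilon>" "\<epsilon> < 1"
    and dev: "\<bar>p - b * (1 - (1 - 1 / b) ^ m)\<bar> \<le> \<epsilon> / 12 * real m"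
  shows "p < b" "\<bar>ln (1 - p / b) / ln (1 - 1 / b) - real m\<bar> \<le> 3 / 10 * \<epsilon> * real m"
proof -
  define x v L where "x = (1 - 1 / b) ^ m" and "v = 1 - p / b" and "L = ln (1 - 1 / b)"
  have "1 + real m * (- (1 / b)) \<le> (1 + (- (1 / b))) ^ m"
    using b by (intro Bernoulli_inequality) auto
  hence "x \<ge> 1 - real m / b" by (simp add: x_def)
  moreover have mb: "real m / b \<le> 2 / 3" using m b by (simp add: field_simps)
  ultimately have x: "x \<ge> 1 / 3" by simp
  have "b * \<bar>v - x\<bar> = \<bar>b * (v - x)\<bar>" using b by (simp add: abs_mult)
  also have "b * (v - x) = - (p - b * (1 - x))" using b by (simp add: v_def algebra_simps)
  also have "\<bar>\<dots>\<bar> \<le> \<epsilon> / 12 * real m" unfolding abs_minus_cancel using dev by (simp only: x_def)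
  finally have vx: "\<bar>v - x\<bar> \<le> \<epsilon> / 12 * (real m / b)" using b by (simp add: field_simps)
  also have "\<dots> \<le> 1 / 12 * (2 / 3)" using \<epsilon> mb b by (intro mult_mono) auto
  finally have v: "v \<ge> 5 / 18" using x by linarith
  show "p < b" using v b by (simp add: v_def field_simps)
  have "ln v - ln x \<le> (v - x) / x" using ln_le_minus_one[of "v / x"] x v by (simp add: ln_div diff_divide_distrib)
  also have "\<dots> \<le> \<bar>v - x\<bar> / x" using x by (intro divide_right_mono) auto
  also have "\<dots> \<le> \<bar>v - x\<bar> / (5 / 18)" using x by (intro divide_left_mono) auto
  finally have a1: "ln v - ln x \<le> 18 / 5 * \<bar>v - x\<bar>" by simp
  have "ln x - ln v \<le> (x - v) / v" using ln_le_minus_one[of "x / v"] x v by (simp add: ln_div diff_divide_distrib)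
  also have "\<dots> \<le> \<bar>v - x\<bar> / v" using v by (intro divide_right_mono) auto
  also have "\<dots> \<le> \<bar>v - x\<bar> / (5 / 18)" using v by (intro divide_left_mono) auto
  finally have "ln x - ln v \<le> 18 / 5 * \<bar>v - x\<bar>" by simp
  hence "\<bar>ln v - ln x\<bar> \<le> 18 / 5 * \<bar>v - x\<bar>" using a1 by linarith
  also have "\<dots> \<le> 18 / 5 * (\<epsilon> / 12 * (real m / b))" using vx by (intro mult_left_mono) auto
  finally have lnd: "\<bar>ln v - ln x\<bar> \<le> 18 / 5 * (\<epsilon> / 12 * (real m / b))" .
  have lx: "ln x = real m * L" using b by (simp add: x_def L_def ln_realpow)
  have L: "- L \<ge> 1 / b" using ln_le_minus_one[of "1 - 1 / b"] b by (simp add: L_def)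
  hence L0: "L < 0" using b by (smt (verit) divide_pos_pos)
  have "ln v / L - real m = (ln v - ln x) / L" using L0 by (simp add: lx diff_divide_distrib)
  hence "\<bar>ln v / L - real m\<bar> = \<bar>ln v - ln x\<bar> / \<bar>L\<bar>" by (simp only: abs_divide)
  also have "\<dots> \<le> \<bar>ln v - ln x\<bar> / (1 / b)" using L L0 b by (intro divide_left_mono) (auto intro: divide_neg_pos)
  also have "\<dots> = b * \<bar>ln v - ln x\<bar>" by simp
  also have "\<dots> \<le> b * (18 / 5 * (\<epsilon> / 12 * (real m / b)))" using lnd b by (intro mult_left_mono) auto
  also have "\<dots> = 3 / 10 * \<epsilon> * real m" using b by simp
  finally show "\<bar>ln (1 - p / b) / ln (1 - 1 / b) - real m\<bar> \<le> 3 / 10 * \<epsilon> * real m" by (simp add: v_def L_def)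
qed

definition row_estimate :: "nat \<Rightarrow> (nat \<Rightarrow> int) \<Rightarrow> nat \<Rightarrow> ereal" where
  "row_estimate b B q =
     (let s = max 0 (real_of_int (Max {B j + int q | j. j < b}) - log 2 (real b) + 9);
          p = card {j. j < b \<and> real_of_int (B j + int q) \<ge> s}
      in if p = b then \<infinity> else ereal (2 powr s * ln (1 - real p / real b) / ln (1 - 1 / real b)))"

lemma estimate_eq_median_rows:
  "estimate l b B q = sort (map (\<lambda>i. row_estimate b (B i) q) [0..<l]) ! (l div 2)"
  by (simp add: estimate_def row_estimate_def Let_def)

lemma tau0_ge_iff:
  assumes "finite A"
  shows "int u \<le> tau0 FE GE HE A (f, g, h) j \<longleftrightarrow> (\<exists>a\<in>A. HE h (GE g a) = j \<and> u \<le> FE f a)"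
proof -
  have fin: "finite ({int (FE f a) | a. a \<in> A \<and> HE h (GE g a) = j} \<union> {-1})" using assms by simp
  show ?thesis unfolding tau0_def using fin by (subst prod.case, subst prod.case, subst Max_ge_iff) auto
qed

text \<open>Error budget: \<open>\<epsilon> / 3\<close> for the number of elements at the cutoff,
  and \<open>3 / 10 * 4 / 3 = 2 / 5\<close> of \<open>\<epsilon>\<close> for counting them by
  occupied bins. The level \<open>q\<close> leaves the estimate unchanged because it does not exceed
  the cutoff.\<close>

lemma row_estimate_accurate:
  fixes FE GE HE :: "nat list \<Rightarrow> nat \<Rightarrow> nat" and f g h :: "nat list" and \<epsilon> :: real and b r q :: nat
  assumes A: "finite A" "A \<noteq> {}" and b: "b = 2 ^ r" "r \<ge> 9" and \<epsilon>: "0 < \<epsilon>" "\<epsilon> < 1"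
    and Hb: "\<And>x. HE h x < b"
  defines "t \<equiv> Max (FE f ` A)"
  defines "lev \<equiv> t + 9 - r"
  defines "R \<equiv> {a \<in> A. lev \<le> FE f a}"
  assumes E1: "real (card A) \<le> 2 ^ 8 * 2 ^ t"
    and E2: "\<bar>real (card R) - real (card A) / 2 ^ lev\<bar> \<le> \<epsilon> / 3 * (real (card A) / 2 ^ lev)"
    and E3: "inj_on (GE g) R"
    and E4: "\<bar>real (card (HE h ` GE g ` R)) - real b * (1 - (1 - 1 / real b) ^ card R)\<bar> \<le> \<epsilon> / 12 * real (card R)"
    and R: "3 * card R \<le> 2 * b"
    and q: "q = 0 \<or> b * 2 ^ (q - 1) < card A"
  shows "\<bar>row_estimate b (tau1 FE GE HE A (f, g, h) q) q - ereal (real (card A))\<bar> \<le> ereal (\<epsilon> * real (card A))"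
proof -
  define T where "T = tau0 FE GE HE A (f, g, h)"
  define B where "B = tau1 FE GE HE A (f, g, h) q"
  \<comment> \<open>Adding \<open>q\<close> back restores every counter except those below
    \<open>q - 1\<close>. These become \<open>q - 1\<close>, which is still below the
    cutoff.\<close>
  have Bq: "B j + int q = max (T j) (int q - 1)" for j by (simp add: B_def tau1_def T_def)
  have Tge: "int u \<le> T j \<longleftrightarrow> (\<exists>a\<in>A. HE h (GE g a) = j \<and> u \<le> FE f a)" for u j
    unfolding T_def by (rule tau0_ge_iff[OF A(1)])
  have finF: "finite (FE f ` A)" "FE f ` A \<noteq> {}" using A by auto
  have Tle: "T j \<le> int t" for j
  proof (rule ccontr)
    assume "\<not> T j \<le> int t"
    hence "int (Suc t) \<le> T j" by simp
    then obtain a where "a \<in> A" "Suc t \<le> FE f a" using Tge by blast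
    moreover have "FE f a \<le> t" unfolding t_def using A \<open>a \<in> A\<close> by (intro Max_ge) auto
    ultimately show False by simp
  qed
  obtain a0 where a0: "a0 \<in> A" "FE f a0 = t" using Max_in[OF finF] by (auto simp: t_def)
  have qlev: "q \<le> lev \<and> int q - 1 \<le> int t"
  proof (cases "q = 0")
    case False
    \<comment> \<open>Combined with \<open>E1\<close> this yields \<open>r + q - 1 < t + 8\<close>,
      that is, \<open>q\<close> lies below \<open>t + 9 - r\<close>.\<close>
    hence "real (b * 2 ^ (q - 1)) < real (card A)" using q by (simp only: of_nat_less_iff) simp
    hence "real (b * 2 ^ (q - 1)) < 2 ^ 8 * 2 ^ t" using E1 by linarith
    hence "(2::real) ^ (r + (q - 1)) < 2 ^ (8 + t)" by (simp add: b power_add)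
    hence "r + (q - 1) < 8 + t" using power_less_imp_less_exp[of "2::real"] by simp
    thus ?thesis using False b(2) by (auto simp: lev_def)
  qed simp
  have Max: "Max {B j + int q | j. j < b} = int t"
  proof (rule Max_eqI)
    show "finite {B j + int q | j. j < b}" by simp
    show "y \<le> int t" if "y \<in> {B j + int q | j. j < b}" for y
      using that Tle qlev by (auto simp: Bq)
    have "int t \<le> T (HE h (GE g a0))" using Tge a0 by blast
    hence "B (HE h (GE g a0)) + int q = int t" using Tle[of "HE h (GE g a0)"] qlev by (simp add: Bq)
    thus "int t \<in> {B j + int q | j. j < b}"
      unfolding mem_Collect_eq using Hb by (intro exI[of _ "HE h (GE g a0)"]) simp
  qed
  define s where "s = max 0 (real_of_int (Max {B j + int q | j. j < b}) - log 2 (real b) + 9)"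
  \<comment> \<open>\<open>log 2 b\<close> is the integer \<open>r\<close>, so the real maximum with
    0 in the estimate agrees with truncated subtraction of naturals in \<open>lev\<close>.\<close>
  have s: "s = real lev" unfolding s_def Max by (simp add: b lev_def log_nat_power of_nat_diff max_def)
  have set: "{j. j < b \<and> real_of_int (B j + int q) \<ge> s} = HE h ` GE g ` R"
  proof -
    have "real_of_int (B j + int q) \<ge> s \<longleftrightarrow> (\<exists>a\<in>A. HE h (GE g a) = j \<and> lev \<le> FE f a)" for j
    proof -
      have "real_of_int (B j + int q) \<ge> s \<longleftrightarrow> int lev \<le> B j + int q" unfolding s by linarith
      also have "\<dots> \<longleftrightarrow> int lev \<le> T j" unfolding Bq using qlev by auto
      finally show ?thesis by (simp add: Tge)
    qed
    thus ?thesis using Hb by (auto simp: R_def)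
  qed
  define p where "p = card (HE h ` GE g ` R)"
  define m where "m = card R"
  define X where "X = real (card A)"
  have X0: "X \<ge> 0" by (simp add: X_def)
  have b2: "real b \<ge> 2"
    using b self_le_power[of "2::real" r] by simp
  have occ: "real p < real b" "\<bar>ln (1 - real p / real b) / ln (1 - 1 / real b) - real m\<bar> \<le> 3 / 10 * \<epsilon> * real m"
    using occupancy_inverse[OF b2 _ \<epsilon>, of m "real p"] E4 R by (auto simp: p_def m_def)
  define y where "y = ln (1 - real p / real b) / ln (1 - 1 / real b)"
  have est: "row_estimate b B q = ereal (2 ^ lev * y)"
    unfolding row_estimate_def Let_def s_def[symmetric] set p_def[symmetric]
    using occ(1) by (simp add: s powr_realpow y_def)
  have m1: "2 ^ lev * \<bar>real m - X / 2 ^ lev\<bar> \<le> \<epsilon> / 3 * X"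
    using mult_left_mono[OF E2, of "2 ^ lev"] by (simp add: m_def X_def)
  hence "\<bar>2 ^ lev * (real m - X / 2 ^ lev)\<bar> \<le> \<epsilon> / 3 * X" by (simp only: abs_mult) simp
  hence m1': "\<bar>2 ^ lev * real m - X\<bar> \<le> \<epsilon> / 3 * X" by (simp add: algebra_simps)
  also have "\<dots> \<le> 1 / 3 * X" using \<epsilon> X0 by (intro mult_right_mono) auto
  finally have m2: "2 ^ lev * real m \<le> 4 / 3 * X" by linarith
  have "\<bar>2 ^ lev * y - 2 ^ lev * real m\<bar> = 2 ^ lev * \<bar>y - real m\<bar>" by (simp add: abs_mult flip: right_diff_distrib)
  also have "\<dots> \<le> 2 ^ lev * (3 / 10 * \<epsilon> * real m)" using occ(2) by (intro mult_left_mono) (auto simp: y_def)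
  also have "\<dots> = 3 / 10 * \<epsilon> * (2 ^ lev * real m)" by simp
  also have "\<dots> \<le> 3 / 10 * \<epsilon> * (4 / 3 * X)" using m2 \<epsilon> by (intro mult_left_mono) auto
  finally have "\<bar>2 ^ lev * y - 2 ^ lev * real m\<bar> \<le> 2 / 5 * (\<epsilon> * X)" by (simp add: mult.commute)
  hence "\<bar>2 ^ lev * y - X\<bar> \<le> \<epsilon> * X" using m1' mult_nonneg_nonneg[of \<epsilon> X] \<epsilon> X0 by linarith
  thus ?thesis unfolding B_def[symmetric] est by (simp add: X_def)
qed

text \<open>Conditioning on the first component. The set that \<open>g\<close> has to separate
  depends on \<open>f\<close>, and the set thrown into the bins depends on \<open>f\<close> and
  \<open>g\<close>.\<close>

lemma card_dependent_le:
  fixes c :: real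
  assumes "finite S" "finite T" "\<And>s. s \<in> S \<Longrightarrow> real (card {t \<in> T. P s t}) \<le> c * real (card T)"
  shows "real (card {x \<in> S \<times> T. P (fst x) (snd x)}) \<le> c * real (card (S \<times> T))"
proof -
  have "{x \<in> S \<times> T. P (fst x) (snd x)} = Sigma S (\<lambda>s. {t \<in> T. P s t})" by auto
  hence "real (card {x \<in> S \<times> T. P (fst x) (snd x)}) = (\<Sum>s\<in>S. real (card {t \<in> T. P s t}))"
    using assms by (simp add: card_SigmaI)
  also have "\<dots> \<le> (\<Sum>s\<in>S. c * real (card T))" using assms by (intro sum_mono) auto
  finally show ?thesis by (simp add: card_cartesian_product mult_ac)
qed

lemma card_fst_le:
  fixes c :: real
  assumes "finite S" "finite T" "real (card {s \<in> S. P s}) \<le> c * real (card S)"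
  shows "real (card {x \<in> S \<times> T. P (fst x)}) \<le> c * real (card (S \<times> T))"
proof -
  have "{x \<in> S \<times> T. P (fst x)} = {s \<in> S. P s} \<times> T" by auto
  hence "real (card {x \<in> S \<times> T. P (fst x)}) = real (card {s \<in> S. P s}) * real (card T)"
    by (simp add: card_cartesian_product)
  also have "\<dots> \<le> c * real (card S) * real (card T)" using assms by (intro mult_right_mono) auto
  finally show ?thesis by (simp add: card_cartesian_product mult_ac)
qed

text \<open>Jensen's inequality by the tangent of \<open>ln\<close> at the mean \<open>w\<close>:
  the terms \<open>x j / w - 1\<close> sum to 0.\<close>

lemma sum_floor_log_le:
  fixes x :: "nat \<Rightarrow> int" and b :: nat
  assumes b: "b > 0" and x: "\<And>j. j < b \<Longrightarrow> x j \<ge> 1"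
  shows "real_of_int (\<Sum>j<b. \<lfloor>log 2 (real_of_int (x j))\<rfloor>) \<le> real b * log 2 ((\<Sum>j<b. real_of_int (x j)) / real b)"
proof -
  define w where "w = (\<Sum>j<b. real_of_int (x j)) / real b"
  have x': "real_of_int (x j) \<ge> 1" if "j < b" for j using x[OF that] by simp
  have "(\<Sum>j<b. 1) \<le> (\<Sum>j<b. real_of_int (x j))" using x' by (intro sum_mono) auto
  hence w: "w \<ge> 1" using b by (simp add: w_def field_simps)
  have "real_of_int (\<Sum>j<b. \<lfloor>log 2 (real_of_int (x j))\<rfloor>) \<le> (\<Sum>j<b. log 2 (real_of_int (x j)))"
    unfolding of_int_sum by (intro sum_mono) auto
  also have "\<dots> = (\<Sum>j<b. ln (real_of_int (x j))) / ln 2" by (simp add: log_def sum_divide_distrib)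
  also have "(\<Sum>j<b. ln (real_of_int (x j))) \<le> (\<Sum>j<b. real_of_int (x j) / w - 1 + ln w)"
  proof (rule sum_mono)
    fix j assume "j \<in> {..<b}"
    hence "ln (real_of_int (x j) / w) \<le> real_of_int (x j) / w - 1"
      using x'[of j] w by (intro ln_le_minus_one) auto
    thus "ln (real_of_int (x j)) \<le> real_of_int (x j) / w - 1 + ln w"
      using x'[of j] \<open>j \<in> {..<b}\<close> w by (simp add: ln_div)
  qed
  also have "\<dots> = (\<Sum>j<b. real_of_int (x j)) / w - real b + real b * ln w"
    by (simp add: sum.distrib sum_subtractf sum_divide_distrib)
  also have "(\<Sum>j<b. real_of_int (x j)) = real b * w" using b by (simp add: w_def)
  also have "real b * w / w - real b + real b * ln w = real b * ln w" using w by simp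
  finally show ?thesis by (simp add: log_def w_def divide_right_mono)
qed

section \<open>Inaccurate seeds and the average counter of one vertex\<close>

locale sketch =
  fixes \<epsilon> :: real and A :: "nat set" and b r k :: nat
    and df dg dh :: nat and pf pg ph :: "bit poly"
    and FE GE HE :: "nat list \<Rightarrow> nat \<Rightarrow> nat" and \<Psi> :: "seed set"
  assumes \<epsilon>: "0 < \<epsilon>" "\<epsilon> < 1" and b_def: "b = 2 ^ r" and r: "r \<ge> 16" and b_ge: "real b * \<epsilon>\<^sup>2 \<ge> 9 * 2 ^ 23"
    and k: "15 / 2 * ln (real b) \<le> real k" "k \<ge> 2" "k \<le> 2 ^ dh"
    and pf: "irreducible pf" "degree pf = df" and Af: "A \<subseteq> {..<2 ^ df}"
    and pg: "irreducible pg" "degree pg = dg" and Ag: "A \<subseteq> {..<2 ^ dg}" and bg: "2 ^ 5 * b ^ 2 \<le> 2 ^ dg"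
    and ph: "irreducible ph" "degree ph = dh" and bh: "2 ^ 5 * b ^ 2 \<le> 2 ^ dh" "b \<le> 2 ^ dh"
    and neA: "A \<noteq> {}"
    and FE_def: "FE = hashG df pf" and GE_def: "GE = hashH dg pg (2 ^ 5 * b ^ 2)" and HE_def: "HE = hashH dh ph b"
    and \<Psi>_def: "\<Psi> = seeds df 2 \<times> seeds dg 2 \<times> seeds dh k"
begin

lemma finA: "finite A" using Af finite_subset by blast

lemma b_pos: "b > 0" by (simp add: b_def)

lemma b_ge_2: "b \<ge> 2" using r self_le_power[of "2::nat" r] by (simp add: b_def)

lemma degree_pos: "df > 0"
  using pf by (metis gr0I irreducible_def is_unit_iff_degree)

sublocale level_hash "seeds df 2" FE A df
proof
  show "finite (seeds df 2)" by (rule finite_seeds)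
  show "finite A" by (rule finA)
  show "A \<noteq> {}" by (rule neA)
  show "card A \<le> 2 ^ df" using card_mono[OF _ Af] by simp
  show "FE s a \<le> df" for s a unfolding FE_def by (rule hashG_le)
  have d2: "2 \<le> (2::nat) ^ df" using degree_pos self_le_power[of "2::nat" df] by simp
  fix a u assume a: "a \<in> A" and u: "u \<le> df"
  show "real (card {s \<in> seeds df 2. u \<le> FE s a}) = real (card (seeds df 2)) * (1 / 2 ^ u)"
    using hashG_indep[OF pf, of "{a}" 2 u] a u d2 Af by (auto simp: FE_def)
  fix a' assume a': "a' \<in> A" "a \<noteq> a'"
  show "real (card {s \<in> seeds df 2. u \<le> FE s a \<and> u \<le> FE s a'}) = real (card (seeds df 2)) * (1 / 2 ^ u)\<^sup>2"
    using hashG_indep[OF pf, of "{a, a'}" 2 u] a a' u d2 Af by (auto simp: FE_def power2_eq_square)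
qed

lemma HE_less: "HE h x < b" by (simp add: HE_def hashH_def b_pos)

lemma GE_less: "GE g x < 2 ^ 5 * b ^ 2" by (simp add: GE_def hashH_def b_pos)

lemma fin_\<Psi>: "finite \<Psi>" by (simp add: \<Psi>_def finite_seeds)

text \<open>The first subsampling level at which at most one surviving element per bin is expected.
  Its minimality is what \<open>row_estimate_accurate\<close> asks of the positive levels.\<close>

definition qmax :: nat where "qmax = (LEAST q. card A \<le> b * 2 ^ q)"

lemma card_A_le_qmax: "card A \<le> b * 2 ^ qmax"
proof -
  have "card A \<le> b * 2 ^ card A"
    using less_exp[of "card A"] mult_le_mono[of 1 b "card A" "2 ^ card A"] b_pos by simp
  thus ?thesis unfolding qmax_def by (rule LeastI)
qed

lemma below_qmax: "q \<le> qmax \<Longrightarrow> q = 0 \<or> b * 2 ^ (q - 1) < card A"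
proof -
  assume q: "q \<le> qmax"
  show ?thesis
  proof (cases "q = 0")
    case False
    hence "q - 1 < qmax" using q by simp
    hence "\<not> card A \<le> b * 2 ^ (q - 1)" unfolding qmax_def by (rule not_less_Least)
    thus ?thesis by simp
  qed simp
qed

abbreviation "lev f \<equiv> max_level f + 9 - r"

definition good_f where
  "good_f f \<longleftrightarrow> real (card A) \<le> 2 ^ 8 * 2 ^ max_level f \<and>
     \<bar>real (card (above f (lev f))) - real (card A) / 2 ^ lev f\<bar> \<le> \<epsilon> / 3 * (real (card A) / 2 ^ lev f)"

text \<open>The offset 9 in the cutoff against the factor \<open>2 ^ 8\<close> in
  \<open>good_f\<close> bounds the expected count by \<open>b / 2\<close>, and the relative
  deviation is at most \<open>1 / 3\<close>. Truncation of the subtraction in \<open>lev\<close> can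
  only raise the cutoff.\<close>

lemma good_f_card:
  assumes "good_f f"
  shows "3 * card (above f (lev f)) \<le> 2 * b"
proof -
  define X where "X = real (card A) / 2 ^ lev f"
  have X0: "X \<ge> 0" by (simp add: X_def)
  have "2 ^ 9 * 2 ^ max_level f \<le> (2::real) ^ (lev f + r)" by (simp only: power_add[symmetric]) (rule power_increasing, auto)
  hence "2 ^ 9 * 2 ^ max_level f \<le> 2 ^ lev f * real b" by (simp add: power_add b_def)
  moreover have "real (card A) \<le> 2 ^ 8 * 2 ^ max_level f" using assms by (simp add: good_f_def)
  ultimately have "2 * real (card A) \<le> 2 ^ lev f * real b" by simp
  hence X: "2 * X \<le> real b" by (simp add: X_def field_simps)
  have "real (card (above f (lev f))) - X \<le> \<epsilon> / 3 * X"
    using assms unfolding good_f_def X_def by (blast dest: abs_le_D1)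
  hence "real (card (above f (lev f))) \<le> X + \<epsilon> / 3 * X" by (metis diff_le_eq add.commute)
  also have "\<dots> \<le> X + 1 / 3 * X" using \<epsilon> X0 by (intro add_left_mono mult_right_mono) auto
  finally have "3 * real (card (above f (lev f))) \<le> 2 * real b" using X by simp
  thus ?thesis by linarith
qed

text \<open>The quantifier over \<open>q\<close> makes this a property of the seed alone, although
  the level in use is chosen by all seeds of the walk together.\<close>

definition good :: "seed \<Rightarrow> bool" where
  "good \<psi> \<longleftrightarrow> (\<forall>q\<le>qmax. \<bar>row_estimate b (tau1 FE GE HE A \<psi> q) q - ereal (real (card A))\<bar> \<le> ereal (\<epsilon> * real (card A)))"

definition bins_off where
  "bins_off f g h \<longleftrightarrow> \<epsilon> / 12 * real (card (GE g ` above f (lev f)))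
      < \<bar>real (card (HE h ` GE g ` above f (lev f))) - real b * (1 - (1 - 1 / real b) ^ card (GE g ` above f (lev f)))\<bar>"

lemma good_if:
  assumes f: "good_f f" and g: "inj_on (GE g) (above f (lev f))" and h: "\<not> bins_off f g h"
  shows "good (f, g, h)"
  unfolding good_def
proof (intro allI impI)
  fix q assume q: "q \<le> qmax"
  have cR: "card (GE g ` above f (lev f)) = card (above f (lev f))" by (rule card_image[OF g])
  show "\<bar>row_estimate b (tau1 FE GE HE A (f, g, h) q) q - ereal (real (card A))\<bar> \<le> ereal (\<epsilon> * real (card A))"
    using f g h[unfolded bins_off_def cR] good_f_card[OF f] below_qmax[OF q] finA neA b_def r \<epsilon> HE_less
    by (intro row_estimate_accurate[where r = r]) (auto simp: good_f_def max_level_def above_def)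
qed

text \<open>The event \<open>?B1\<close> is included because \<open>cutoff_level_deviation\<close>
  counts only seeds whose maximal level is not too large. The total is
  \<open>1/2^7 + 1/2^7 + 1/2^6 = 1/2^5\<close>.\<close>

lemma bad_f_count: "real (card {f \<in> seeds df 2. \<not> good_f f}) \<le> 1 / 2 ^ 5 * real (card (seeds df 2))"
proof -
  let ?B1 = "{s \<in> seeds df 2. 2 ^ 7 * real (card A) < 2 ^ max_level s}"
  let ?B2 = "{s \<in> seeds df 2. 2 ^ 8 * 2 ^ max_level s < real (card A)}"
  let ?B3 = "{s \<in> seeds df 2. 2 ^ max_level s \<le> 2 ^ 7 * real (card A) \<and>
       \<epsilon> / 3 * (real (card A) / 2 ^ lev s) < \<bar>real (card (above s (lev s))) - real (card A) / 2 ^ lev s\<bar>}"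
  have "{f \<in> seeds df 2. \<not> good_f f} \<subseteq> ?B1 \<union> ?B2 \<union> ?B3" by (auto simp: good_f_def)
  hence "card {f \<in> seeds df 2. \<not> good_f f} \<le> card (?B1 \<union> ?B2 \<union> ?B3)"
    using finite_seeds by (intro card_mono) auto
  also have "\<dots> \<le> card ?B1 + card ?B2 + card ?B3" by (meson add_mono card_Un_le le_refl le_trans)
  finally have "real (card {f \<in> seeds df 2. \<not> good_f f}) \<le> real (card ?B1 + card ?B2 + card ?B3)"
    by (rule of_nat_mono)
  also have "\<dots> = real (card ?B1) + real (card ?B2) + real (card ?B3)" by (simp only: of_nat_add)
  also have "real (card ?B3) \<le> real (card (seeds df 2)) / 2 ^ 6"
    using cutoff_level_deviation[OF \<epsilon>(1), of r] b_ge r by (simp add: b_def)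
  finally show ?thesis using max_level_too_large max_level_too_small by simp
qed

text \<open>A birthday bound: at most \<open>2 / 3 * b\<close> elements in a range of size
  \<open>2 ^ 5 * b ^ 2\<close> collide with probability at most
  \<open>4 / 9 / 2 ^ 5\<close>.\<close>

lemma bad_g_count:
  assumes "good_f f"
  shows "real (card {g \<in> seeds dg 2. \<not> inj_on (GE g) (above f (lev f))}) \<le> 1 / 2 ^ 6 * real (card (seeds dg 2))"
proof -
  let ?R = "above f (lev f)"
  have RA: "?R \<subseteq> A" by (auto simp: above_def)
  have M: "2 ^ 5 * b ^ 2 = 2 ^ (5 + 2 * r)" by (simp add: b_def power_add power_mult[symmetric] mult.commute)
  have "real (card {g \<in> seeds dg 2. \<not> inj_on (GE g) ?R}) \<le> real (card (seeds dg 2)) * ((real (card ?R))\<^sup>2 / real (2 ^ 5 * b ^ 2))"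
  proof (rule not_inj_count)
    show "finite ?R" using finA RA finite_subset by blast
    show "0 < real (2 ^ 5 * b ^ 2)" using b_pos by simp
    fix x y assume "x \<in> ?R" "y \<in> ?R" "x \<noteq> y"
    hence "x < 2 ^ dg" "y < 2 ^ dg" "x \<noteq> y" using RA Ag by auto
    from hashH_collision[OF pg this M bg]
    show "real (card {s \<in> seeds dg 2. GE s x = GE s y}) \<le> real (card (seeds dg 2)) / real (2 ^ 5 * b ^ 2)"
      by (simp add: GE_def)
  qed (rule finite_seeds)
  also have "\<dots> \<le> real (card (seeds dg 2)) * (1 / 2 ^ 6)"
  proof (intro mult_left_mono)
    have "real (3 * card ?R) \<le> real (2 * b)" using good_f_card[OF assms] by (rule of_nat_mono)
    hence "(3 * real (card ?R))\<^sup>2 \<le> (2 * real b)\<^sup>2" by (intro power_mono) auto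
    hence "9 * (real (card ?R))\<^sup>2 \<le> 4 * real b ^ 2" by (simp add: power_mult_distrib)
    moreover have "0 \<le> real b ^ 2" by simp
    ultimately have "(real (card ?R))\<^sup>2 \<le> 1 / 2 * real b ^ 2" by linarith
    thus "(real (card ?R))\<^sup>2 / real (2 ^ 5 * b ^ 2) \<le> 1 / 2 ^ 6" using b_pos by (simp add: field_simps)
  qed simp
  finally show ?thesis by (simp add: mult.commute)
qed

text \<open>With \<open>f\<close> and \<open>g\<close> fixed only \<open>h\<close> is random.
  Injectivity of \<open>g\<close> carries the size bound on the elements over to the hash values
  thrown into the bins.\<close>

lemma bad_h_count:
  assumes "good_f f" "inj_on (GE g) (above f (lev f))"
  shows "real (card {h \<in> seeds dh k. bins_off f g h}) \<le> 1 / 2 ^ 6 * real (card (seeds dh k))"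
proof -
  let ?R = "GE g ` above f (lev f)"
  have cR: "card ?R = card (above f (lev f))" by (rule card_image[OF assms(2)])
  have RM: "?R \<subseteq> {..<2 ^ dh}" using GE_less bh(1) by (auto intro: less_le_trans)
  have "real (card {h \<in> seeds dh k. bins_off f g h}) \<le> real (card (seeds dh k)) / 2 ^ 6"
    unfolding bins_off_def
  proof (rule occupied_bins_deviation[where k = k])
    show "finite ?R" using finA by (simp add: above_def)
    show "3 * card ?R \<le> 2 * b" using good_f_card[OF assms(1)] by (simp add: cR)
    fix X J assume XJ: "X \<subseteq> ?R" "card X \<le> k" "J \<subseteq> {..<b}"
    show "real (card {s \<in> seeds dh k. \<forall>x\<in>X. HE s x \<in> J}) = real (card (seeds dh k)) * (real (card J) / real b) ^ card X"
      unfolding HE_def using XJ RM k(3) bh(2) by (intro hashH_indep[OF ph _ _ _ b_def]) auto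
  qed (use finite_seeds b_ge_2 \<epsilon> b_ge HE_less k in auto)
  thus ?thesis by simp
qed

text \<open>Each failure is counted only where the preceding stages succeed, so the bounds add up to
  \<open>1/2^5 + 1/2^6 + 1/2^6 = 1/16\<close>.\<close>

lemma bad_count: "real (card {\<psi> \<in> \<Psi>. \<not> good \<psi>}) \<le> 1 / 16 * real (card \<Psi>)"
proof -
  let ?R = "\<lambda>f. above f (lev f)"
  let ?T = "seeds dg 2 \<times> seeds dh k"
  let ?B1 = "{x \<in> \<Psi>. \<not> good_f (fst x)}"
  let ?B2 = "{x \<in> \<Psi>. good_f (fst x) \<and> \<not> inj_on (GE (fst (snd x))) (?R (fst x))}"
  let ?B3 = "{x \<in> \<Psi>. good_f (fst x) \<and> inj_on (GE (fst (snd x))) (?R (fst x)) \<and> bins_off (fst x) (fst (snd x)) (snd (snd x))}"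
  have B1: "real (card ?B1) \<le> 1 / 2 ^ 5 * real (card \<Psi>)"
    unfolding \<Psi>_def using bad_f_count finite_seeds by (intro card_fst_le) auto
  have B2: "real (card ?B2) \<le> 1 / 2 ^ 6 * real (card \<Psi>)"
    unfolding \<Psi>_def
  proof (rule card_dependent_le)
    fix f
    show "real (card {t \<in> ?T. good_f f \<and> \<not> inj_on (GE (fst t)) (?R f)}) \<le> 1 / 2 ^ 6 * real (card ?T)"
    proof (cases "good_f f")
      case True
      thus ?thesis using card_fst_le[OF finite_seeds finite_seeds bad_g_count[OF True], of dh k] by simp
    qed simp
  qed (auto simp: finite_seeds)
  have B3: "real (card ?B3) \<le> 1 / 2 ^ 6 * real (card \<Psi>)"
    unfolding \<Psi>_def
  proof (rule card_dependent_le)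
    fix f
    show "real (card {t \<in> ?T. good_f f \<and> inj_on (GE (fst t)) (?R f) \<and> bins_off f (fst t) (snd t)}) \<le> 1 / 2 ^ 6 * real (card ?T)"
    proof (rule card_dependent_le)
      fix g
      show "real (card {h \<in> seeds dh k. good_f f \<and> inj_on (GE g) (?R f) \<and> bins_off f g h}) \<le> 1 / 2 ^ 6 * real (card (seeds dh k))"
        using bad_h_count[of f g] by (cases "good_f f \<and> inj_on (GE g) (?R f)") auto
    qed (auto simp: finite_seeds)
  qed (auto simp: finite_seeds)
  have "{\<psi> \<in> \<Psi>. \<not> good \<psi>} \<subseteq> ?B1 \<union> ?B2 \<union> ?B3" using good_if by fastforce
  hence "card {\<psi> \<in> \<Psi>. \<not> good \<psi>} \<le> card (?B1 \<union> ?B2 \<union> ?B3)"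
    using fin_\<Psi> by (intro card_mono) auto
  also have "\<dots> \<le> card ?B1 + card ?B2 + card ?B3" by (meson add_mono card_Un_le le_refl le_trans)
  finally have "real (card {\<psi> \<in> \<Psi>. \<not> good \<psi>}) \<le> real (card ?B1 + card ?B2 + card ?B3)"
    by (rule of_nat_mono)
  also have "\<dots> = real (card ?B1) + real (card ?B2) + real (card ?B3)" by (simp only: of_nat_add)
  finally show ?thesis using B1 B2 B3 by simp
qed

text \<open>The average counter at the cutoff \<open>qmax\<close>, shifted to be at least 1; by concavity its logarithm
  bounds the number of bits per counter.\<close>
definition W :: "seed \<Rightarrow> real" where
  "W \<psi> = (\<Sum>j<b. real_of_int (tau1 FE GE HE A \<psi> qmax j + 2)) / real b"

lemma tau1_ge: "tau1 FE GE HE A \<psi> q j \<ge> -1"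
  by (simp add: tau1_def)

lemma W_ge_1: "W \<psi> \<ge> 1"
proof -
  have "(\<Sum>j<b. 1) \<le> (\<Sum>j<b. real_of_int (tau1 FE GE HE A \<psi> qmax j + 2))"
    using tau1_ge[of \<psi> qmax] by (intro sum_mono) (smt (verit) of_int_1_le_iff)
  thus ?thesis using b_pos by (simp add: W_def field_simps)
qed

lemma sum_floor_log_tau_le:
  "real_of_int (\<Sum>j<b. \<lfloor>log 2 (real_of_int (tau1 FE GE HE A \<psi> qmax j) + 2)\<rfloor>) \<le> real b * log 2 (W \<psi>)"
proof -
  have "tau1 FE GE HE A \<psi> qmax j + 2 \<ge> 1" for j using tau1_ge[of \<psi> qmax j] by simp
  from sum_floor_log_le[OF b_pos this] show ?thesis by (simp add: W_def)
qed

text \<open>A maximum of nonnegative terms is at most their sum, and the truncated subtraction makes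
  elements below level \<open>q\<close> contribute 0. Summed over all bins, the right side no longer
  depends on \<open>g\<close> and \<open>h\<close>.\<close>

lemma tau1_le_sum:
  "real_of_int (tau1 FE GE HE A (f, g, h) q j + 1) \<le> (\<Sum>a\<in>{a\<in>A. HE h (GE g a) = j}. real (FE f a + 1 - q))"
proof (cases "tau0 FE GE HE A (f, g, h) j \<ge> int q")
  case True
  define t where "t = nat (tau0 FE GE HE A (f, g, h) j)"
  have t: "tau0 FE GE HE A (f, g, h) j = int t" "q \<le> t" using True by (auto simp: t_def)
  have "int t \<le> tau0 FE GE HE A (f, g, h) j" using t by simp
  then obtain a where a: "a \<in> A" "HE h (GE g a) = j" "t \<le> FE f a" using tau0_ge_iff[OF finA] by blast
  have "tau1 FE GE HE A (f, g, h) q j + 1 = int (t + 1 - q)" using t by (simp add: tau1_def of_nat_diff)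
  hence "real_of_int (tau1 FE GE HE A (f, g, h) q j + 1) = real (t + 1 - q)" by linarith
  also have "\<dots> \<le> real (FE f a + 1 - q)" using a by simp
  also have "\<dots> \<le> (\<Sum>a\<in>{a\<in>A. HE h (GE g a) = j}. real (FE f a + 1 - q))"
    using a finA by (intro member_le_sum) auto
  finally show ?thesis .
next
  case False
  hence "tau1 FE GE HE A (f, g, h) q j + 1 = 0" by (simp add: tau1_def)
  thus ?thesis by (simp only: of_int_0) (simp add: sum_nonneg)
qed

lemma W_le: "W (f, g, h) \<le> 1 + (\<Sum>a\<in>A. real (FE f a + 1 - qmax)) / real b"
proof -
  have "(\<Sum>j<b. real_of_int (tau1 FE GE HE A (f, g, h) qmax j + 2))
     = real b + (\<Sum>j<b. real_of_int (tau1 FE GE HE A (f, g, h) qmax j + 1))"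
    by (simp add: sum.distrib)
  also have "\<dots> \<le> real b + (\<Sum>j<b. \<Sum>a\<in>{a\<in>A. HE h (GE g a) = j}. real (FE f a + 1 - qmax))"
    by (intro add_left_mono sum_mono tau1_le_sum)
  also have "(\<Sum>j<b. \<Sum>a\<in>{a\<in>A. HE h (GE g a) = j}. real (FE f a + 1 - qmax)) = (\<Sum>a\<in>A. real (FE f a + 1 - qmax))"
    using finA HE_less by (intro sum.group) auto
  finally have "W (f, g, h) \<le> (real b + (\<Sum>a\<in>A. real (FE f a + 1 - qmax))) / real b"
    unfolding W_def using b_pos by (intro divide_right_mono) auto
  thus ?thesis using b_pos by (simp add: add_divide_distrib)
qed

text \<open>Layer-cake summation: the excess of an element counts the levels from
  \<open>qmax\<close> to its own. The expected total is \<open>card A\<close> times a geometric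
  tail, at most \<open>2 * card A / 2 ^ qmax\<close>, and \<open>qmax\<close> was chosen to make
  this at most \<open>2 * b\<close>.\<close>

lemma level_excess_sum:
  "(\<Sum>f\<in>seeds df 2. \<Sum>a\<in>A. real (FE f a + 1 - qmax)) \<le> real (card (seeds df 2)) * (2 * real b)"
proof -
  let ?S = "seeds df 2"
  have e: "real (FE f a + 1 - qmax) = (\<Sum>u\<in>{qmax..df}. of_bool (u \<le> FE f a))" for f a
  proof -
    have "{qmax..df} \<inter> {u. u \<le> FE f a} = {qmax..FE f a}" using F_le[of f a] by auto
    thus ?thesis by (simp add: sum.If_cases of_bool_def)
  qed
  have "(\<Sum>f\<in>?S. \<Sum>a\<in>A. real (FE f a + 1 - qmax)) = (\<Sum>a\<in>A. \<Sum>f\<in>?S. \<Sum>u\<in>{qmax..df}. of_bool (u \<le> FE f a))"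
    unfolding e by (rule sum.swap)
  also have "\<dots> = (\<Sum>a\<in>A. \<Sum>u\<in>{qmax..df}. \<Sum>f\<in>?S. of_bool (u \<le> FE f a))" by (intro sum.cong refl sum.swap)
  also have "\<dots> = (\<Sum>a\<in>A. \<Sum>u\<in>{qmax..df}. real (card ?S) * (1 / 2 ^ u))"
    using F_one finite_seeds by (intro sum.cong refl) (simp add: sum.If_cases of_bool_def Int_def)
  also have "\<dots> = real (card A) * real (card ?S) * (\<Sum>u\<in>{qmax..df}. 1 / 2 ^ u)"
    by (simp add: sum_distrib_left mult_ac)
  also have "\<dots> \<le> real (card A) * real (card ?S) * (2 / 2 ^ qmax)"
  proof (intro mult_left_mono)
    have "(\<Sum>u\<in>{m..m + i}. 1 / 2 ^ u :: real) \<le> 2 / 2 ^ m - 1 / 2 ^ (m + i)" for m i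
    proof (induction i)
      case (Suc i)
      have "(1::real) / 2 ^ (m + i) = 2 * (1 / 2 ^ (m + Suc i))" by simp
      thus ?case using Suc by simp
    qed simp
    from this[of qmax "df - qmax"] show "(\<Sum>u\<in>{qmax..df}. 1 / 2 ^ u :: real) \<le> 2 / 2 ^ qmax"
      by (cases "qmax \<le> df") (auto intro: order_trans)
  qed simp
  also have "\<dots> = real (card ?S) * (2 * (real (card A) / 2 ^ qmax))" by simp
  also have "\<dots> \<le> real (card ?S) * (2 * real b)"
  proof (intro mult_left_mono)
    have "real (card A) \<le> real b * 2 ^ qmax" using of_nat_mono[OF card_A_le_qmax, where 'a = real] by simp
    thus "real (card A) / 2 ^ qmax \<le> real b" by (simp add: field_simps)
  qed auto
  finally show ?thesis .
qed

lemma W_mean: "(\<Sum>\<psi>\<in>\<Psi>. W \<psi>) \<le> 3 * real (card \<Psi>)"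
proof -
  let ?T = "seeds dg 2 \<times> seeds dh k"
  have "(\<Sum>\<psi>\<in>\<Psi>. W \<psi>) = (\<Sum>f\<in>seeds df 2. \<Sum>t\<in>?T. W (f, t))"
    unfolding \<Psi>_def by (simp add: sum.cartesian_product)
  also have "\<dots> \<le> (\<Sum>f\<in>seeds df 2. \<Sum>t\<in>?T. 1 + (\<Sum>a\<in>A. real (FE f a + 1 - qmax)) / real b)"
    using W_le by (intro sum_mono) auto
  also have "\<dots> = real (card ?T) * (real (card (seeds df 2)) + (\<Sum>f\<in>seeds df 2. \<Sum>a\<in>A. real (FE f a + 1 - qmax)) / real b)"
    by (simp add: sum.distrib sum_divide_distrib flip: sum_distrib_left)
  also have "\<dots> \<le> real (card ?T) * (real (card (seeds df 2)) + real (card (seeds df 2)) * (2 * real b) / real b)"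
    using level_excess_sum by (intro mult_left_mono add_left_mono divide_right_mono) auto
  also have "\<dots> = 3 * real (card \<Psi>)" using b_pos by (simp add: \<Psi>_def card_cartesian_product algebra_simps)
  finally show ?thesis .
qed

end

section \<open>Spectral bound for regular graphs\<close>

lemma trace_mult_comm:
  fixes P Q :: "'a :: comm_semiring_0 mat"
  assumes "P \<in> carrier_mat n n" "Q \<in> carrier_mat n n"
  shows "(\<Sum>i<n. (P * Q) $$ (i, i)) = (\<Sum>i<n. (Q * P) $$ (i, i))"
proof -
  have "(\<Sum>i<n. (P * Q) $$ (i, i)) = (\<Sum>i<n. \<Sum>j<n. P $$ (i, j) * Q $$ (j, i))"
    using assms by (intro sum.cong) (auto simp: scalar_prod_def lessThan_atLeast0)
  also have "\<dots> = (\<Sum>j<n. \<Sum>i<n. P $$ (i, j) * Q $$ (j, i))" by (rule sum.swap)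
  also have "\<dots> = (\<Sum>j<n. (Q * P) $$ (j, j))"
    using assms by (intro sum.cong) (auto simp: scalar_prod_def lessThan_atLeast0 mult.commute)
  finally show ?thesis .
qed

lemma upper_triangular_pow:
  fixes B :: "'a :: semiring_1 mat"
  assumes B: "B \<in> carrier_mat n n" "upper_triangular B"
  shows "upper_triangular (B ^\<^sub>m m) \<and> (\<forall>i<n. (B ^\<^sub>m m) $$ (i, i) = (B $$ (i, i)) ^ m)"
proof (induction m)
  case 0
  thus ?case using B by auto
next
  case (Suc m)
  let ?C = "B ^\<^sub>m m"
  have C: "?C \<in> carrier_mat n n" using B(1) by auto
  have e: "(?C * B) $$ (i, j) = (\<Sum>k<n. ?C $$ (i, k) * B $$ (k, j))" if "i < n" "j < n" for i j
    using that B(1) C by (auto simp: scalar_prod_def lessThan_atLeast0)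
  have z: "?C $$ (i, k) * B $$ (k, j) = 0" if "i < n" "k < n" "j < n" "k < i \<or> j < k" for i j k
    using that upper_triangularD[OF B(2), of j k] upper_triangularD[of ?C k i] Suc.IH B(1) C by auto
  have "(?C * B) $$ (i, j) = 0" if "j < i" "i < n" for i j
  proof -
    have "?C $$ (i, k) * B $$ (k, j) = 0" if "k < n" for k
      using z[of i k j] that \<open>j < i\<close> \<open>i < n\<close> by (cases "k < i") auto
    thus ?thesis using that e[of i j] by simp
  qed
  moreover have "(?C * B) $$ (i, i) = (B $$ (i, i)) ^ Suc m" if i: "i < n" for i
  proof -
    have "(?C * B) $$ (i, i) = (\<Sum>k<n. if k = i then ?C $$ (i, i) * B $$ (i, i) else 0)"
      unfolding e[OF i i] using z[of i _ i] i by (intro sum.cong) (auto simp: nat_neq_iff)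
    thus ?thesis using i Suc.IH by (simp add: power_commutes)
  qed
  ultimately show ?case using C B(1) by (auto intro!: upper_triangularI)
qed

text \<open>Triangularisation replaces diagonalisation: the powers of the triangular factor carry
  the powers of the eigenvalues on the diagonal, and the trace is invariant under
  conjugation.\<close>

lemma trace_pow_eigenvalues:
  fixes A :: "complex mat"
  assumes A: "A \<in> carrier_mat n n" and c: "char_poly A = (\<Prod>e\<leftarrow>es. [:- e, 1:])"
  shows "(\<Sum>i<n. (A ^\<^sub>m m) $$ (i, i)) = (\<Sum>e\<leftarrow>es. e ^ m)"
proof -
  obtain B P Q where dec: "schur_decomposition A es = (B, P, Q)" by (metis prod_cases3)
  from schur_decomposition[OF A c dec]
  have sim: "similar_mat_wit A B P Q" and ut: "upper_triangular B" and diag: "diag_mat B = es" by auto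
  have BPQ: "B \<in> carrier_mat n n" "P \<in> carrier_mat n n" "Q \<in> carrier_mat n n" and QP: "Q * P = 1\<^sub>m n"
    using sim A unfolding similar_mat_wit_def Let_def by auto
  have Bm: "B ^\<^sub>m m \<in> carrier_mat n n" using BPQ by auto
  have "(\<Sum>i<n. (A ^\<^sub>m m) $$ (i, i)) = (\<Sum>i<n. ((P * B ^\<^sub>m m) * Q) $$ (i, i))"
    using similar_mat_wit_pow_id[OF sim, of m] by simp
  also have "\<dots> = (\<Sum>i<n. (Q * (P * B ^\<^sub>m m)) $$ (i, i))"
    using BPQ Bm by (intro trace_mult_comm) auto
  also have "Q * (P * B ^\<^sub>m m) = B ^\<^sub>m m"
    using BPQ Bm QP by (simp flip: assoc_mult_mat[of Q n n P n "B ^\<^sub>m m" n])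
  also have "(\<Sum>i<n. (B ^\<^sub>m m) $$ (i, i)) = (\<Sum>i<n. (B $$ (i, i)) ^ m)"
    using upper_triangular_pow[OF BPQ(1) ut] by simp
  also have "\<dots> = (\<Sum>e\<leftarrow>diag_mat B. e ^ m)"
    using BPQ(1) by (simp add: diag_mat_def sum_list_map_eq_sum_count comp_def interv_sum_list_conv_sum_set_nat lessThan_atLeast0)
  finally show ?thesis by (simp add: diag)
qed

text \<open>Compare both sides of the eigenvector equation at a coordinate of maximal
  modulus.\<close>

lemma eigenvalue_cmod_le_row_sum:
  fixes A :: "complex mat"
  assumes A: "A \<in> carrier_mat n n" and ev: "eigenvalue A x"
    and row: "\<And>i. i < n \<Longrightarrow> (\<Sum>j<n. cmod (A $$ (i, j))) \<le> D"
  shows "cmod x \<le> D"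
proof -
  obtain v where v: "v \<in> carrier_vec n" "v \<noteq> 0\<^sub>v n" "A *\<^sub>v v = x \<cdot>\<^sub>v v"
    using ev A unfolding eigenvalue_def eigenvector_def by auto
  then obtain i0 where i0: "i0 < n" "v $ i0 \<noteq> 0" by (metis carrier_vecD eq_vecI index_zero_vec)
  define w where "w = Max ((\<lambda>i. cmod (v $ i)) ` {..<n})"
  have fin: "finite ((\<lambda>i. cmod (v $ i)) ` {..<n})" and ne: "(\<lambda>i. cmod (v $ i)) ` {..<n} \<noteq> {}" using i0 by auto
  obtain i where i: "i < n" "cmod (v $ i) = w" using Max_in[OF fin ne] by (auto simp: w_def)
  have le: "cmod (v $ j) \<le> w" if "j < n" for j
    unfolding w_def using fin that by (intro Max_ge) auto
  have w0: "w > 0" using le[OF i0(1)] i0(2) by (smt (verit) zero_less_norm_iff)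
  have "x * v $ i = (A *\<^sub>v v) $ i" using v i by simp
  also have "\<dots> = (\<Sum>j<n. A $$ (i, j) * v $ j)"
    using A v(1) i(1) by (auto simp: scalar_prod_def lessThan_atLeast0)
  finally have "cmod x * w = cmod (\<Sum>j<n. A $$ (i, j) * v $ j)" using i by (metis norm_mult)
  also have "\<dots> \<le> (\<Sum>j<n. cmod (A $$ (i, j)) * w)"
    by (rule order_trans[OF norm_sum]) (auto intro!: sum_mono mult_left_mono le simp: norm_mult)
  also have "\<dots> = (\<Sum>j<n. cmod (A $$ (i, j))) * w" by (simp add: sum_distrib_right)
  also have "\<dots> \<le> D * w" using row[OF i(1)] w0 by (intro mult_right_mono) auto
  finally show ?thesis using w0 by simp
qed

text \<open>Log-convexity makes the ratios \<open>x (Suc m) / x m\<close> nondecreasing, so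
  \<open>x m\<close> grows at least like \<open>(x 1 / x 0) ^ m\<close>. A first ratio above
  \<open>s\<close> would eventually beat \<open>C * s ^ m\<close>, whatever the constant
  \<open>C\<close> is.\<close>

lemma log_convex_growth:
  fixes x :: "nat \<Rightarrow> real"
  assumes nn: "\<And>m. x m \<ge> 0" and conv: "\<And>m. (x (Suc m))\<^sup>2 \<le> x m * x (Suc (Suc m))"
    and bd: "\<And>m. x m \<le> C * s ^ m" and s: "s \<ge> 0"
  shows "x 1 \<le> s * x 0"
proof (rule ccontr)
  assume "\<not> x 1 \<le> s * x 0"
  hence gt: "x 1 > s * x 0" by simp
  have x0: "x 0 > 0"
  proof (rule ccontr)
    assume "\<not> x 0 > 0"
    hence "x 0 = 0" using nn[of 0] by simp
    thus False using conv[of 0] gt by simp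
  qed
  define r where "r = x 1 / x 0"
  have rs: "r > s" using gt x0 by (simp add: r_def field_simps)
  have step: "x m > 0 \<and> x (Suc m) \<ge> r * x m" for m
  proof (induction m)
    case 0
    thus ?case using x0 by (simp add: r_def)
  next
    case (Suc m)
    have pos: "x (Suc m) > 0" using Suc rs s by (smt (verit) mult_pos_pos)
    have "x m * (r * x (Suc m)) \<le> x (Suc m) * x (Suc m)"
      using mult_right_mono[of "r * x m" "x (Suc m)" "x (Suc m)"] Suc pos by (simp add: mult_ac)
    also have "\<dots> \<le> x m * x (Suc (Suc m))" using conv[of m] by (simp add: power2_eq_square)
    finally have "r * x (Suc m) \<le> x (Suc (Suc m))" using Suc by simp
    thus ?case using pos by simp
  qed
  have ge: "x m \<ge> r ^ m * x 0" for m
  proof (induction m)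
    case (Suc m)
    have "r ^ Suc m * x 0 = r * (r ^ m * x 0)" by simp
    also have "\<dots> \<le> r * x m" using Suc rs s by (intro mult_left_mono) auto
    also have "\<dots> \<le> x (Suc m)" using step by simp
    finally show ?case .
  qed simp
  show False
  proof (cases "s = 0")
    case True
    thus ?thesis using bd[of 1] step[of 1] by simp
  next
    case False
    hence s0: "s > 0" using s by simp
    obtain m where "C / x 0 < (r / s) ^ m" using real_arch_pow[of "r / s"] rs s0 by auto
    hence "C * s ^ m < r ^ m * x 0" using x0 s0 by (simp add: field_simps)
    thus False using ge[of m] bd[of m] by simp
  qed
qed

section \<open>Adjacency operator and walk counts of a regular multigraph\<close>

definition adj_op :: "'v set \<Rightarrow> ('v \<Rightarrow> 'v \<Rightarrow> nat) \<Rightarrow> ('v \<Rightarrow> real) \<Rightarrow> 'v \<Rightarrow> real" where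
  "adj_op V a \<phi> u = (\<Sum>w\<in>V. real (a u w) * \<phi> w)"

text \<open>Entries of the matrix powers, indexed by the vertices themselves and with natural
  values; the enumeration \<open>enum_of\<close> enters only where eigenvalues are needed.\<close>

fun walk_count :: "'v set \<Rightarrow> ('v \<Rightarrow> 'v \<Rightarrow> nat) \<Rightarrow> nat \<Rightarrow> 'v \<Rightarrow> 'v \<Rightarrow> nat" where
  "walk_count V a 0 u v = of_bool (u = v)"
| "walk_count V a (Suc m) u v = (\<Sum>w\<in>V. walk_count V a m u w * a w v)"

lemma walk_count_add:
  assumes "finite V" "v \<in> V"
  shows "walk_count V a (m + n) u v = (\<Sum>w\<in>V. walk_count V a m u w * walk_count V a n w v)"
  using assms(2)
proof (induction n arbitrary: v)
  case 0
  thus ?case using assms(1) by (simp add: of_bool_def if_distrib cong: if_cong)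
next
  case (Suc n)
  have "walk_count V a (m + Suc n) u v = (\<Sum>x\<in>V. (\<Sum>w\<in>V. walk_count V a m u w * walk_count V a n w x) * a x v)"
    using Suc by simp
  also have "\<dots> = (\<Sum>x\<in>V. \<Sum>w\<in>V. walk_count V a m u w * (walk_count V a n w x * a x v))"
    by (simp add: sum_distrib_right mult.assoc)
  also have "\<dots> = (\<Sum>w\<in>V. \<Sum>x\<in>V. walk_count V a m u w * (walk_count V a n w x * a x v))" by (rule sum.swap)
  finally show ?case by (simp add: sum_distrib_left)
qed

lemma walk_count_1:
  assumes "finite V" "u \<in> V"
  shows "walk_count V a 1 u v = a u v"
proof -
  have "walk_count V a 1 u v = (\<Sum>w\<in>V. if w = u then a u v else 0)"
    by (simp del: sum.delta sum.delta') (intro sum.cong, auto)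
  thus ?thesis using assms by simp
qed

context
  fixes V :: "'v set" and a :: "'v \<Rightarrow> 'v \<Rightarrow> nat" and D :: nat
  assumes reg: "regular V a D"
begin

lemma fin_V: "finite V"
  and adj_sym: "u \<in> V \<Longrightarrow> v \<in> V \<Longrightarrow> a u v = a v u"
  and adj_row_sum: "u \<in> V \<Longrightarrow> (\<Sum>v\<in>V. a u v) = D"
  using reg by (auto simp: regular_def)

lemma walk_count_Suc':
  assumes "u \<in> V" "v \<in> V"
  shows "walk_count V a (Suc m) u v = (\<Sum>w\<in>V. a u w * walk_count V a m w v)"
  using walk_count_add[OF fin_V assms(2), of a 1 m u] walk_count_1[OF fin_V assms(1), of a]
  by simp

lemma walk_count_sym: "u \<in> V \<Longrightarrow> v \<in> V \<Longrightarrow> walk_count V a m u v = walk_count V a m v u"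
proof (induction m arbitrary: u v)
  case (Suc m)
  have "walk_count V a (Suc m) u v = (\<Sum>w\<in>V. a v w * walk_count V a m w u)"
    using Suc by (simp add: adj_sym mult.commute)
  thus ?case using walk_count_Suc' Suc by metis
qed auto

lemma walk_count_row_sum: "u \<in> V \<Longrightarrow> (\<Sum>v\<in>V. walk_count V a m u v) = D ^ m"
proof (induction m)
  case 0
  thus ?case using fin_V by (simp add: of_bool_def)
next
  case (Suc m)
  have "(\<Sum>v\<in>V. walk_count V a (Suc m) u v) = (\<Sum>w\<in>V. \<Sum>v\<in>V. walk_count V a m u w * a w v)"
    by simp (rule sum.swap)
  also have "\<dots> = (\<Sum>w\<in>V. walk_count V a m u w * D)"
    by (intro sum.cong) (auto simp: adj_row_sum simp flip: sum_distrib_left)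
  finally show ?case using Suc by (simp flip: sum_distrib_right)
qed

lemma trace_walk_count: "(\<Sum>u\<in>V. walk_count V a (2 * m) u u) = (\<Sum>u\<in>V. \<Sum>w\<in>V. (walk_count V a m u w)\<^sup>2)"
proof (intro sum.cong refl)
  fix u assume u: "u \<in> V"
  have "walk_count V a (2 * m) u u = (\<Sum>w\<in>V. walk_count V a m u w * walk_count V a m w u)"
    using walk_count_add[OF fin_V u, of a m m u] by (simp add: mult_2)
  thus "walk_count V a (2 * m) u u = (\<Sum>w\<in>V. (walk_count V a m u w)\<^sup>2)"
    using walk_count_sym u by (simp add: power2_eq_square cong: sum.cong)
qed

lemma adj_op_pow:
  assumes "u \<in> V"
  shows "(adj_op V a ^^ m) \<phi> u = (\<Sum>w\<in>V. real (walk_count V a m u w) * \<phi> w)"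
  using assms
proof (induction m arbitrary: u)
  case 0
  have "(\<Sum>w\<in>V. real (walk_count V a 0 u w) * \<phi> w) = (\<Sum>w\<in>V. if w = u then \<phi> u else 0)"
    by (intro sum.cong) auto
  thus ?case using fin_V 0 by simp
next
  case (Suc m)
  have "(adj_op V a ^^ Suc m) \<phi> u = (\<Sum>x\<in>V. real (a u x) * (\<Sum>w\<in>V. real (walk_count V a m x w) * \<phi> w))"
    using Suc.IH by (simp add: adj_op_def[of V a "(adj_op V a ^^ m) \<phi>"])
  also have "\<dots> = (\<Sum>x\<in>V. \<Sum>w\<in>V. real (a u x * walk_count V a m x w) * \<phi> w)"
    by (simp add: sum_distrib_left mult.assoc)
  also have "\<dots> = (\<Sum>w\<in>V. \<Sum>x\<in>V. real (a u x * walk_count V a m x w) * \<phi> w)" by (rule sum.swap)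
  also have "\<dots> = (\<Sum>w\<in>V. real (walk_count V a (Suc m) u w) * \<phi> w)"
    using Suc.prems by (intro sum.cong refl) (simp add: walk_count_Suc' flip: sum_distrib_right del: walk_count.simps)
  finally show ?case .
qed

lemma adj_op_selfadjoint: "(\<Sum>u\<in>V. adj_op V a \<phi> u * \<psi> u) = (\<Sum>u\<in>V. \<phi> u * adj_op V a \<psi> u)"
proof -
  have "(\<Sum>u\<in>V. adj_op V a \<phi> u * \<psi> u) = (\<Sum>u\<in>V. \<Sum>w\<in>V. real (a u w) * \<phi> w * \<psi> u)"
    by (simp add: adj_op_def sum_distrib_right)
  also have "\<dots> = (\<Sum>w\<in>V. \<Sum>u\<in>V. real (a u w) * \<phi> w * \<psi> u)" by (rule sum.swap)
  also have "\<dots> = (\<Sum>w\<in>V. \<Sum>u\<in>V. \<phi> w * (real (a w u) * \<psi> u))"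
    by (intro sum.cong refl) (simp add: adj_sym mult_ac)
  finally show ?thesis by (simp add: adj_op_def sum_distrib_left)
qed

text \<open>As \<open>\<phi>\<close> has sum 0, each row of the \<open>m\<close>-th power may be
  shifted by the constant \<open>D ^ m / N\<close>, its mean. Cauchy-Schwarz on the shifted rows
  bounds the left side by their squared Frobenius norm. The shift lowers this norm by
  \<open>D ^ (2 * m)\<close>, and the unshifted norm is a trace by symmetry.\<close>

lemma adj_op_pow_bound_trace:
  assumes "(\<Sum>w\<in>V. \<phi> w) = 0" "V \<noteq> {}"
  shows "(\<Sum>u\<in>V. ((adj_op V a ^^ m) \<phi> u)\<^sup>2)
    \<le> (\<Sum>w\<in>V. (\<phi> w)\<^sup>2) * (real (\<Sum>u\<in>V. walk_count V a (2 * m) u u) - real D ^ (2 * m))"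
proof -
  define N where "N = real (card V)"
  have N: "N > 0" using fin_V assms(2) by (simp add: N_def card_gt_0_iff)
  have row: "((adj_op V a ^^ m) \<phi> u)\<^sup>2 \<le> ((\<Sum>w\<in>V. (real (walk_count V a m u w))\<^sup>2) - real D ^ (2 * m) / N) * (\<Sum>w\<in>V. (\<phi> w)\<^sup>2)"
    if u: "u \<in> V" for u
  proof -
    define r where "r = (\<lambda>w. real (walk_count V a m u w))"
    define c where "c = real D ^ m / N"
    have sr: "(\<Sum>w\<in>V. r w) = N * c"
      using walk_count_row_sum[OF u, of m] N unfolding r_def c_def by (simp flip: of_nat_sum of_nat_power)
    have "(adj_op V a ^^ m) \<phi> u = (\<Sum>w\<in>V. (r w - c) * \<phi> w)"
      using u assms(1) by (simp add: adj_op_pow r_def left_diff_distrib sum_subtractf flip: sum_distrib_left)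
    hence "((adj_op V a ^^ m) \<phi> u)\<^sup>2 \<le> (\<Sum>w\<in>V. (r w - c)\<^sup>2) * (\<Sum>w\<in>V. (\<phi> w)\<^sup>2)"
      using Cauchy_Schwarz_ineq_sum[of "\<lambda>w. r w - c" \<phi> V] by simp
    also have "(\<Sum>w\<in>V. (r w - c)\<^sup>2) = (\<Sum>w\<in>V. (r w)\<^sup>2) - 2 * c * (\<Sum>w\<in>V. r w) + N * c\<^sup>2"
      unfolding power2_diff sum.distrib sum_subtractf sum_distrib_left by (simp add: N_def mult_ac)
    also have "\<dots> = (\<Sum>w\<in>V. (r w)\<^sup>2) - N * c\<^sup>2" unfolding sr by (simp add: power2_eq_square)
    also have "N * c\<^sup>2 = real D ^ (2 * m) / N" using N by (simp add: c_def power2_eq_square power_mult field_simps flip: power_mult_distrib)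
    finally show ?thesis by (simp add: r_def)
  qed
  have "(\<Sum>u\<in>V. ((adj_op V a ^^ m) \<phi> u)\<^sup>2)
     \<le> (\<Sum>u\<in>V. ((\<Sum>w\<in>V. (real (walk_count V a m u w))\<^sup>2) - real D ^ (2 * m) / N) * (\<Sum>w\<in>V. (\<phi> w)\<^sup>2))"
    by (intro sum_mono row)
  also have "\<dots> = ((\<Sum>u\<in>V. \<Sum>w\<in>V. (real (walk_count V a m u w))\<^sup>2) - real D ^ (2 * m)) * (\<Sum>w\<in>V. (\<phi> w)\<^sup>2)"
    using N by (simp add: sum_subtractf N_def flip: sum_distrib_right)
  also have "(\<Sum>u\<in>V. \<Sum>w\<in>V. (real (walk_count V a m u w))\<^sup>2) = real (\<Sum>u\<in>V. walk_count V a (2 * m) u u)"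
    unfolding trace_walk_count by simp
  finally show ?thesis by (simp add: mult.commute)
qed

lemma enum_of_bij: "bij_betw (enum_of V) {..<card V} V"
proof -
  have "\<exists>e. bij_betw e {..<card V} V"
    using ex_bij_betw_nat_finite[OF fin_V] by (simp add: lessThan_atLeast0)
  thus ?thesis unfolding enum_of_def by (rule someI_ex)
qed

lemma adj_mat_pow:
  assumes "i < card V" "j < card V"
  shows "(adj_mat V a ^\<^sub>m m) $$ (i, j) = of_nat (walk_count V a m (enum_of V i) (enum_of V j))"
  using assms
proof (induction m arbitrary: i j)
  case 0
  thus ?case using enum_of_bij by (auto simp: adj_mat_def bij_betw_def inj_on_eq_iff)
next
  case (Suc m)
  have A: "adj_mat V a \<in> carrier_mat (card V) (card V)" by (simp add: adj_mat_def)
  have Am: "adj_mat V a ^\<^sub>m m \<in> carrier_mat (card V) (card V)" using A by auto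
  have "(adj_mat V a ^\<^sub>m Suc m) $$ (i, j)
     = (\<Sum>k<card V. (adj_mat V a ^\<^sub>m m) $$ (i, k) * adj_mat V a $$ (k, j))"
    using A Am Suc.prems by (auto simp: scalar_prod_def lessThan_atLeast0)
  also have "\<dots> = (\<Sum>k<card V. of_nat (walk_count V a m (enum_of V i) (enum_of V k) * a (enum_of V k) (enum_of V j)))"
    using Suc by (intro sum.cong) (auto simp: adj_mat_def)
  also have "\<dots> = (\<Sum>w\<in>V. of_nat (walk_count V a m (enum_of V i) w * a w (enum_of V j)))"
    by (rule sum.reindex_bij_betw[OF enum_of_bij])
  finally show ?case by simp
qed

text \<open>The trace is the sum of the \<open>m\<close>-th powers of the eigenvalues. Sorted by
  modulus, the first is bounded by \<open>D\<close> through the row sums and each of the others by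
  the second modulus.\<close>

lemma walk_count_trace_eigenvalues:
  assumes V: "card V \<ge> 2"
  shows "real (\<Sum>u\<in>V. walk_count V a m u u) \<le> real D ^ m + real (card V - 1) * second_abs_eig V a ^ m"
    and "second_abs_eig V a \<ge> 0"
proof -
  let ?A = "adj_mat V a"
  have A: "?A \<in> carrier_mat (card V) (card V)" by (simp add: adj_mat_def)
  obtain es where es: "char_poly ?A = (\<Prod>e\<leftarrow>es. [:- e, 1:])" "length es = card V"
    using char_poly_factorized[OF A] by auto
  have "proots (\<Prod>e\<leftarrow>es. [:- e, 1:]) = mset es"
  proof (induction es)
    case (Cons e es)
    have "(\<Prod>e\<leftarrow>es. [:- e, 1:]) \<noteq> 0" by (auto simp: prod_list_zero_iff)
    hence "proots ([:- e, 1:] * (\<Prod>e\<leftarrow>es. [:- e, 1:])) = proots [:- e, 1:] + proots (\<Prod>e\<leftarrow>es. [:- e, 1:])"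
      by (intro proots_mult) auto
    thus ?case using Cons by (simp del: mult_pCons_left)
  qed simp
  hence ms: "eigenvalues_mset V a = mset es" by (simp add: eigenvalues_mset_def es)
  define xs where "xs = rev (sorted_list_of_multiset (image_mset cmod (mset es)))"
  have mxs: "mset xs = image_mset cmod (mset es)" by (simp add: xs_def)
  have lxs: "length xs = card V" using mxs es(2) by (metis size_image_mset size_mset)
  have s2: "second_abs_eig V a = xs ! 1"
    unfolding second_abs_eig_def Let_def ms xs_def[symmetric] using lxs V by simp
  have srt: "sorted_wrt (\<ge>) xs" unfolding xs_def sorted_wrt_rev by simp
  have xle: "x \<le> real D \<and> x \<ge> 0" if "x \<in> set xs" for x
  proof -
    have "x \<in># image_mset cmod (mset es)" using that mxs by (metis set_mset_mset)
    then obtain e where e: "e \<in> set es" "x = cmod e" by auto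
    have "poly (char_poly ?A) e = 0" unfolding es(1) using e(1) by (auto simp: poly_prod_list prod_list_zero_iff)
    hence ev: "eigenvalue ?A e" using eigenvalue_root_char_poly[OF A] by simp
    have "cmod e \<le> real D"
    proof (rule eigenvalue_cmod_le_row_sum[OF A ev])
      fix i assume i: "i < card V"
      have "(\<Sum>j<card V. cmod (?A $$ (i, j))) = (\<Sum>j<card V. real (a (enum_of V i) (enum_of V j)))"
        using i by (intro sum.cong) (auto simp: adj_mat_def)
      also have "\<dots> = (\<Sum>w\<in>V. real (a (enum_of V i) w))" by (rule sum.reindex_bij_betw[OF enum_of_bij])
      also have "\<dots> = real D" using adj_row_sum[of "enum_of V i"] enum_of_bij i
        by (auto simp: bij_betw_def simp flip: of_nat_sum)
      finally show "(\<Sum>j<card V. cmod (?A $$ (i, j))) \<le> real D" by simp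
    qed
    thus ?thesis using e by simp
  qed
  show "second_abs_eig V a \<ge> 0" using xle[of "xs ! 1"] s2 lxs V by simp
  obtain x0 x1 ys where xs: "xs = x0 # x1 # ys"
    using lxs V by (metis Suc_le_length_iff numeral_2_eq_2)
  have "complex_of_real (real (\<Sum>u\<in>V. walk_count V a m u u)) = (\<Sum>u\<in>V. of_nat (walk_count V a m u u))" by simp
  also have "\<dots> = (\<Sum>i<card V. of_nat (walk_count V a m (enum_of V i) (enum_of V i)))"
    by (rule sum.reindex_bij_betw[OF enum_of_bij, symmetric])
  also have "\<dots> = (\<Sum>i<card V. (?A ^\<^sub>m m) $$ (i, i))" by (intro sum.cong) (auto simp: adj_mat_pow)
  also have "\<dots> = (\<Sum>e\<leftarrow>es. e ^ m)" by (rule trace_pow_eigenvalues[OF A es(1)])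
  finally have "real (\<Sum>u\<in>V. walk_count V a m u u) = cmod (\<Sum>e\<leftarrow>es. e ^ m)"
    by (metis abs_of_nat norm_of_real)
  also have "\<dots> \<le> (\<Sum>e\<leftarrow>es. cmod e ^ m)"
    by (induction es) (auto simp: norm_power intro: order_trans[OF norm_triangle_ineq])
  also have "\<dots> = (\<Sum>x\<in>#image_mset cmod (mset es). x ^ m)" by (simp add: image_mset.compositionality comp_def sum_mset_sum_list flip: mset_map)
  also have "\<dots> = (\<Sum>x\<leftarrow>xs. x ^ m)" unfolding mxs[symmetric] by (metis mset_map sum_mset_sum_list)
  also have "\<dots> = x0 ^ m + (\<Sum>x\<leftarrow>x1 # ys. x ^ m)" by (simp add: xs)
  also have "\<dots> \<le> real D ^ m + (\<Sum>x\<leftarrow>x1 # ys. x1 ^ m)"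
  proof (intro add_mono power_mono sum_list_mono)
    show "x0 \<le> real D" "0 \<le> x0" using xle[of x0] xs by auto
    fix x assume x: "x \<in> set (x1 # ys)"
    show "x \<le> x1" using srt x xs by auto
    show "0 \<le> x" using xle[of x] x xs by auto
  qed
  also have "(\<Sum>x\<leftarrow>x1 # ys. x1 ^ m) = real (card V - 1) * x1 ^ m"
  proof -
    have "card V - 1 = length (x1 # ys)" using lxs xs by simp
    thus ?thesis by (simp only: sum_list_triv map_replicate_const sum_list_replicate)
  qed
  finally show "real (\<Sum>u\<in>V. walk_count V a m u u) \<le> real D ^ m + real (card V - 1) * second_abs_eig V a ^ m"
    by (simp add: s2 xs)
qed

text \<open>The spectral theorem is avoided: the trace of \<open>A\<^sup>2\<^sup>m\<close> bounds \<open>\<parallel>A\<^sup>m \<phi>\<parallel>\<^sup>2\<close> up to the factor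
  \<open>card V\<close>, and log-convexity of \<open>m \<mapsto> \<parallel>A\<^sup>m \<phi>\<parallel>\<^sup>2\<close> removes that factor as \<open>m\<close> grows.\<close>
lemma adj_op_contraction:
  assumes "(\<Sum>w\<in>V. \<phi> w) = 0"
  shows "(\<Sum>u\<in>V. (adj_op V a \<phi> u)\<^sup>2) \<le> (second_abs_eig V a)\<^sup>2 * (\<Sum>w\<in>V. (\<phi> w)\<^sup>2)"
proof (cases "card V \<ge> 2")
  case False
  \<comment> \<open>With fewer than two eigenvalues \<open>second_abs_eig\<close> has the default
    value 0. The bound still holds, as a function with sum 0 on at most one vertex vanishes.\<close>
  have "\<phi> w = 0" if "w \<in> V" for w
  proof -
    have "card V \<noteq> 0" using that fin_V by auto
    hence "card V = 1" using False by linarith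
    then obtain z where "V = {z}" by (auto simp: card_1_singleton_iff)
    thus ?thesis using assms that by simp
  qed
  thus ?thesis by (simp add: adj_op_def)
next
  case True
  define s where "s = (second_abs_eig V a)\<^sup>2"
  define x where "x = (\<lambda>m. \<Sum>u\<in>V. ((adj_op V a ^^ m) \<phi> u)\<^sup>2)"
  have ne: "V \<noteq> {}" using True by auto
  have "x 1 \<le> s * x 0"
  proof (rule log_convex_growth)
    show "x m \<ge> 0" for m by (simp add: x_def sum_nonneg)
    show "s \<ge> 0" by (simp add: s_def)
    show "(x (Suc m))\<^sup>2 \<le> x m * x (Suc (Suc m))" for m
    proof -
      let ?f = "(adj_op V a ^^ m) \<phi>"
      \<comment> \<open>Moving one operator across the inner product pairs the \<open>m\<close>-th
        iterate with the iterate of order \<open>m + 2\<close>; Cauchy-Schwarz then gives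
        log-convexity.\<close>
      have "x (Suc m) = (\<Sum>u\<in>V. adj_op V a ?f u * adj_op V a ?f u)" by (simp add: x_def power2_eq_square)
      also have "\<dots> = (\<Sum>u\<in>V. ?f u * adj_op V a (adj_op V a ?f) u)" by (rule adj_op_selfadjoint)
      finally show ?thesis
        using Cauchy_Schwarz_ineq_sum[of ?f "adj_op V a (adj_op V a ?f)" V] by (simp add: x_def)
    qed
    show "x m \<le> ((\<Sum>w\<in>V. (\<phi> w)\<^sup>2) * real (card V - 1)) * s ^ m" for m
    proof -
      have "x m \<le> (\<Sum>w\<in>V. (\<phi> w)\<^sup>2) * (real (\<Sum>u\<in>V. walk_count V a (2 * m) u u) - real D ^ (2 * m))"
        unfolding x_def by (rule adj_op_pow_bound_trace[OF assms ne])
      also have "\<dots> \<le> (\<Sum>w\<in>V. (\<phi> w)\<^sup>2) * (real (card V - 1) * second_abs_eig V a ^ (2 * m))"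
        using walk_count_trace_eigenvalues(1)[OF True, of "2 * m"] by (intro mult_left_mono) (auto simp: sum_nonneg)
      finally show ?thesis by (simp add: s_def power_mult mult.assoc)
    qed
  qed
  thus ?thesis by (simp add: x_def s_def)
qed

end

section \<open>Random walks on expanders\<close>

lemma prob_le_expectation:
  fixes h :: "'a \<Rightarrow> real"
  assumes "finite (set_pmf p)" "\<And>x. x \<in> set_pmf p \<Longrightarrow> 0 \<le> h x"
    and "\<And>x. x \<in> set_pmf p \<Longrightarrow> P x \<Longrightarrow> 1 \<le> h x"
  shows "measure_pmf.prob p {x. P x} \<le> measure_pmf.expectation p h"
proof -
  have "measure_pmf.prob p {x. P x} = measure_pmf.expectation p (indicator {x. P x})" by simp
  also have "\<dots> \<le> measure_pmf.expectation p h"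
    using assms by (intro integral_mono_AE integrable_measure_pmf_finite) (auto simp: AE_measure_pmf_iff indicator_def)
  finally show ?thesis .
qed

context
  fixes V :: "'v set" and a :: "'v \<Rightarrow> 'v \<Rightarrow> nat" and D :: nat
  assumes reg: "regular V a D" and D: "D > 0" and neV: "V \<noteq> {}"
begin

lemmas finV = fin_V[OF reg]

lemma pmf_walk_step:
  assumes v: "v \<in> V"
  shows "pmf (walk_step V a v) u = (if u \<in> V then real (a v u) / real D else 0)"
    and "set_pmf (walk_step V a v) \<subseteq> V"
proof -
  define M where "M = (\<Sum>u\<in>V. replicate_mset (a v u) u)"
  have cnt: "count M u = (if u \<in> V then a v u else 0)" for u
    using finV by (simp add: M_def count_sum)
  have "size M = (\<Sum>u\<in>V. size (replicate_mset (a v u) u))"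
    unfolding M_def by (induction V rule: infinite_finite_induct) auto
  hence size: "size M = D" using adj_row_sum[OF reg v] by simp
  hence ne: "M \<noteq> {#}" using D by auto
  show "pmf (walk_step V a v) u = (if u \<in> V then real (a v u) / real D else 0)"
    unfolding walk_step_def M_def[symmetric] using ne cnt size by simp
  have "set_mset M \<subseteq> V" using cnt by (metis count_eq_zero_iff subsetI)
  thus "set_pmf (walk_step V a v) \<subseteq> V"
    unfolding walk_step_def M_def[symmetric] using ne by simp
qed

lemma set_walk_from:
  "v \<in> V \<Longrightarrow> set_pmf (walk_from V a m v) \<subseteq> {\<omega>. set \<omega> \<subseteq> V \<and> length \<omega> = Suc m}"
proof (induction m arbitrary: v)
  case (Suc m)
  thus ?case using pmf_walk_step(2)[of v] by (fastforce simp: set_bind_pmf)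
qed auto

lemma finite_walk_from: "v \<in> V \<Longrightarrow> finite (set_pmf (walk_from V a m v))"
  by (rule finite_subset[OF set_walk_from finite_lists_length_eq[OF finV]])

lemma expectation_walk_from_Suc:
  fixes h :: "'v list \<Rightarrow> real"
  assumes v: "v \<in> V"
  shows "measure_pmf.expectation (walk_from V a (Suc m) v) h
     = adj_op V a (\<lambda>u. measure_pmf.expectation (walk_from V a m u) (\<lambda>\<omega>. h (v # \<omega>))) v / real D"
proof -
  have "measure_pmf.expectation (walk_from V a (Suc m) v) h = (\<Sum>u\<in>V. pmf (walk_step V a v) u *\<^sub>R
      measure_pmf.expectation (map_pmf (Cons v) (walk_from V a m u)) h)"
    using finite_walk_from pmf_walk_step(2)[OF v] finV
    by (simp only: walk_from.simps, intro pmf_expectation_bind) auto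
  thus ?thesis using v by (simp add: pmf_walk_step(1) adj_op_def sum_divide_distrib)
qed

lemma set_walk:
  assumes "l > 0"
  shows "set_pmf (walk V a l) \<subseteq> {\<omega>. set \<omega> \<subseteq> V \<and> length \<omega> = l}"
proof
  fix \<omega> assume "\<omega> \<in> set_pmf (walk V a l)"
  then obtain v where "v \<in> V" "\<omega> \<in> set_pmf (walk_from V a (l - 1) v)"
    using neV finV by (auto simp: walk_def)
  thus "\<omega> \<in> {\<omega>. set \<omega> \<subseteq> V \<and> length \<omega> = l}" using set_walk_from[of v "l - 1"] assms by auto
qed

lemma finite_walk: "finite (set_pmf (walk V a l))"
  using finite_walk_from neV finV by (auto simp: walk_def set_bind_pmf)

lemma expectation_walk:
  fixes h :: "'v list \<Rightarrow> real"
  shows "measure_pmf.expectation (walk V a l) h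
     = (\<Sum>v\<in>V. measure_pmf.expectation (walk_from V a (l - 1) v) h) / real (card V)"
  unfolding walk_def using finite_walk_from neV finV
  by (subst pmf_expectation_bind_pmf_of_set)
     (simp_all add: sum_distrib_left[symmetric] divide_inverse mult.commute)

lemma adj_op_sum: "(\<Sum>v\<in>V. adj_op V a \<phi> v) = real D * (\<Sum>v\<in>V. \<phi> v)"
proof -
  have "(\<Sum>v\<in>V. adj_op V a \<phi> v * 1) = (\<Sum>v\<in>V. \<phi> v * adj_op V a (\<lambda>_. 1) v)"
    by (rule adj_op_selfadjoint[OF reg])
  also have "\<dots> = (\<Sum>v\<in>V. \<phi> v * real D)"
    using adj_row_sum[OF reg] by (intro sum.cong) (auto simp: adj_op_def simp flip: of_nat_sum)
  finally show ?thesis by (simp add: sum_distrib_left mult.commute)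
qed

text \<open>The uniform distribution is stationary on a regular graph, so every position of the walk
  contributes the mean of \<open>W\<close>. The induction runs on the sum over all starting
  vertices, where \<open>adj_op_sum\<close> applies.\<close>

lemma expectation_walk_sum:
  fixes W :: "'v \<Rightarrow> real"
  assumes "l > 0"
  shows "measure_pmf.expectation (walk V a l) (\<lambda>\<omega>. \<Sum>x\<leftarrow>\<omega>. W x) = real l * ((\<Sum>v\<in>V. W v) / real (card V))"
proof -
  have "(\<Sum>v\<in>V. measure_pmf.expectation (walk_from V a m v) (\<lambda>\<omega>. \<Sum>x\<leftarrow>\<omega>. W x)) = real (Suc m) * (\<Sum>v\<in>V. W v)" for m
  proof (induction m)
    case (Suc m)
    let ?E = "\<lambda>m v. measure_pmf.expectation (walk_from V a m v) (\<lambda>\<omega>. \<Sum>x\<leftarrow>\<omega>. W x)"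
    have "?E (Suc m) v = W v + adj_op V a (?E m) v / real D" if v: "v \<in> V" for v
    proof -
      have "?E (Suc m) v = adj_op V a (\<lambda>u. W v + ?E m u) v / real D"
        unfolding expectation_walk_from_Suc[OF v] adj_op_def
        by (intro arg_cong[of _ _ "\<lambda>x. x / real D"] sum.cong refl arg_cong2[of _ _ _ _ "(*)"])
           (auto simp: finite_walk_from integrable_measure_pmf_finite)
      also have "\<dots> = (W v * (\<Sum>u\<in>V. real (a v u)) + adj_op V a (?E m) v) / real D"
        by (simp add: adj_op_def algebra_simps sum.distrib sum_distrib_left)
      also have "(\<Sum>u\<in>V. real (a v u)) = real D" using adj_row_sum[OF reg v] by (simp flip: of_nat_sum)
      finally show ?thesis using D by (simp add: add_divide_distrib)
    qed
    hence "(\<Sum>v\<in>V. ?E (Suc m) v) = (\<Sum>v\<in>V. W v) + (\<Sum>v\<in>V. adj_op V a (?E m) v) / real D"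
      by (simp add: sum.distrib sum_divide_distrib)
    also have "\<dots> = (\<Sum>v\<in>V. W v) + real (Suc m) * (\<Sum>v\<in>V. W v)"
      unfolding adj_op_sum Suc using D by simp
    finally show ?case by (simp add: algebra_simps)
  qed simp
  from this[of "l - 1"] show ?thesis using assms by (simp add: expectation_walk)
qed

text \<open>A norm bound for the normalised adjacency operator conjugated by \<open>sqrt Z\<close>.
  Split \<open>sqrt Z * \<phi>\<close> into its mean \<open>c\<close> and a part of sum 0. The
  operator fixes the constant part, and Cauchy-Schwarz bounds its contribution by the mean of
  \<open>Z\<close>. The other part shrinks by \<open>lam\<close>, and each of the two factors
  \<open>sqrt Z\<close> costs at most \<open>sqrt M\<close>.\<close>

lemma weighted_step_norm:
  fixes Z \<phi> :: "'v \<Rightarrow> real"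
  assumes Z: "\<And>v. v \<in> V \<Longrightarrow> 0 \<le> Z v" "\<And>v. v \<in> V \<Longrightarrow> Z v \<le> M"
    and lam: "second_abs_eig V a \<le> real D * lam" "lam \<ge> 0"
  shows "L2_set (\<lambda>v. sqrt (Z v) * adj_op V a (\<lambda>u. sqrt (Z u) * \<phi> u) v / real D) V
     \<le> ((\<Sum>v\<in>V. Z v) / real (card V) + lam * M) * L2_set \<phi> V"
proof -
  define N where "N = real (card V)"
  have N: "N > 0" using finV neV by (simp add: N_def card_gt_0_iff)
  define \<mu> where "\<mu> = (\<Sum>v\<in>V. Z v) / N"
  have \<mu>0: "\<mu> \<ge> 0" using Z N by (auto simp: \<mu>_def sum_nonneg)
  have M0: "M \<ge> 0" using Z neV by force
  define \<psi> where "\<psi> = (\<lambda>u. sqrt (Z u) * \<phi> u)"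
  define c where "c = (\<Sum>u\<in>V. \<psi> u) / N"
  define \<psi>' where "\<psi>' = (\<lambda>u. \<psi> u - c)"
  have split: "sqrt (Z v) * adj_op V a \<psi> v / real D = sqrt (Z v) * c + sqrt (Z v) * (adj_op V a \<psi>' v / real D)"
    if v: "v \<in> V" for v
  proof -
    have "adj_op V a \<psi>' v = adj_op V a \<psi> v - c * (\<Sum>u\<in>V. real (a v u))"
      unfolding adj_op_def \<psi>'_def right_diff_distrib sum_subtractf by (simp add: sum_distrib_left mult.commute)
    also have "(\<Sum>u\<in>V. real (a v u)) = real D" using adj_row_sum[OF reg v] by (simp flip: of_nat_sum)
    finally have "adj_op V a \<psi> v = adj_op V a \<psi>' v + c * real D" by simp
    thus ?thesis using D by (simp add: field_simps)
  qed
  have LZ: "L2_set (\<lambda>v. sqrt (Z v)) V = sqrt (N * \<mu>)"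
    using Z N by (simp add: L2_set_def \<mu>_def)
  have "\<bar>\<Sum>u\<in>V. \<psi> u\<bar> \<le> L2_set (\<lambda>v. sqrt (Z v)) V * L2_set \<phi> V"
    by (rule order_trans[OF sum_abs order_trans[OF _ L2_set_mult_ineq]]) (simp add: \<psi>_def abs_mult)
  hence "N * \<bar>c\<bar> \<le> sqrt (N * \<mu>) * L2_set \<phi> V" using N by (simp add: c_def LZ)
  hence "sqrt (N * \<mu>) * (N * \<bar>c\<bar>) \<le> sqrt (N * \<mu>) * (sqrt (N * \<mu>) * L2_set \<phi> V)"
    using N \<mu>0 by (intro mult_left_mono) auto
  also have "\<dots> = N * \<mu> * L2_set \<phi> V" using N \<mu>0 by simp
  finally have "N * (sqrt (N * \<mu>) * \<bar>c\<bar>) \<le> N * (\<mu> * L2_set \<phi> V)" by (simp only: mult_ac)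
  hence "sqrt (N * \<mu>) * \<bar>c\<bar> \<le> \<mu> * L2_set \<phi> V" using N by simp
  moreover have "L2_set (\<lambda>v. sqrt (Z v) * c) V = sqrt (N * \<mu>) * \<bar>c\<bar>"
  proof -
    have "L2_set (\<lambda>v. sqrt (Z v) * c) V = L2_set (\<lambda>v. sqrt (Z v) * \<bar>c\<bar>) V"
      by (simp add: L2_set_def power_mult_distrib)
    thus ?thesis by (simp add: LZ flip: L2_set_left_distrib)
  qed
  ultimately have part1: "L2_set (\<lambda>v. sqrt (Z v) * c) V \<le> \<mu> * L2_set \<phi> V" by simp
  have sum0: "(\<Sum>u\<in>V. \<psi>' u) = 0" using N by (simp add: \<psi>'_def sum_subtractf c_def N_def)
  have adj: "L2_set (adj_op V a \<psi>') V \<le> real D * lam * L2_set \<psi>' V"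
  proof (cases "card V < 2")
    case True
    hence "card V = 1" using N by (simp add: N_def)
    then obtain z where "V = {z}" by (auto simp: card_1_singleton_iff)
    thus ?thesis using sum0 by (simp add: adj_op_def)
  next
    case False
    hence e0: "second_abs_eig V a \<ge> 0" using walk_count_trace_eigenvalues(2)[OF reg] by simp
    have "L2_set (adj_op V a \<psi>') V \<le> sqrt ((second_abs_eig V a)\<^sup>2 * (\<Sum>w\<in>V. (\<psi>' w)\<^sup>2))"
      unfolding L2_set_def using adj_op_contraction[OF reg sum0] by simp
    also have "\<dots> = second_abs_eig V a * L2_set \<psi>' V" using e0 by (simp add: real_sqrt_mult L2_set_def)
    also have "\<dots> \<le> real D * lam * L2_set \<psi>' V" using lam by (intro mult_right_mono) auto
    finally show ?thesis .
  qed
  have "(\<Sum>u\<in>V. (\<psi>' u)\<^sup>2) = (\<Sum>u\<in>V. (\<psi> u)\<^sup>2) - 2 * c * (\<Sum>u\<in>V. \<psi> u) + N * c\<^sup>2"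
    unfolding \<psi>'_def power2_diff sum.distrib sum_subtractf sum_distrib_left by (simp add: N_def mult_ac)
  also have "\<dots> = (\<Sum>u\<in>V. (\<psi> u)\<^sup>2) - N * c\<^sup>2" using N by (simp add: c_def power2_eq_square)
  finally have "(\<Sum>u\<in>V. (\<psi>' u)\<^sup>2) \<le> (\<Sum>u\<in>V. (\<psi> u)\<^sup>2)" using N by simp
  hence "L2_set \<psi>' V \<le> L2_set \<psi> V" by (simp add: L2_set_def)
  also have "\<dots> \<le> L2_set (\<lambda>v. sqrt M * \<bar>\<phi> v\<bar>) V"
  proof -
    have "L2_set \<psi> V = L2_set (\<lambda>v. sqrt (Z v) * \<bar>\<phi> v\<bar>) V" by (simp add: \<psi>_def L2_set_def power_mult_distrib)
    also have "\<dots> \<le> L2_set (\<lambda>v. sqrt M * \<bar>\<phi> v\<bar>) V"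
      using Z by (intro L2_set_mono mult_right_mono) auto
    finally show ?thesis .
  qed
  also have "\<dots> = sqrt M * L2_set \<phi> V" using M0 by (subst L2_set_right_distrib[symmetric]) (auto simp: L2_set_def)
  finally have psi: "L2_set \<psi>' V \<le> sqrt M * L2_set \<phi> V" .
  have "L2_set (\<lambda>v. sqrt (Z v) * (adj_op V a \<psi>' v / real D)) V
     = L2_set (\<lambda>v. sqrt (Z v) * (\<bar>adj_op V a \<psi>' v\<bar> / real D)) V" by (simp add: L2_set_def power_mult_distrib power_divide)
  also have "\<dots> \<le> L2_set (\<lambda>v. sqrt M / real D * \<bar>adj_op V a \<psi>' v\<bar>) V"
  proof (rule L2_set_mono)
    fix v assume v: "v \<in> V"
    have "sqrt (Z v) * (\<bar>adj_op V a \<psi>' v\<bar> / real D) \<le> sqrt M * (\<bar>adj_op V a \<psi>' v\<bar> / real D)"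
      using Z v by (intro mult_right_mono) auto
    thus "sqrt (Z v) * (\<bar>adj_op V a \<psi>' v\<bar> / real D) \<le> sqrt M / real D * \<bar>adj_op V a \<psi>' v\<bar>" by simp
  qed (use Z in auto)
  also have "\<dots> = sqrt M / real D * L2_set (adj_op V a \<psi>') V"
    using M0 by (subst L2_set_right_distrib[symmetric]) (auto simp: L2_set_def)
  also have "\<dots> \<le> sqrt M / real D * (real D * lam * L2_set \<psi>' V)" using M0 adj by (intro mult_left_mono) auto
  also have "\<dots> = sqrt M * lam * L2_set \<psi>' V" using D by simp
  also have "\<dots> \<le> sqrt M * lam * (sqrt M * L2_set \<phi> V)" using M0 lam psi by (intro mult_left_mono) auto
  also have "\<dots> = lam * M * L2_set \<phi> V" using M0 by simp
  finally have part2: "L2_set (\<lambda>v. sqrt (Z v) * (adj_op V a \<psi>' v / real D)) V \<le> lam * M * L2_set \<phi> V" .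
  have "L2_set (\<lambda>v. sqrt (Z v) * adj_op V a \<psi> v / real D) V
     = L2_set (\<lambda>v. sqrt (Z v) * c + sqrt (Z v) * (adj_op V a \<psi>' v / real D)) V"
    using split by (intro L2_set_cong) auto
  also have "\<dots> \<le> \<mu> * L2_set \<phi> V + lam * M * L2_set \<phi> V"
    by (rule order_trans[OF L2_set_triangle_ineq]) (intro add_mono part1 part2)
  finally show ?thesis by (simp add: \<psi>_def \<mu>_def N_def algebra_simps)
qed

text \<open>Each weight is split as \<open>sqrt Z * sqrt Z\<close> and shared between the two
  adjacent steps, so that the walk becomes a power of the symmetric operator \<open>T\<close> of
  \<open>weighted_step_norm\<close> applied to \<open>sqrt Z\<close>.\<close>

lemma expectation_walk_prod:
  fixes Z :: "'v \<Rightarrow> real"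
  assumes Z: "\<And>v. v \<in> V \<Longrightarrow> 0 \<le> Z v" "\<And>v. v \<in> V \<Longrightarrow> Z v \<le> M"
    and lam: "second_abs_eig V a \<le> real D * lam" "lam \<ge> 0" and l: "l > 0"
  shows "measure_pmf.expectation (walk V a l) (\<lambda>\<omega>. \<Prod>x\<leftarrow>\<omega>. Z x)
     \<le> ((\<Sum>v\<in>V. Z v) / real (card V) + lam * M) ^ l"
proof -
  define N where "N = real (card V)"
  have N: "N > 0" using finV neV by (simp add: N_def card_gt_0_iff)
  define \<mu> where "\<mu> = (\<Sum>v\<in>V. Z v) / N"
  define \<rho> where "\<rho> = \<mu> + lam * M"
  have \<mu>0: "\<mu> \<ge> 0" using Z N by (auto simp: \<mu>_def sum_nonneg)
  have M0: "M \<ge> 0" using Z neV by force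
  have \<rho>: "\<rho> \<ge> \<mu>" using M0 lam by (simp add: \<rho>_def)
  define T where "T = (\<lambda>\<phi> v. sqrt (Z v) * adj_op V a (\<lambda>u. sqrt (Z u) * \<phi> u) v / real D)"
  define K where "K = (\<lambda>m. (T ^^ m) (\<lambda>v. sqrt (Z v)))"
  have KS: "K (Suc m) v = sqrt (Z v) * adj_op V a (\<lambda>u. sqrt (Z u) * K m u) v / real D" for m v
    by (simp add: K_def T_def)
  let ?E = "\<lambda>m v. measure_pmf.expectation (walk_from V a m v) (\<lambda>\<omega>. \<Prod>x\<leftarrow>\<omega>. Z x)"
  have E: "?E m v = sqrt (Z v) * K m v" if "v \<in> V" for m v
    using that
  proof (induction m arbitrary: v)
    case 0
    thus ?case using Z by (simp add: K_def)
  next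
    case (Suc m)
    have "?E (Suc m) v = adj_op V a (\<lambda>u. Z v * ?E m u) v / real D"
      unfolding expectation_walk_from_Suc[OF Suc.prems] by simp
    also have "\<dots> = Z v * adj_op V a (?E m) v / real D" by (simp add: adj_op_def sum_distrib_left mult_ac)
    also have "adj_op V a (?E m) v = adj_op V a (\<lambda>u. sqrt (Z u) * K m u) v"
      unfolding adj_op_def using Suc.IH by simp
    also have "Z v = sqrt (Z v) * sqrt (Z v)" using Z Suc.prems by simp
    finally show ?case by (simp add: KS)
  qed
  have K0: "L2_set (K 0) V = sqrt (N * \<mu>)" using Z N by (simp add: K_def L2_set_def \<mu>_def)
  have Kn: "L2_set (K m) V \<le> \<rho> ^ m * sqrt (N * \<mu>)" for m
  proof (induction m)
    case 0
    thus ?case by (simp add: K0)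
  next
    case (Suc m)
    have "L2_set (K (Suc m)) V \<le> \<rho> * L2_set (K m) V"
      using weighted_step_norm[OF Z lam, where \<phi> = "K m"] by (simp add: KS[abs_def] \<rho>_def \<mu>_def N_def)
    also have "\<dots> \<le> \<rho> * (\<rho> ^ m * sqrt (N * \<mu>))" using Suc \<rho> \<mu>0 by (intro mult_left_mono) auto
    finally show ?case by simp
  qed
  have "(\<Sum>v\<in>V. ?E (l - 1) v) = (\<Sum>v\<in>V. sqrt (Z v) * K (l - 1) v)" by (intro sum.cong) (auto simp: E)
  also have "\<dots> \<le> (\<Sum>v\<in>V. \<bar>K 0 v\<bar> * \<bar>K (l - 1) v\<bar>)" 
    using Z by (intro sum_mono) (auto simp: K_def intro!: mult_left_mono)
  also have "\<dots> \<le> L2_set (K 0) V * L2_set (K (l - 1)) V" by (rule L2_set_mult_ineq)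
  also have "\<dots> \<le> sqrt (N * \<mu>) * (\<rho> ^ (l - 1) * sqrt (N * \<mu>))" unfolding K0 using Kn N \<mu>0 by (intro mult_left_mono) auto
  also have "\<dots> = N * (\<mu> * \<rho> ^ (l - 1))" using N \<mu>0 by simp
  \<comment> \<open>There are \<open>l\<close> weights but only \<open>l - 1\<close> steps. The two
    end factors contribute \<open>N * \<mu>\<close>, and \<open>\<mu> \<le> \<rho>\<close> completes
    the power.\<close>
  also have "\<dots> \<le> N * (\<rho> * \<rho> ^ (l - 1))" using N \<rho> \<mu>0 by (intro mult_left_mono mult_right_mono) auto
  also have "\<rho> * \<rho> ^ (l - 1) = \<rho> ^ l" using l by (cases l) auto
  finally have "(\<Sum>v\<in>V. ?E (l - 1) v) / N \<le> \<rho> ^ l" using N by (simp add: field_simps)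
  thus ?thesis unfolding expectation_walk by (simp add: N_def \<rho>_def \<mu>_def)
qed

end

text \<open>\<open>P\<close> describes an interval. If the median lies outside it, good entries
  cannot occur on both sides of the median, so all positions up to \<open>l div 2\<close> or all
  positions from there on are bad, in each case at least half of the list.\<close>

lemma sort_nth_median_bad:
  fixes xs :: "'a :: linorder list"
  assumes conv: "\<And>x y z. x \<le> y \<Longrightarrow> y \<le> z \<Longrightarrow> P x \<Longrightarrow> P z \<Longrightarrow> P y"
    and l: "length xs = l" "l > 0" and bad: "\<not> P (sort xs ! (l div 2))"
  shows "l \<le> 2 * card {i. i < l \<and> \<not> P (xs ! i)}"
proof -
  define ys m where "ys = sort xs" and "m = l div 2"
  have ly: "length ys = l" using l by (simp add: ys_def)
  have ml: "m < l" using l by (simp add: m_def)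
  have mono: "i \<le> j \<Longrightarrow> j < l \<Longrightarrow> ys ! i \<le> ys ! j" for i j
    using sorted_nth_mono[of ys i j] ly by (simp add: ys_def)
  have "l \<le> 2 * card {i. i < l \<and> \<not> P (ys ! i)}"
  proof (cases "\<exists>i\<le>m. P (ys ! i)")
    case True
    then obtain i where i: "i \<le> m" "P (ys ! i)" by blast
    have "\<not> P (ys ! j)" if "m \<le> j" "j < l" for j
      using conv[of "ys ! i" "ys ! m" "ys ! j"] mono i ml that bad by (auto simp: ys_def m_def)
    hence "{m..<l} \<subseteq> {i. i < l \<and> \<not> P (ys ! i)}" by auto
    hence "card {m..<l} \<le> card {i. i < l \<and> \<not> P (ys ! i)}" by (intro card_mono) auto
    thus ?thesis by (simp add: m_def)
  next
    case False
    hence "{..m} \<subseteq> {i. i < l \<and> \<not> P (ys ! i)}" using ml by auto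
    hence "card {..m} \<le> card {i. i < l \<and> \<not> P (ys ! i)}" by (intro card_mono) auto
    thus ?thesis by (simp add: m_def)
  qed
  also have "card {i. i < l \<and> \<not> P (ys ! i)} = length (filter (\<lambda>x. \<not> P x) ys)"
    by (simp add: length_filter_conv_card ly)
  also have "\<dots> = length (filter (\<lambda>x. \<not> P x) xs)"
    unfolding ys_def by (metis filter_sort length_sort)
  also have "\<dots> = card {i. i < l \<and> \<not> P (xs ! i)}" by (simp add: length_filter_conv_card l)
  finally show ?thesis .
qed

lemma ereal_dist_le_iff: "\<bar>y - ereal x\<bar> \<le> ereal e \<longleftrightarrow> ereal (x - e) \<le> y \<and> y \<le> ereal (x + e)"
  by (cases y) auto

context
  fixes V :: "'v set" and a :: "'v \<Rightarrow> 'v \<Rightarrow> nat" and D :: nat and lam :: real and l :: nat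
  assumes reg: "regular V a D" and D: "D > 0" and neV: "V \<noteq> {}"
    and eig: "second_abs_eig V a \<le> real D * lam" and lam: "lam > 0" and l: "l > 0"
begin

lemma cardV_pos: "real (card V) > 0"
  using fin_V[OF reg] neV by (simp add: card_gt_0_iff)

text \<open>The weight 8 balances the two charges: the mean is at most \<open>1 + 7 / 16\<close>,
  the spectral term at most \<open>8 / 16\<close>, together \<open>31 / 16\<close>. Markov's
  inequality compares this per step with \<open>sqrt 8\<close>, the weight per step when half of the
  entries are bad.\<close>

lemma walk_majority_bad:
  assumes lam16: "lam \<le> 1 / 16" and bad: "real (card {v \<in> V. P v}) \<le> 1 / 16 * real (card V)"
  shows "measure_pmf.prob (walk V a l) {\<omega>. l \<le> 2 * card {i. i < l \<and> P (\<omega> ! i)}} \<le> exp (- real l / 4)"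
proof -
  note finV = fin_V[OF reg]
  define Z where "Z = (\<lambda>v. if P v then 8 else (1::real))"
  define c where "c = (\<lambda>\<omega>. card {i. i < l \<and> P (\<omega> ! i)})"
  have prodZ: "(\<Prod>x\<leftarrow>\<omega>. Z x) = 8 ^ c \<omega>" if len: "length \<omega> = l" for \<omega>
  proof -
    have "(\<Prod>x\<leftarrow>xs. Z x) = 8 ^ length (filter P xs)" for xs by (induction xs) (auto simp: Z_def)
    thus ?thesis by (simp add: c_def length_filter_conv_card len)
  qed
  have "measure_pmf.prob (walk V a l) {\<omega>. l \<le> 2 * c \<omega>}
     \<le> measure_pmf.expectation (walk V a l) (\<lambda>\<omega>. (\<Prod>x\<leftarrow>\<omega>. Z x) / sqrt 8 ^ l)"
  proof (rule prob_le_expectation)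
    show "finite (set_pmf (walk V a l))" by (rule finite_walk[OF reg D neV])
    fix \<omega> assume "\<omega> \<in> set_pmf (walk V a l)"
    hence len: "length \<omega> = l" using set_walk[OF reg D neV l] by auto
    show "0 \<le> (\<Prod>x\<leftarrow>\<omega>. Z x) / sqrt 8 ^ l" by (simp add: prodZ[OF len])
    assume "l \<le> 2 * c \<omega>"
    hence "sqrt 8 ^ l \<le> sqrt 8 ^ (2 * c \<omega>)" by (intro power_increasing) auto
    also have "\<dots> = 8 ^ c \<omega>" by (simp add: power_mult)
    finally show "1 \<le> (\<Prod>x\<leftarrow>\<omega>. Z x) / sqrt 8 ^ l" by (simp add: prodZ[OF len])
  qed
  also have "\<dots> = measure_pmf.expectation (walk V a l) (\<lambda>\<omega>. \<Prod>x\<leftarrow>\<omega>. Z x) / sqrt 8 ^ l" by simp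
  also have "\<dots> \<le> ((\<Sum>v\<in>V. Z v) / real (card V) + lam * 8) ^ l / sqrt 8 ^ l"
    using lam l by (intro divide_right_mono expectation_walk_prod[OF reg D neV _ _ eig]) (auto simp: Z_def)
  also have "\<dots> \<le> (31 / 16) ^ l / sqrt 8 ^ l"
  proof (intro divide_right_mono power_mono)
    have "(\<Sum>v\<in>V. Z v) = (\<Sum>v\<in>V. 1 + 7 * of_bool (P v))" by (intro sum.cong) (auto simp: Z_def)
    also have "\<dots> = real (card V) + 7 * real (card {v \<in> V. P v})"
      using finV by (simp add: sum.distrib sum.If_cases of_bool_def Int_def flip: sum_distrib_left)
    also have "\<dots> \<le> 23 / 16 * real (card V)" using bad by simp
    finally have "(\<Sum>v\<in>V. Z v) / real (card V) \<le> 23 / 16" using cardV_pos by (simp add: field_simps)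
    thus "(\<Sum>v\<in>V. Z v) / real (card V) + lam * 8 \<le> 31 / 16" using lam16 by simp
    show "0 \<le> (\<Sum>v\<in>V. Z v) / real (card V) + lam * 8"
      using lam by (intro add_nonneg_nonneg divide_nonneg_nonneg sum_nonneg) (auto simp: Z_def)
  qed simp
  also have "\<dots> = (31 / 16 / sqrt 8) ^ l" by (simp only: power_divide)
  also have "\<dots> \<le> exp (- 1 / 4) ^ l"
  proof (intro power_mono)
    have "exp (1 / 4 :: real) \<le> 7 / 5"
    proof (rule power_le_imp_le_base)
      have "exp (1 / 4 :: real) ^ Suc 3 = exp 1" by (simp flip: exp_of_nat_mult)
      thus "exp (1 / 4 :: real) ^ Suc 3 \<le> (7 / 5) ^ Suc 3" using exp_le by (simp add: power_numeral_reduce)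
    qed simp
    moreover have "sqrt 8 \<ge> 14 / 5" by (rule real_le_rsqrt) (simp add: power2_eq_square)
    moreover have "31 / 16 * exp (1 / 4 :: real) \<le> 31 / 16 * (7 / 5)" using calculation(1) by simp
    ultimately have "31 / 16 * exp (1 / 4 :: real) \<le> sqrt 8" by linarith
    thus "31 / 16 / sqrt 8 \<le> exp (- 1 / 4)" by (simp add: exp_minus field_simps)
  qed simp
  also have "\<dots> = exp (- real l / 4)" by (simp flip: exp_of_nat_mult)
  finally show ?thesis by (simp add: c_def)
qed

text \<open>\<open>expectation_walk_prod\<close> involves the maximum of the weight, for which
  \<open>W\<close> offers no suitable bound, so \<open>W\<close> is cut at the \<open>M\<close> that
  makes \<open>lam * M\<close> constant. Some vertex of the walk passes the cut with probability at
  most \<open>3 * l / M\<close>, which is proportional to \<open>l * lam\<close>.\<close>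

lemma walk_prod_tail:
  fixes W :: "'v \<Rightarrow> real"
  assumes W: "\<And>v. W v \<ge> 1" and mean: "(\<Sum>v\<in>V. W v) \<le> 3 * real (card V)"
    and laml: "lam \<le> exp (- real l)" and l3: "l \<ge> 3"
  shows "measure_pmf.prob (walk V a l) {\<omega>. 2 ^ (33 * l) < (\<Prod>x\<leftarrow>\<omega>. W x)} \<le> exp (- real l / 4)"
proof -
  note finV = fin_V[OF reg]
  note finW = finite_walk[OF reg D neV, of l]
  define M where "M = 2 ^ 31 / lam"
  have M: "M > 0" using lam by (simp add: M_def)
  define Z where "Z = (\<lambda>v. min (W v) M)"
  have Z: "0 \<le> Z v" "Z v \<le> M" for v using W[of v] M by (auto simp: Z_def)
  let ?p = "walk V a l"
  have "measure_pmf.prob ?p {\<omega>. 2 ^ (33 * l) < (\<Prod>x\<leftarrow>\<omega>. W x)}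
     \<le> measure_pmf.prob ?p ({\<omega>. \<exists>x\<in>set \<omega>. M < W x} \<union> {\<omega>. 2 ^ (33 * l) < (\<Prod>x\<leftarrow>\<omega>. Z x)})"
  proof (intro measure_pmf.finite_measure_mono subsetI)
    fix \<omega> assume \<omega>: "\<omega> \<in> {\<omega>. 2 ^ (33 * l) < (\<Prod>x\<leftarrow>\<omega>. W x)}"
    show "\<omega> \<in> {\<omega>. \<exists>x\<in>set \<omega>. M < W x} \<union> {\<omega>. 2 ^ (33 * l) < (\<Prod>x\<leftarrow>\<omega>. Z x)}"
    proof (cases "\<exists>x\<in>set \<omega>. M < W x")
      case False
      hence "map W \<omega> = map Z \<omega>" by (auto simp: Z_def)
      thus ?thesis using \<omega> by (simp del: map_eq_conv)
    qed simp
  qed simp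
  also have "\<dots> \<le> measure_pmf.prob ?p {\<omega>. \<exists>x\<in>set \<omega>. M < W x} + measure_pmf.prob ?p {\<omega>. 2 ^ (33 * l) < (\<Prod>x\<leftarrow>\<omega>. Z x)}"
    by (rule measure_Un_le) auto
  also have "measure_pmf.prob ?p {\<omega>. \<exists>x\<in>set \<omega>. M < W x} \<le> 1 / 2 * exp (- real l / 4)"
  proof -
    have nn: "(\<Sum>x\<leftarrow>\<omega>. of_bool (M < W x)) \<ge> (0::real)" for \<omega> by (intro sum_list_nonneg) auto
    have "measure_pmf.prob ?p {\<omega>. \<exists>x\<in>set \<omega>. M < W x} \<le> measure_pmf.expectation ?p (\<lambda>\<omega>. \<Sum>x\<leftarrow>\<omega>. of_bool (M < W x))"
    proof (rule prob_le_expectation[OF finW nn])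
      fix \<omega> assume "\<exists>x\<in>set \<omega>. M < W x"
      then obtain x where x: "x \<in> set \<omega>" "M < W x" by blast
      have "of_bool (M < W x) \<in> set (map (\<lambda>x. of_bool (M < W x)) \<omega>)" using x(1) by auto
      hence "(of_bool (M < W x) :: real) \<le> (\<Sum>x\<leftarrow>\<omega>. of_bool (M < W x))"
        by (intro member_le_sum_list) auto
      thus "1 \<le> (\<Sum>x\<leftarrow>\<omega>. of_bool (M < W x) :: real)" using x by simp
    qed
    also have "\<dots> = real l * ((\<Sum>v\<in>V. of_bool (M < W v)) / real (card V))"
      by (rule expectation_walk_sum[OF reg D neV l])
    also have "\<dots> \<le> real l * (3 / M)"
    proof (intro mult_left_mono)
      have "M * (\<Sum>v\<in>V. of_bool (M < W v)) = (\<Sum>v\<in>V. M * of_bool (M < W v))" by (rule sum_distrib_left)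
      also have "\<dots> \<le> (\<Sum>v\<in>V. W v)"
      proof (rule sum_mono)
        fix v show "M * of_bool (M < W v) \<le> W v" using W[of v] by auto
      qed
      also note mean
      finally show "(\<Sum>v\<in>V. of_bool (M < W v)) / real (card V) \<le> 3 / M"
        using M cardV_pos by (simp add: field_simps)
    qed simp
    also have "\<dots> = 3 / 2 ^ 31 * (real l * lam)" using lam by (simp add: M_def)
    also have "\<dots> \<le> 3 / 2 ^ 31 * (real l * exp (- real l))" using laml by (intro mult_left_mono) auto
    also have "real l * exp (- real l) \<le> 2 * exp (- real l / 4)"
    proof -
      have "real l / 2 \<le> exp (real l / 2)" using exp_ge_add_one_self[of "real l / 2"] by linarith
      hence "real l * exp (- real l) \<le> 2 * exp (real l / 2) * exp (- real l)" by (intro mult_right_mono) auto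
      also have "\<dots> = 2 * exp (- real l / 2)" by (simp flip: exp_add)
      also have "\<dots> \<le> 2 * exp (- real l / 4)" by simp
      finally show ?thesis .
    qed
    finally have "measure_pmf.prob ?p {\<omega>. \<exists>x\<in>set \<omega>. M < W x} \<le> 3 / 2 ^ 31 * (2 * exp (- real l / 4))" by simp
    also have "\<dots> = 3 / 2 ^ 30 * exp (- real l / 4)" by simp
    also have "\<dots> \<le> 1 / 2 * exp (- real l / 4)" by (intro mult_right_mono) auto
    finally show ?thesis .
  qed
  also have "measure_pmf.prob ?p {\<omega>. 2 ^ (33 * l) < (\<Prod>x\<leftarrow>\<omega>. Z x)} \<le> 1 / 2 * exp (- real l / 4)"
  proof -
    have pn: "0 \<le> (\<Prod>x\<leftarrow>\<omega>. Z x)" for \<omega> using Z by (induction \<omega>) auto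
    have "measure_pmf.prob ?p {\<omega>. 2 ^ (33 * l) < (\<Prod>x\<leftarrow>\<omega>. Z x)}
      \<le> measure_pmf.expectation ?p (\<lambda>\<omega>. (\<Prod>x\<leftarrow>\<omega>. Z x) / 2 ^ (33 * l))"
      using pn by (intro prob_le_expectation[OF finW]) auto
    also have "\<dots> = measure_pmf.expectation ?p (\<lambda>\<omega>. \<Prod>x\<leftarrow>\<omega>. Z x) / 2 ^ (33 * l)" by simp
    also have "\<dots> \<le> ((\<Sum>v\<in>V. Z v) / real (card V) + lam * M) ^ l / 2 ^ (33 * l)"
      using lam l Z by (intro divide_right_mono expectation_walk_prod[OF reg D neV _ _ eig]) auto
    also have "\<dots> \<le> (3 + 2 ^ 31) ^ l / 2 ^ (33 * l)"
    proof (intro divide_right_mono power_mono add_mono)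
      have "(\<Sum>v\<in>V. Z v) \<le> (\<Sum>v\<in>V. W v)" by (intro sum_mono) (simp add: Z_def)
      also note mean
      finally show "(\<Sum>v\<in>V. Z v) / real (card V) \<le> 3" using cardV_pos by (simp add: field_simps)
      show "lam * M \<le> 2 ^ 31" using lam by (simp add: M_def)
      show "0 \<le> (\<Sum>v\<in>V. Z v) / real (card V) + lam * M"
        using lam M Z by (intro add_nonneg_nonneg divide_nonneg_nonneg sum_nonneg) auto
    qed simp
    \<comment> \<open>The base is barely above \<open>1 / 4\<close>: the budget of 33 bits exceeds
      the spectral charge \<open>2 ^ 31\<close> by two bits.\<close>
    also have "\<dots> = ((3 + 2 ^ 31) / 2 ^ 33) ^ l" by (simp only: power_divide power_mult)
    also have "\<dots> \<le> (1 / 3) ^ l" by (intro power_mono) auto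
    also have "\<dots> \<le> exp (- 1) ^ l"
    proof (intro power_mono)
      show "1 / 3 \<le> exp (- 1 :: real)" using exp_le by (simp add: exp_minus field_simps)
    qed simp
    also have "\<dots> = exp (- (3 / 4) * real l) * exp (- real l / 4)" by (simp flip: exp_of_nat_mult exp_add)
    also have "\<dots> \<le> 1 / 2 * exp (- real l / 4)"
    proof (intro mult_right_mono)
      have "2 \<le> 1 + 3 / 4 * real l" using l3 by simp
      also have "\<dots> \<le> exp (3 / 4 * real l)" by (rule exp_ge_add_one_self)
      finally show "exp (- (3 / 4) * real l) \<le> 1 / 2" by (simp add: exp_minus field_simps)
    qed simp
    finally show ?thesis .
  qed
  finally show ?thesis by simp
qed

end

section \<open>The median estimate\<close>

text \<open>At a level up to \<open>qmax\<close> accurate seeds give accurate rows, so a wrong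
  median needs half of the seeds to be inaccurate. At a larger level, minimality of
  \<open>qfun\<close> says that \<open>qmax\<close> violates the bit budget, and the concavity bound
  on the bits of each row turns this into a large product of the \<open>W\<close>.\<close>

lemma (in sketch) estimate_bad_imp:
  assumes len: "length \<omega> = l" "l > 0"
    and bad: "\<bar>estimate l b (tau2 FE GE HE A \<omega> (qfun FE GE HE A l b \<omega>)) (qfun FE GE HE A l b \<omega>) - ereal (real (card A))\<bar>
        > ereal (\<epsilon> * real (card A))"
  shows "l \<le> 2 * card {i. i < l \<and> \<not> good (\<omega> ! i)} \<or> 2 ^ (33 * l) < (\<Prod>x\<leftarrow>\<omega>. W x)"
proof (cases "qfun FE GE HE A l b \<omega> \<le> qmax")
  case True
  define q where "q = qfun FE GE HE A l b \<omega>"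
  define P where "P = (\<lambda>y. \<bar>y - ereal (real (card A))\<bar> \<le> ereal (\<epsilon> * real (card A)))"
  define xs where "xs = map (\<lambda>i. row_estimate b (tau2 FE GE HE A \<omega> q i) q) [0..<l]"
  have "\<not> P (sort xs ! (l div 2))"
    using bad unfolding q_def[symmetric] P_def estimate_eq_median_rows xs_def by simp
  hence "l \<le> 2 * card {i. i < l \<and> \<not> P (xs ! i)}"
    using len(2) by (intro sort_nth_median_bad) (auto simp: P_def ereal_dist_le_iff xs_def intro: order_trans)
  also have "card {i. i < l \<and> \<not> P (xs ! i)} \<le> card {i. i < l \<and> \<not> good (\<omega> ! i)}"
  proof (intro card_mono subsetI)
    fix i assume "i \<in> {i. i < l \<and> \<not> P (xs ! i)}"
    hence i: "i < l" "\<not> P (row_estimate b (tau1 FE GE HE A (\<omega> ! i) q) q)"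
      by (auto simp: xs_def tau2_def[abs_def])
    thus "i \<in> {i. i < l \<and> \<not> good (\<omega> ! i)}" using True by (auto simp: good_def P_def q_def)
  qed simp
  finally show ?thesis by simp
next
  case False
  have W_pos: "0 < W x" for x using W_ge_1[of x] by linarith
  let ?s = "\<lambda>i. \<Sum>j<b. \<lfloor>log 2 (real_of_int (tau1 FE GE HE A (\<omega> ! i) qmax j) + 2)\<rfloor>"
  have "\<not> (\<Sum>i<l. ?s i) \<le> int (33 * b * l)"
    using False not_less_Least[of qmax "\<lambda>q. (\<Sum>i<l. \<Sum>j<b. \<lfloor>log 2 (real_of_int (tau2 FE GE HE A \<omega> q i j) + 2)\<rfloor>) \<le> int (33 * b * l)"]
    by (simp add: qfun_def tau2_def)
  hence "real_of_int (int (33 * b * l)) < real_of_int (\<Sum>i<l. ?s i)" by (simp only: of_int_less_iff not_le)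
  also have "\<dots> = (\<Sum>i<l. real_of_int (?s i))" by (rule of_int_sum)
  also have "\<dots> \<le> (\<Sum>i<l. real b * log 2 (W (\<omega> ! i)))" by (intro sum_mono sum_floor_log_tau_le)
  finally have "real b * (33 * real l) < real b * (\<Sum>i<l. log 2 (W (\<omega> ! i)))" by (simp add: sum_distrib_left)
  hence "33 * real l < (\<Sum>i<l. log 2 (W (\<omega> ! i)))" using b_pos by simp
  also have "\<dots> = log 2 (\<Prod>i<l. W (\<omega> ! i))"
  proof -
    have "ln (\<Prod>i<l. W (\<omega> ! i)) = (\<Sum>i<l. ln (W (\<omega> ! i)))"
      using W_pos by (intro ln_prod) (simp_all add: less_imp_neq[symmetric])
    thus ?thesis by (simp add: log_def sum_divide_distrib)
  qed
  also have "(\<Prod>i<l. W (\<omega> ! i)) = (\<Prod>x\<leftarrow>\<omega>. W x)"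
    using len(1) by (simp add: prod.list_conv_set_nth lessThan_atLeast0)
  finally have "real (33 * l) < log 2 (\<Prod>x\<leftarrow>\<omega>. W x)" by simp
  moreover have "0 < (\<Prod>x\<leftarrow>\<omega>. W x)" using W_pos by (induction \<omega>) simp_all
  ultimately have "2 powr real (33 * l) < (\<Prod>x\<leftarrow>\<omega>. W x)" by (simp add: less_log_iff)
  moreover have "2 powr real (33 * l) = 2 ^ (33 * l)" by (rule powr_realpow) simp
  ultimately show ?thesis by simp
qed

theorem theorem7:
  fixes n :: nat and \<epsilon> \<delta> :: real and A :: "nat set"
    and df dg dh :: nat and pf pg ph :: "bit poly"
    and adj :: "seed \<Rightarrow> seed \<Rightarrow> nat" and D :: nat
    and l b k :: nat and lam :: real and \<Psi> :: "seed set"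
    and FE GE HE :: "nat list \<Rightarrow> nat \<Rightarrow> nat"
  assumes "n \<ge> 1" and "0 < \<epsilon>" and "\<epsilon> < 1"
    and "1 \<le> \<delta> * ln (real n)" and "\<delta> < 1"
  defines "l \<equiv> nat \<lceil>4 * ln (2 / \<delta>)\<rceil>"
    and "b \<equiv> 2 ^ nat \<lceil>log 2 (9 * 2 ^ 23 / \<epsilon> ^ 2)\<rceil>"
    and "k \<equiv> nat \<lceil>15 / 2 * ln (real b) + 16\<rceil>"
    and "lam \<equiv> min (1 / 16) (exp (- real l * ln (real l) ^ 3))"
  assumes "irreducible pf" and "degree pf = df" and "n \<le> 2 ^ df"
    and "irreducible pg" and "degree pg = dg" and "n \<le> 2 ^ dg" and "2 ^ 5 * b ^ 2 \<le> 2 ^ dg"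
    and "irreducible ph" and "degree ph = dh" and "2 ^ 5 * b ^ 2 \<le> 2 ^ dh" and "b \<le> 2 ^ dh"
  defines "FE \<equiv> hashG df pf"
    and "GE \<equiv> hashH dg pg (2 ^ 5 * b ^ 2)"
    and "HE \<equiv> hashH dh ph b"
    and "\<Psi> \<equiv> seeds df 2 \<times> seeds dg 2 \<times> seeds dh k"
  assumes "expander \<Psi> adj D lam" and "D > 0"
    and "A \<subseteq> {..<n}" and "A \<noteq> {}"
  shows "measure_pmf.prob (walk \<Psi> adj l)
           {\<omega>. \<bar>estimate l b (tau2 FE GE HE A \<omega> (qfun FE GE HE A l b \<omega>)) (qfun FE GE HE A l b \<omega>)
                 - ereal (real (card A))\<bar> > ereal (\<epsilon> * real (card A))} \<le> \<delta>"
proof -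
  define r where "r = nat \<lceil>log 2 (9 * 2 ^ 23 / \<epsilon> ^ 2)\<rceil>"
  have br: "b = 2 ^ r" by (simp add: b_def r_def)
  have e2: "0 < \<epsilon> ^ 2" "\<epsilon> ^ 2 \<le> 1" using \<open>0 < \<epsilon>\<close> \<open>\<epsilon> < 1\<close> by (auto simp: power_le_one)
  have big: "9 * 2 ^ 23 \<le> 9 * 2 ^ 23 / \<epsilon> ^ 2" using e2 by (simp add: field_simps)
  have "23 = log 2 (2 ^ 23 :: real)" by (subst log_pow_cancel) auto
  also have "\<dots> \<le> log 2 (9 * 2 ^ 23 / \<epsilon> ^ 2)" using big by (subst log_le_cancel_iff) auto
  finally have rge: "log 2 (9 * 2 ^ 23 / \<epsilon> ^ 2) \<le> real r" and r16: "r \<ge> 16" unfolding r_def by linarith+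
  have "9 * 2 ^ 23 / \<epsilon> ^ 2 \<le> 2 powr real r" using rge e2 by (subst (asm) log_le_iff) auto
  hence bge: "real b * \<epsilon>\<^sup>2 \<ge> 9 * 2 ^ 23" using e2 by (simp add: br powr_realpow field_simps)
  have b1: "b \<ge> 1" by (simp add: br)
  have lnb: "0 \<le> ln (real b)" "ln (real b) \<le> real b"
    using b1 ln_le_minus_one[of "real b"] by auto
  have k1: "15 / 2 * ln (real b) \<le> real k" and k2: "k \<ge> 2" using lnb unfolding k_def by linarith+
  \<comment> \<open>The third field must have at least \<open>k\<close> elements, since
    \<open>gf_eval_indep\<close> needs \<open>k\<close> distinct points.\<close>
  have "real k \<le> 15 / 2 * ln (real b) + 17" using lnb unfolding k_def by linarith
  also have "\<dots> \<le> 32 * real b" using lnb b1 by linarith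
  also have "\<dots> \<le> real (2 ^ 5 * b ^ 2)" using b1 by (simp add: power2_eq_square)
  also have "\<dots> \<le> real (2 ^ dh)" using \<open>2 ^ 5 * b ^ 2 \<le> 2 ^ dh\<close> by (rule of_nat_mono)
  finally have k3: "k \<le> 2 ^ dh" by (simp only: of_nat_le_iff)
  interpret sketch \<epsilon> A b r k df dg dh pf pg ph FE GE HE \<Psi>
  proof
    show "A \<subseteq> {..<2 ^ df}" "A \<subseteq> {..<2 ^ dg}"
      using \<open>A \<subseteq> {..<n}\<close> \<open>n \<le> 2 ^ df\<close> \<open>n \<le> 2 ^ dg\<close> by (auto intro: less_le_trans)
  qed (fact | simp only: FE_def GE_def HE_def \<Psi>_def)+
  have \<delta>: "\<delta> > 0"
  proof (rule ccontr)
    assume "\<not> \<delta> > 0"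
    hence "\<delta> * ln (real n) \<le> 0" using \<open>n \<ge> 1\<close> by (intro mult_nonpos_nonneg) auto
    thus False using \<open>1 \<le> \<delta> * ln (real n)\<close> by simp
  qed
  have "ln 2 \<le> ln (2 / \<delta>)" using \<delta> \<open>\<delta> < 1\<close> by (subst ln_le_cancel_iff) (auto simp: field_simps)
  moreover have "ln (2::real) > 1 / 2"
  proof -
    have "exp (1 / 2 :: real) < 2"
    proof (rule power_less_imp_less_base)
      have "exp (1 / 2 :: real) ^ 2 = exp 1" by (simp flip: exp_of_nat_mult)
      thus "exp (1 / 2 :: real) ^ 2 < 2 ^ 2" using exp_le by simp
    qed simp
    thus ?thesis by (metis exp_less_cancel_iff exp_ln zero_less_numeral)
  qed
  \<comment> \<open>Since \<open>2 / \<delta> > 2\<close> and \<open>ln 2 > 1 / 2\<close>, the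
    ceiling is at least 3. This exceeds \<open>e\<close>, so \<open>ln l\<close> is at least 1 and
    \<open>lam\<close> is at most \<open>exp (- l)\<close>.\<close>
  ultimately have l3: "l \<ge> 3" and lge: "4 * ln (2 / \<delta>) \<le> real l" unfolding l_def by linarith+
  \<comment> \<open>The factor 4 in \<open>l\<close> matches the exponent of both tail bounds, and
    the 2 in \<open>2 / \<delta>\<close> divides \<open>\<delta>\<close> between the two
    events.\<close>
  have "exp (- real l / 4) \<le> exp (- ln (2 / \<delta>))" using lge by simp
  also have "\<dots> = \<delta> / 2" using \<delta> by (simp add: exp_minus)
  finally have el: "exp (- real l / 4) \<le> \<delta> / 2" .
  have "exp 1 \<le> real l" using exp_le l3 by linarith
  hence "1 \<le> ln (real l)" using l3 by (subst ln_ge_iff) auto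
  hence "real l * 1 \<le> real l * ln (real l) ^ 3" by (intro mult_left_mono one_le_power) auto
  hence "exp (- real l * ln (real l) ^ 3) \<le> exp (- real l)" by simp
  hence lam: "lam > 0" "lam \<le> 1 / 16" "lam \<le> exp (- real l)" by (auto simp: lam_def min_le_iff_disj)
  have reg: "regular \<Psi> adj D" and eig: "second_abs_eig \<Psi> adj \<le> real D * lam"
    using \<open>expander \<Psi> adj D lam\<close> by (auto simp: expander_def)
  have "card \<Psi> > 0" by (simp add: \<Psi>_def card_cartesian_product card_seeds)
  hence ne: "\<Psi> \<noteq> {}" by auto
  have l0: "l > 0" using l3 by simp
  let ?p = "walk \<Psi> adj l"
  let ?B1 = "{\<omega>. l \<le> 2 * card {i. i < l \<and> \<not> good (\<omega> ! i)}}"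
  let ?B2 = "{\<omega>. 2 ^ (33 * l) < (\<Prod>x\<leftarrow>\<omega>. W x)}"
  let ?E = "{\<omega>. \<bar>estimate l b (tau2 FE GE HE A \<omega> (qfun FE GE HE A l b \<omega>)) (qfun FE GE HE A l b \<omega>)
                 - ereal (real (card A))\<bar> > ereal (\<epsilon> * real (card A))}"
  have "measure_pmf.prob ?p ?E \<le> measure_pmf.prob ?p (?B1 \<union> ?B2)"
  proof (rule measure_pmf.finite_measure_mono_AE)
    \<comment> \<open>The inclusion holds only on the support, where every list has length
      \<open>l\<close>.\<close>
    have "\<omega> \<in> ?B1 \<union> ?B2" if "\<omega> \<in> ?E" "\<omega> \<in> set_pmf ?p" for \<omega>
    proof -
      have "length \<omega> = l" using set_walk[OF reg \<open>D > 0\<close> ne l0] that(2) by auto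
      thus ?thesis using estimate_bad_imp[OF _ l0, of \<omega>] that(1) by blast
    qed
    thus "AE \<omega> in measure_pmf ?p. \<omega> \<in> ?E \<longrightarrow> \<omega> \<in> ?B1 \<union> ?B2" unfolding AE_measure_pmf_iff by blast
  qed simp
  also have "\<dots> \<le> measure_pmf.prob ?p ?B1 + measure_pmf.prob ?p ?B2"
    by (rule measure_Un_le) auto
  also have "measure_pmf.prob ?p ?B1 \<le> \<delta> / 2"
    using walk_majority_bad[OF reg \<open>D > 0\<close> ne eig lam(1) l0 lam(2) bad_count] el by simp
  also have "measure_pmf.prob ?p ?B2 \<le> \<delta> / 2"
    using walk_prod_tail[OF reg \<open>D > 0\<close> ne eig lam(1) l0 W_ge_1 W_mean lam(3) l3] el by simp
  finally show ?thesis by simp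
qed

end
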